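(* Let the errors be independent sub-Gaussian with parameter $\sigma^2$, i.e. $\mathbb{E}e^{u\epsilon_i}\le\exp(u^2\sigma^2/2)$ for all $u\in\mathbb{R}$, and let $\Gamma>0$. (1) If $\Omega\in\mathscr{P}_k$ is a polytopal domain in $\mathbb{R}^d$, then $$R_\nu(n;\mathcal{C}(\Gamma))\le \mathfrak{C}\,(k/n)^{4/(d+4)}.$$ (2) If $\Omega\subset\mathbb{R}^d$ is a smooth convex body, then $$R_\nu(n;\mathcal{C}(\Gamma))\le \mathfrak{C}\cdot\begin{cases} n^{-2/3}\log n, & d=2,\\ n^{-2/(d+1)}, & d\ge 3,\end{cases}$$ where for $d=2$ the conclusion holds for $n$ large enough. Here $\mathfrak{C}$ denotes a constant depending only on $d,|\Omega|,\Gamma,\sigma,\nu$.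
   Context: Random design regression model: $\Omega\subset\mathbb{R}^d$ is a convex body, $X_1,\dots,X_n$ are i.i.d. from a probability measure $\nu$ on $\Omega$, absolutely continuous with respect to Lebesgue measure $\lambda$ with $\nu_{\max}:=\sup_{x\in\Omega}\frac{d\nu}{d\lambda}(x)<\infty$ and $\nu_{\min}:=\inf_{x\in\Omega}\frac{d\nu}{d\lambda}(x)>0$; $Y_i=f(X_i)+\epsilon_i$, where the errors are mean zero and independent of the $X_i$'s. The loss is $l_\nu^2(f,g):=\int_\Omega (f-g)^2\,d\nu$, and $R_\nu(n;\mathcal{F}):=\inf_{\hat f_n}\sup_{f\in\mathcal{F}}\mathbb{E}_f\,l_\nu^2(f,\hat f_n)$, the infimum being over all estimators based on $(X_i,Y_i)_{i=1}^n$. $\mathcal{C}(\Gamma)$ is the class of convex functions $f$ on $\Omega$ with $\sup_\Omega|f|\le\Gamma$. $|\cdot|$ denotes Lebesgue volume. $\mathscr{P}_k$ is the collection of polytopes that can be written as a union of at most $k$ simplices with pairwise disjoint interiors. Smooth convex body: a sequence of simplices $\{D_i\}_{i\ge1}$ contained in $\Omega$ is admissible if their interiors are pairwise disjoint. Let $S(t,\{D_i\};\Omega):=\min\{m\in\mathbb{N}:|\Omega\setminus\cup_{i=1}^m D_i|\le t|\Omega|\}$ and $S(t;\Omega):=\inf S(t,\{D_i\};\Omega)$ over all admissible sequences. $\Omega$ is smooth if $\limsup_{t\to0}t^{(d-1)/2}S(t;\Omega)<\infty$. *)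

theory Defs
  imports "HOL-Probability.Probability"
begin

definition convex_body :: "'a::euclidean_space set \<Rightarrow> bool" where
  "convex_body \<Omega> \<longleftrightarrow> convex \<Omega> \<and> compact \<Omega> \<and> interior \<Omega> \<noteq> {}"

abbreviation vol :: "'a::euclidean_space set \<Rightarrow> real" where
  "vol \<equiv> measure lborel"

section \<open>Polytopal and smooth domains\<close>

abbreviation full_simplex :: "'a::euclidean_space set \<Rightarrow> bool" where
  "full_simplex D \<equiv> int DIM('a) simplex D"

definition simplicial_polytopes :: "nat \<Rightarrow> 'a::euclidean_space set set" where
  "simplicial_polytopes k = {\<Omega>. polytope \<Omega> \<and>
     (\<exists>\<D>. finite \<D> \<and> card \<D> \<le> k \<and> (\<forall>D\<in>\<D>. full_simplex D) \<and>
          pairwise (\<lambda>D D'. interior D \<inter> interior D' = {}) \<D> \<and> \<Omega> = \<Union>\<D>)}"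

text \<open>Sequences are indexed by the positive integers; the value at \<open>0\<close> is irrelevant.\<close>

definition admissible :: "'a::euclidean_space set \<Rightarrow> (nat \<Rightarrow> 'a set) \<Rightarrow> bool" where
  "admissible \<Omega> D \<longleftrightarrow> (\<forall>i\<ge>1. full_simplex (D i) \<and> D i \<subseteq> \<Omega>) \<and>
     (\<forall>i\<ge>1. \<forall>j\<ge>1. i \<noteq> j \<longrightarrow> interior (D i) \<inter> interior (D j) = {})"

text \<open>The value is \<open>\<infinity>\<close> if no \<open>m\<close> achieves the required accuracy.\<close>

definition simplex_number_seq :: "real \<Rightarrow> (nat \<Rightarrow> 'a::euclidean_space set) \<Rightarrow> 'a set \<Rightarrow> enat" where
  "simplex_number_seq t D \<Omega> =
     (INF m\<in>{m. vol (\<Omega> - (\<Union>i\<in>{1..m}. D i)) \<le> t * vol \<Omega>}. enat m)"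

definition simplex_number :: "real \<Rightarrow> 'a::euclidean_space set \<Rightarrow> enat" where
  "simplex_number t \<Omega> = (INF D\<in>{D. admissible \<Omega> D}. simplex_number_seq t D \<Omega>)"

definition smooth_convex_body :: "'a::euclidean_space set \<Rightarrow> bool" where
  "smooth_convex_body \<Omega> \<longleftrightarrow> convex_body \<Omega> \<and>
     Limsup (at_right 0) (\<lambda>t. ennreal (t powr ((real DIM('a) - 1) / 2)) *
       ennreal_of_enat (simplex_number t \<Omega>)) < \<infinity>"

section \<open>The regression model\<close>

text \<open>
  \<open>p\<close> is a version of the density of \<open>\<nu>\<close> with respect to Lebesgue measure on \<open>\<Omega>\<close>; its values
  outside \<open>\<Omega>\<close> are irrelevant.
\<close>

definition density_inf :: "'a set \<Rightarrow> ('a \<Rightarrow> ennreal) \<Rightarrow> ennreal" where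
  "density_inf \<Omega> p = (INF x\<in>\<Omega>. p x)"

definition density_sup :: "'a set \<Rightarrow> ('a \<Rightarrow> ennreal) \<Rightarrow> ennreal" where
  "density_sup \<Omega> p = (SUP x\<in>\<Omega>. p x)"

definition design_law ::
  "'a::euclidean_space set \<Rightarrow> 'a measure \<Rightarrow> ('a \<Rightarrow> ennreal) \<Rightarrow> bool" where
  "design_law \<Omega> \<nu> p \<longleftrightarrow> prob_space \<nu> \<and> p \<in> borel_measurable borel \<and>
     \<nu> = density lborel (\<lambda>x. p x * indicator \<Omega> x) \<and>
     density_inf \<Omega> p > 0 \<and> density_sup \<Omega> p < \<infinity>"

text \<open>\<open>Q\<close> is the joint law of the error vector \<open>(\<epsilon>\<^sub>1, \<dots>, \<epsilon>\<^sub>n)\<close>.\<close>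

definition subgaussian_errors :: "nat \<Rightarrow> real \<Rightarrow> (nat \<Rightarrow> real) measure \<Rightarrow> bool" where
  "subgaussian_errors n \<sigma> Q \<longleftrightarrow>
     prob_space Q \<and> sets Q = sets (\<Pi>\<^sub>M i\<in>{1..n}. borel) \<and>
     prob_space.indep_vars Q (\<lambda>_. borel) (\<lambda>i e. e i) {1..n} \<and>
     (\<forall>i\<in>{1..n}. integrable Q (\<lambda>e. e i) \<and> (\<integral>e. e i \<partial>Q) = 0 \<and>
        (\<forall>u. (\<integral>\<^sup>+e. ennreal (exp (u * e i)) \<partial>Q) \<le> ennreal (exp (u\<^sup>2 * \<sigma>\<^sup>2 / 2))))"

definition bounded_convex :: "'a::euclidean_space set \<Rightarrow> real \<Rightarrow> ('a \<Rightarrow> real) set" where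
  "bounded_convex \<Omega> \<Gamma> = {f. convex_on \<Omega> f \<and> (\<forall>x\<in>\<Omega>. \<bar>f x\<bar> \<le> \<Gamma>)}"

text \<open>
  A convex function on \<open>\<Omega>\<close> is continuous on the interior but may fail to be Borel on the boundary,
  a null set. The lower integral \<open>\<integral>\<^sup>+\<close> does not see such a failure: the values of \<open>sq_loss\<close> and
  \<open>risk\<close> below are unaffected by changing \<open>f\<close> on a Borel null set so as to make it measurable.
\<close>

definition sq_loss ::
  "'a::euclidean_space set \<Rightarrow> 'a measure \<Rightarrow> ('a \<Rightarrow> real) \<Rightarrow> ('a \<Rightarrow> real) \<Rightarrow> ennreal" where
  "sq_loss \<Omega> \<nu> f g = (\<integral>\<^sup>+x\<in>\<Omega>. ennreal ((f x - g x)\<^sup>2) \<partial>\<nu>)"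

text \<open>
  An estimator maps the data \<open>(X\<^sub>i, Y\<^sub>i)\<close>, \<open>1 \<le> i \<le> n\<close>, to a function; joint measurability in data and
  point makes its expected loss well defined.
\<close>

definition estimators :: "nat \<Rightarrow> ((nat \<Rightarrow> 'a::euclidean_space \<times> real) \<Rightarrow> 'a \<Rightarrow> real) set" where
  "estimators n = {fhat. (\<lambda>(z, x). fhat z x) \<in>
     borel_measurable ((\<Pi>\<^sub>M i\<in>{1..n}. borel \<Otimes>\<^sub>M borel) \<Otimes>\<^sub>M borel)}"

definition sample :: "nat \<Rightarrow> ('a \<Rightarrow> real) \<Rightarrow> (nat \<Rightarrow> 'a) \<Rightarrow> (nat \<Rightarrow> real) \<Rightarrow> nat \<Rightarrow> 'a \<times> real" where
  "sample n f X \<epsilon> = (\<lambda>i\<in>{1..n}. (X i, f (X i) + \<epsilon> i))"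

text \<open>
  The product measure makes the design points i.i.d. with law \<open>\<nu>\<close> and independent of the errors.
\<close>

definition risk ::
  "'a::euclidean_space set \<Rightarrow> 'a measure \<Rightarrow> (nat \<Rightarrow> real) measure \<Rightarrow> nat \<Rightarrow> ('a \<Rightarrow> real) \<Rightarrow>
   ((nat \<Rightarrow> 'a \<times> real) \<Rightarrow> 'a \<Rightarrow> real) \<Rightarrow> ennreal" where
  "risk \<Omega> \<nu> Q n f fhat =
     (\<integral>\<^sup>+(X, \<epsilon>). sq_loss \<Omega> \<nu> f (fhat (sample n f X \<epsilon>)) \<partial>((\<Pi>\<^sub>M i\<in>{1..n}. \<nu>) \<Otimes>\<^sub>M Q))"

definition minimax_risk ::
  "'a::euclidean_space set \<Rightarrow> 'a measure \<Rightarrow> (nat \<Rightarrow> real) measure \<Rightarrow> nat \<Rightarrow> ('a \<Rightarrow> real) set \<Rightarrow>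
   ennreal" where
  "minimax_risk \<Omega> \<nu> Q n F = (INF fhat\<in>estimators n. SUP f\<in>F. risk \<Omega> \<nu> Q n f fhat)"

end

theory Submission
  imports Defs
begin

text \<open>
  The estimator is least squares over a finite net of the class. If \<open>f\<close> is the truth and
  \<open>h = f - g\<close> for a member \<open>g\<close> of the net, the excess empirical loss \<open>Z\<close> of \<open>g\<close> over \<open>f\<close>
  satisfies \<open>E exp (- \<theta> Z) \<le> exp (- \<theta> n \<parallel>h\<parallel>\<^sup>2 / 4)\<close> for small \<open>\<theta>\<close>, so the risk is at most
  a constant times (squared radius of the net + log-cardinality / n), and everything reduces to metric entropy.

  The entropy bounds follow Bronshtein. A convex function is described by its jets (point, slope,
  value); \<open>(point, slope) \<mapsto> point + slope\<close> is expansive, so a grid of mesh \<open>\<epsilon>\<close> in the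
  image records the function up to \<open>\<epsilon>\<^sup>2\<close>, and recording from coarse to fine grids costs only \<open>O(1)\<close> bits per
  cell, without a logarithmic factor. Unbounded slopes are rescaled dyadically: near a vertex of a
  simplex, a slope of size \<open>2\<^sup>i\<close> along an edge direction forces the corresponding barycentric coordinate
  to be \<open>O(2\<^sup>-\<^sup>i)\<close>, which yields \<open>\<epsilon>\<^sup>-\<^sup>d\<^sup>/\<^sup>2\<close> per simplex by affine invariance. On a convex body, points
  with slope of size \<open>2\<^sup>i\<close> lie in a boundary layer of width \<open>O(2\<^sup>-\<^sup>i)\<close>; there the graph is read as a graph
  over a vertical coordinate hyperplane, in which the slope in the value direction is only \<open>2\<^sup>-\<^sup>i\<close>. The
  resulting saving makes the total entropy \<open>\<epsilon>\<^sup>-\<^sup>(\<^sup>d\<^sup>-\<^sup>1\<^sup>)\<close>, with a power of a logarithm for \<open>d = 2\<close>.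
\<close>

section \<open>Entropy of families of convex jets\<close>

text \<open>What remains is the choice of meshes. On a simplex a vector i of slope exponents, with
  sum |i|, has entropy r_i^-d and squared error r_i^4 on a set of volume 2^-|i|, so meshes growing
  slowly with |i| make both sums geometric. On a body, layer i has entropy 2^(-i/2) r_i^-d and
  squared error r_i^4 2^i. For d >= 3 the meshes can be tilted so that the outermost layer J
  dominates both sums; for d = 2 the admissible range of tilts is empty, all J layers count alike,
  and this is the source of the logarithm. Slopes beyond 2^J are not recorded: they occur on volume
  O(2^-J), where the trivial bound suffices. All comparisons are one-sided: a recorded minorant of g
  is compared with f, and exchanging f and g is free because equality of labels is symmetric. The
  constants for a body depend on the body itself. This is legitimate because the body is the support
  of \<nu>, hence a function of \<nu>.\<close>

definition splits :: "'f set \<Rightarrow> real \<Rightarrow> ('f \<Rightarrow> 'f \<Rightarrow> bool) \<Rightarrow> bool" where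
  "splits F E R \<longleftrightarrow> (\<exists>\<kappa>::'f \<Rightarrow> nat. finite (\<kappa> ` F) \<and> real (card (\<kappa> ` F)) \<le> exp E \<and>
     (\<forall>f\<in>F. \<forall>g\<in>F. \<kappa> f = \<kappa> g \<longrightarrow> R f g))"

lemma splitsI:
  fixes \<kappa> :: "'f \<Rightarrow> 'c"
  assumes fin: "finite (\<kappa> ` F)" and card: "real (card (\<kappa> ` F)) \<le> exp E"
    and R: "\<And>f g. f \<in> F \<Longrightarrow> g \<in> F \<Longrightarrow> \<kappa> f = \<kappa> g \<Longrightarrow> R f g"
  shows "splits F E R"
proof -
  obtain h :: "'c \<Rightarrow> nat" where h: "inj_on h (\<kappa> ` F)"
    using finite_imp_inj_to_nat_seg[OF fin] by blast
  have "(\<lambda>f. h (\<kappa> f)) ` F = h ` (\<kappa> ` F)" by auto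
  then have "finite ((\<lambda>f. h (\<kappa> f)) ` F)" "card ((\<lambda>f. h (\<kappa> f)) ` F) = card (\<kappa> ` F)"
    using fin card_image[OF h] by auto
  moreover have "R f g" if "f \<in> F" "g \<in> F" "h (\<kappa> f) = h (\<kappa> g)" for f g
    using R[OF that(1,2)] inj_onD[OF h that(3)] that by auto
  ultimately show ?thesis
    unfolding splits_def using card by (intro exI[of _ "\<lambda>f. h (\<kappa> f)"]) auto
qed

lemma splits_mono:
  assumes "splits F E R" "E \<le> E'" "\<And>f g. f \<in> F \<Longrightarrow> g \<in> F \<Longrightarrow> R f g \<Longrightarrow> R' f g"
  shows "splits F E' R'"
  using assms unfolding splits_def by (meson exp_le_cancel_iff order_trans)

lemma splits_trivial: "0 \<le> E \<Longrightarrow> (\<And>f g. f \<in> F \<Longrightarrow> g \<in> F \<Longrightarrow> R f g) \<Longrightarrow> splits F E R"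
proof (rule splitsI[of "\<lambda>_. ()"])
  assume "0 \<le> E"
  have "card ((\<lambda>_. ()) ` F) \<le> card {()}" by (rule card_mono) auto
  then show "real (card ((\<lambda>_. ()) ` F)) \<le> exp E"
    using one_le_exp_iff[of E] \<open>0 \<le> E\<close> by (smt (verit) One_nat_def card.empty card_insert_disjoint empty_iff finite.emptyI of_nat_1 of_nat_le_iff)
qed auto

lemma splits_conj:
  assumes "splits F E R" "splits F E' R'"
  shows "splits F (E + E') (\<lambda>f g. R f g \<and> R' f g)"
proof -
  obtain \<kappa> :: "'a \<Rightarrow> nat" where k: "finite (\<kappa> ` F)" "real (card (\<kappa> ` F)) \<le> exp E"
    "\<forall>f\<in>F. \<forall>g\<in>F. \<kappa> f = \<kappa> g \<longrightarrow> R f g" using assms(1) unfolding splits_def by auto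
  obtain \<kappa>' :: "'a \<Rightarrow> nat" where k': "finite (\<kappa>' ` F)" "real (card (\<kappa>' ` F)) \<le> exp E'"
    "\<forall>f\<in>F. \<forall>g\<in>F. \<kappa>' f = \<kappa>' g \<longrightarrow> R' f g" using assms(2) unfolding splits_def by auto
  have sub: "(\<lambda>f. (\<kappa> f, \<kappa>' f)) ` F \<subseteq> (\<kappa> ` F) \<times> (\<kappa>' ` F)" by auto
  have fin: "finite ((\<kappa> ` F) \<times> (\<kappa>' ` F))" using k k' by auto
  show ?thesis
  proof (rule splitsI[of "\<lambda>f. (\<kappa> f, \<kappa>' f)"])
    show "finite ((\<lambda>f. (\<kappa> f, \<kappa>' f)) ` F)" using finite_subset[OF sub fin] .
    have "real (card ((\<lambda>f. (\<kappa> f, \<kappa>' f)) ` F)) \<le> real (card (\<kappa> ` F)) * real (card (\<kappa>' ` F))"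
      using card_mono[OF fin sub] by (metis card_cartesian_product of_nat_le_iff of_nat_mult)
    also have "\<dots> \<le> exp E * exp E'" using k k' by (intro mult_mono) auto
    finally show "real (card ((\<lambda>f. (\<kappa> f, \<kappa>' f)) ` F)) \<le> exp (E + E')" by (simp add: exp_add)
  qed (use k k' in auto)
qed

text \<open>Equality of labels is symmetric, so a one-sided comparison \<open>R\<close> becomes
  two-sided without new labels. The chart estimates below therefore only bound \<open>f\<close> from
  above in terms of \<open>g\<close>.\<close>

lemma splits_sym: "splits F E R \<Longrightarrow> splits F E (\<lambda>f g. R f g \<and> R g f)"
  unfolding splits_def by metis

lemma splits_Ball:
  assumes "finite I" "\<And>i. i \<in> I \<Longrightarrow> splits F (E i) (R i)"
  shows "splits F (\<Sum>i\<in>I. E i) (\<lambda>f g. \<forall>i\<in>I. R i f g)"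
  using assms
proof (induction I)
  case empty
  show ?case by (simp add: splits_trivial)
next
  case (insert i I)
  have "splits F (E i + (\<Sum>i\<in>I. E i)) (\<lambda>f g. R i f g \<and> (\<forall>i\<in>I. R i f g))"
    using insert by (intro splits_conj) auto
  then show ?case using insert by simp
qed

section \<open>Dyadic grids and tags of jets\<close>

lemma norm_le_coords:
  fixes x :: "'a::euclidean_space"
  assumes "\<And>b. b \<in> Basis \<Longrightarrow> \<bar>x \<bullet> b\<bar> \<le> c"
  shows "norm x \<le> real DIM('a) * c"
proof -
  have "norm x \<le> (\<Sum>b\<in>Basis. \<bar>x \<bullet> b\<bar>)" by (rule norm_le_l1)
  also have "\<dots> \<le> (\<Sum>b\<in>(Basis::'a set). c)" by (intro sum_mono assms)
  finally show ?thesis by simp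
qed

text \<open>Restriction to \<open>Basis\<close> makes cells extensional functions: equal coordinates
  mean equal cells, and the cells of a box form a finite product \<open>\<Pi>\<^sub>E\<close> that
  can be counted.\<close>

definition grid_floor :: "nat \<Rightarrow> 'a::euclidean_space \<Rightarrow> 'a \<Rightarrow> int" where
  "grid_floor l x = (\<lambda>b\<in>Basis. \<lfloor>2 ^ l * (x \<bullet> b)\<rfloor>)"

definition grid_pt :: "nat \<Rightarrow> ('a::euclidean_space \<Rightarrow> int) \<Rightarrow> 'a" where
  "grid_pt l q = (\<Sum>b\<in>Basis. (of_int (q b) / 2 ^ l) *\<^sub>R b)"

text \<open>The slope is not stored: up to order 2^-l it is the difference of the two cells. The
  stored height is that of the affine minorant at the corner of the cell of \<open>u\<close>, not
  \<open>z\<close> itself: the corner is known from the tag, so a height there can be used at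
  accuracy 4^-l, whereas \<open>u\<close> is known only up to 2^-l.\<close>

fun jet_tag :: "nat \<Rightarrow> 'a::euclidean_space \<times> 'a \<times> real \<Rightarrow> ('a \<Rightarrow> int) \<times> ('a \<Rightarrow> int) \<times> int" where
  "jet_tag l (u, w, z) = (grid_floor l (u + w), grid_floor l u,
     \<lfloor>4 ^ l * (z + w \<bullet> (grid_pt l (grid_floor l u) - u))\<rfloor>)"

text \<open>The interpolation condition: the supremum of the affine minorants is convex and takes
  the value \<open>z\<close> at \<open>u\<close> with subgradient \<open>w\<close>. No function is
  mentioned, so the jets may also come from a graph read in other coordinates.\<close>

definition convex_jets :: "('a::euclidean_space \<times> 'a \<times> real) set \<Rightarrow> bool" where
  "convex_jets J \<longleftrightarrow> (\<forall>(u, w, z)\<in>J. \<forall>(u', w', z')\<in>J. z + w \<bullet> (u' - u) \<le> z')"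

lemma grid_pt_inner: "b \<in> Basis \<Longrightarrow> grid_pt l q \<bullet> b = of_int (q b) / 2 ^ l"
  unfolding grid_pt_def by (simp add: inner_sum_left inner_Basis if_distrib sum.If_cases cong: if_cong)

lemma grid_floor_apply: "b \<in> Basis \<Longrightarrow> grid_floor l x b = \<lfloor>2 ^ l * (x \<bullet> b)\<rfloor>"
  by (simp add: grid_floor_def)

lemma grid_pt_floor:
  fixes x :: "'a::euclidean_space"
  assumes "b \<in> Basis"
  shows "0 \<le> (x - grid_pt l (grid_floor l x)) \<bullet> b" "(x - grid_pt l (grid_floor l x)) \<bullet> b \<le> 1 / 2 ^ l"
proof -
  have "of_int \<lfloor>2 ^ l * (x \<bullet> b)\<rfloor> \<le> 2 ^ l * (x \<bullet> b)" "2 ^ l * (x \<bullet> b) \<le> of_int \<lfloor>2 ^ l * (x \<bullet> b)\<rfloor> + 1"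
    by linarith+
  then have "of_int \<lfloor>2 ^ l * (x \<bullet> b)\<rfloor> / 2 ^ l \<le> x \<bullet> b" "x \<bullet> b \<le> (of_int \<lfloor>2 ^ l * (x \<bullet> b)\<rfloor> + 1) / 2 ^ l"
    by (simp_all add: pos_divide_le_eq pos_le_divide_eq mult.commute)
  then show "0 \<le> (x - grid_pt l (grid_floor l x)) \<bullet> b" "(x - grid_pt l (grid_floor l x)) \<bullet> b \<le> 1 / 2 ^ l"
    using assms by (auto simp: inner_diff_left grid_pt_inner grid_floor_apply add_divide_distrib)
qed

lemma norm_grid_pt_floor:
  fixes x :: "'a::euclidean_space"
  shows "norm (x - grid_pt l (grid_floor l x)) \<le> real DIM('a) / 2 ^ l"
  using norm_le_coords[of "x - grid_pt l (grid_floor l x)" "1 / 2 ^ l"] grid_pt_floor[of _ x l] by fastforce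

lemma same_cell:
  fixes x y :: "'a::euclidean_space"
  assumes "grid_floor l x = grid_floor l y"
  shows "b \<in> Basis \<Longrightarrow> \<bar>(x - y) \<bullet> b\<bar> \<le> 1 / 2 ^ l" and "norm (x - y) \<le> real DIM('a) / 2 ^ l"
proof -
  show *: "\<bar>(x - y) \<bullet> b\<bar> \<le> 1 / 2 ^ l" if "b \<in> Basis" for b
    using grid_pt_floor[OF that, of x l] grid_pt_floor[OF that, of y l] assms
    by (simp add: inner_diff_left abs_le_iff)
  show "norm (x - y) \<le> real DIM('a) / 2 ^ l" using norm_le_coords[of "x - y" "1 / 2 ^ l"] * by simp
qed

text \<open>Monotonicity of subgradients makes \<open>(u, w) \<mapsto> u + w\<close> expansive.\<close>

lemma convex_jets_expansive:
  assumes "convex_jets J" "(u, w, z) \<in> J" "(u', w', z') \<in> J"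
  shows "norm (u - u') \<le> norm ((u + w) - (u' + w'))" "norm (w - w') \<le> norm ((u + w) - (u' + w'))"
    and "z - z' - w' \<bullet> (u - u') \<ge> 0" "z - z' - w' \<bullet> (u - u') \<le> norm (u - u') * norm (w - w')"
proof -
  have 1: "z + w \<bullet> (u' - u) \<le> z'" "z' + w' \<bullet> (u - u') \<le> z"
    using assms unfolding convex_jets_def by fast+
  have "0 \<le> (w - w') \<bullet> (u - u')" using 1 by (simp add: inner_diff_left inner_diff_right)
  then have i: "0 \<le> (u - u') \<bullet> (w - w')" by (simp add: inner_commute)
  have e: "(u + w) - (u' + w') = (u - u') + (w - w')" by simp
  have "norm ((u + w) - (u' + w'))^2 = norm (u - u')^2 + 2 * ((u - u') \<bullet> (w - w')) + norm (w - w')^2"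
    unfolding e by (simp add: power2_norm_eq_inner inner_add_left inner_add_right inner_commute)
  then have "norm (u - u')^2 \<le> norm ((u + w) - (u' + w'))^2" "norm (w - w')^2 \<le> norm ((u + w) - (u' + w'))^2"
    using i by auto
  then show "norm (u - u') \<le> norm ((u + w) - (u' + w'))" "norm (w - w') \<le> norm ((u + w) - (u' + w'))"
    by (auto intro: power2_le_imp_le)
  show "z - z' - w' \<bullet> (u - u') \<ge> 0" using 1 by simp
  have "z - z' - w' \<bullet> (u - u') \<le> (u - u') \<bullet> (w - w')"
    using 1 by (simp add: inner_diff_left inner_diff_right inner_commute)
  also have "\<dots> \<le> norm (u - u') * norm (w - w')" by (rule norm_cauchy_schwarz)
  finally show "z - z' - w' \<bullet> (u - u') \<le> norm (u - u') * norm (w - w')" .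
qed

text \<open>First-order extrapolation from a coarse tag to the corner of a finer cell, with the
  difference of the two stored cells in place of the slope.\<close>

fun predict :: "nat \<Rightarrow> ('a::euclidean_space \<Rightarrow> int) \<times> ('a \<Rightarrow> int) \<times> int \<Rightarrow> ('a \<Rightarrow> int) \<Rightarrow> real" where
  "predict l (q, \<pi>, v) \<pi>' = of_int v / 4 ^ l + (grid_pt l q - grid_pt l \<pi>) \<bullet> (grid_pt (Suc l) \<pi>' - grid_pt l \<pi>)"

text \<open>The two jets only share the coarse cell of \<open>u + w\<close>. Expansiveness then
  makes points, slopes and corners differ by O(2^-l), and every error term is of the order of a
  product of two such differences, hence O(4^-l). This second-order accuracy leaves boundedly many
  heights at the next level.\<close>

lemma predict_error:
  fixes u w :: "'a::euclidean_space"
  assumes J: "convex_jets J" "(u, w, z) \<in> J" "(u0, w0, z0) \<in> J"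
    and cell: "grid_floor l (u + w) = grid_floor l (u0 + w0)"
  shows "\<bar>z + w \<bullet> (grid_pt (Suc l) (grid_floor (Suc l) u) - u)
     - predict l (jet_tag l (u0, w0, z0)) (grid_floor (Suc l) u)\<bar> \<le> 6 * (real DIM('a))\<^sup>2 / 4 ^ l"
proof -
  define D where "D = real DIM('a) / 2 ^ l"
  define a where "a = grid_pt (Suc l) (grid_floor (Suc l) u)"
  define a0 where "a0 = grid_pt l (grid_floor l u0)"
  define c where "c = grid_pt l (grid_floor l (u0 + w0)) - a0"
  define v where "v = \<lfloor>4 ^ l * (z0 + w0 \<bullet> (a0 - u0))\<rfloor>"
  have D0: "D \<ge> 0" by (simp add: D_def)
  have dim: "real DIM('a) \<ge> 1" using DIM_positive[where 'a='a] by linarith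
  have D2: "D * D = (real DIM('a))\<^sup>2 / 4 ^ l"
    by (simp add: D_def power2_eq_square power_mult_distrib[symmetric])
  have uw: "norm ((u + w) - (u0 + w0)) \<le> D" unfolding D_def by (rule same_cell(2)[OF cell])
  have nu: "norm (u - u0) \<le> D" and nw: "norm (w - w0) \<le> D"
    using convex_jets_expansive(1,2)[OF J] uw by linarith+
  have e1: "0 \<le> z - z0 - w0 \<bullet> (u - u0)" "z - z0 - w0 \<bullet> (u - u0) \<le> D * D"
    using convex_jets_expansive(3,4)[OF J] mult_mono[OF nu nw D0 norm_ge_zero] by linarith+
  have na: "norm (a - u) \<le> D"
  proof -
    have "norm (u - a) \<le> real DIM('a) / 2 ^ Suc l" unfolding a_def by (rule norm_grid_pt_floor)
    also have "\<dots> \<le> D" by (simp add: D_def field_simps)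
    finally show ?thesis by (simp add: norm_minus_commute)
  qed
  have na0: "norm (u0 - a0) \<le> D" unfolding a0_def D_def by (rule norm_grid_pt_floor)
  have naa: "norm (a - a0) \<le> 3 * D"
    using norm_triangle_ineq[of "a - u" "u - u0"] norm_triangle_ineq[of "a - u0" "u0 - a0"] na nu na0 by simp
  have nc: "norm (w0 - c) \<le> D"
  proof -
    have "\<bar>(w0 - c) \<bullet> b\<bar> \<le> 1 / 2 ^ l" if "b \<in> Basis" for b
    proof -
      have "(w0 - c) \<bullet> b = (u0 + w0 - grid_pt l (grid_floor l (u0 + w0))) \<bullet> b - (u0 - a0) \<bullet> b"
        by (simp add: c_def algebra_simps)
      then show ?thesis using grid_pt_floor[OF that, of "u0 + w0" l] grid_pt_floor[OF that, of u0 l]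
        unfolding a0_def by linarith
    qed
    from norm_le_coords[OF this] show ?thesis by (simp add: D_def)
  qed
  have v: "0 \<le> z0 + w0 \<bullet> (a0 - u0) - v / 4 ^ l" "z0 + w0 \<bullet> (a0 - u0) - v / 4 ^ l \<le> D * D"
  proof -
    have "of_int v \<le> 4 ^ l * (z0 + w0 \<bullet> (a0 - u0))" "4 ^ l * (z0 + w0 \<bullet> (a0 - u0)) \<le> of_int v + 1"
      unfolding v_def by linarith+
    then have "v / 4 ^ l \<le> z0 + w0 \<bullet> (a0 - u0)" "z0 + w0 \<bullet> (a0 - u0) \<le> (v + 1) / 4 ^ l"
      by (simp_all add: pos_divide_le_eq pos_le_divide_eq mult.commute)
    then have *: "0 \<le> z0 + w0 \<bullet> (a0 - u0) - v / 4 ^ l" "z0 + w0 \<bullet> (a0 - u0) - v / 4 ^ l \<le> 1 / 4 ^ l"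
      by (auto simp: add_divide_distrib)
    have "1 / 4 ^ l \<le> D * D" unfolding D2 using dim by (intro divide_right_mono) (auto simp: one_le_power)
    then show "0 \<le> z0 + w0 \<bullet> (a0 - u0) - v / 4 ^ l" "z0 + w0 \<bullet> (a0 - u0) - v / 4 ^ l \<le> D * D"
      using * by linarith+
  qed
  have t1: "\<bar>(w0 - c) \<bullet> (a - a0)\<bar> \<le> D * (3 * D)"
    using Cauchy_Schwarz_ineq2[of "w0 - c" "a - a0"] mult_mono[OF nc naa D0 norm_ge_zero] by linarith
  have t2: "\<bar>(w - w0) \<bullet> (a - u)\<bar> \<le> D * D"
    using Cauchy_Schwarz_ineq2[of "w - w0" "a - u"] mult_mono[OF nw na D0 norm_ge_zero] by linarith
  \<comment> \<open>Four errors: the convexity remainder at \<open>u\<close>, the rounding of the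
    stored height, the error of the reconstructed slope, and the change of slope. They are at most
    \<open>D * D\<close>, \<open>D * D\<close>, \<open>D * (3 * D)\<close> and
    \<open>D * D\<close>.\<close>
  have "z + w \<bullet> (a - u) - (v / 4 ^ l + c \<bullet> (a - a0)) =
     (z - z0 - w0 \<bullet> (u - u0)) + (z0 + w0 \<bullet> (a0 - u0) - v / 4 ^ l) + (w0 - c) \<bullet> (a - a0) + (w - w0) \<bullet> (a - u)"
    by (simp add: inner_diff_left inner_diff_right algebra_simps)
  then have "\<bar>z + w \<bullet> (a - u) - (v / 4 ^ l + c \<bullet> (a - a0))\<bar> \<le> 6 * (D * D)"
    using e1 v t1 t2 by linarith
  then show ?thesis unfolding D2 by (simp add: a_def[symmetric] a0_def[symmetric] c_def[symmetric] v_def)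
qed

section \<open>Counting tag sets from coarse to fine\<close>

definition cells :: "nat \<Rightarrow> ('a::euclidean_space \<Rightarrow> real) \<Rightarrow> ('a \<Rightarrow> int) set" where
  "cells l a = (\<Pi>\<^sub>E b\<in>Basis. {\<lfloor>- (2 ^ l * (4 * a b))\<rfloor>..\<lfloor>2 ^ l * (4 * a b)\<rfloor>})"

text \<open>The candidates compatible with one coarse tag. Points differ by at most
  \<open>DIM('a) / 2 ^ l\<close>, which gives the window for the cell of \<open>u\<close>; the
  window \<open>24 * DIM('a)^2\<close> for heights is the prediction error
  \<open>6 * DIM('a)^2 / 4 ^ l\<close> in units of 4^-(l+1). The extra units absorb
  rounding.\<close>

fun near_tags :: "nat \<Rightarrow> ('a::euclidean_space \<Rightarrow> int) \<times> ('a \<Rightarrow> int) \<times> int \<Rightarrow> (('a \<Rightarrow> int) \<times> int) set" where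
  "near_tags l (q, \<pi>, v) =
     (SIGMA \<pi>':(\<Pi>\<^sub>E b\<in>Basis. {2 * \<pi> b - 2 * int DIM('a) - 1..2 * \<pi> b + 2 * int DIM('a) + 2}).
        {\<lfloor>4 ^ Suc l * predict l (q, \<pi>, v) \<pi>'\<rfloor> - 24 * (int DIM('a))\<^sup>2 - 1..
         \<lfloor>4 ^ Suc l * predict l (q, \<pi>, v) \<pi>'\<rfloor> + 24 * (int DIM('a))\<^sup>2 + 1})"

text \<open>For each fine cell a single coarse tag over its parent is picked by \<open>SOME\<close>.
  The candidates thus depend only on the coarse tag set \<open>T\<close>, and their number is
  proportional to the number of fine cells, however many tags share a parent.\<close>

definition next_tags :: "nat \<Rightarrow> ('a::euclidean_space \<Rightarrow> real) \<Rightarrow> (('a \<Rightarrow> int) \<times> ('a \<Rightarrow> int) \<times> int) set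
    \<Rightarrow> (('a \<Rightarrow> int) \<times> ('a \<Rightarrow> int) \<times> int) set" where
  "next_tags l a T = (SIGMA q:cells (Suc l) a.
     near_tags l (SOME \<tau>. \<tau> \<in> T \<and> fst \<tau> = (\<lambda>b\<in>Basis. q b div 2)))"

lemma finite_cells [simp]: "finite (cells l a)"
  unfolding cells_def by (intro finite_PiE) auto

text \<open>The count depends on the dimension only: this is the bounded number of bits spent per
  cell.\<close>

lemma near_tags_bound:
  fixes \<tau> :: "('a::euclidean_space \<Rightarrow> int) \<times> ('a \<Rightarrow> int) \<times> int"
  shows "finite (near_tags l \<tau>)"
    and "card (near_tags l \<tau>) = (4 * DIM('a) + 4) ^ DIM('a) * (48 * DIM('a)\<^sup>2 + 3)"
proof -
  obtain q \<pi> v where \<tau>: "\<tau> = (q, \<pi>, v)" by (metis prod.exhaust)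
  have fin: "finite (\<Pi>\<^sub>E b\<in>Basis. {2 * \<pi> b - 2 * int DIM('a) - 1..2 * \<pi> b + 2 * int DIM('a) + 2})"
    by (intro finite_PiE) auto
  show "finite (near_tags l \<tau>)" unfolding \<tau> near_tags.simps by (intro finite_SigmaI fin) auto
  have "card (\<Pi>\<^sub>E b\<in>(Basis::'a set). {2 * \<pi> b - 2 * int DIM('a) - 1..2 * \<pi> b + 2 * int DIM('a) + 2})
      = (4 * DIM('a) + 4) ^ DIM('a)"
    by (simp add: card_PiE nat_add_distrib nat_mult_distrib add.commute)
  moreover have "nat (2 * (24 * (int DIM('a))\<^sup>2) + 3) = 48 * DIM('a)\<^sup>2 + 3"
    by (simp add: nat_add_distrib nat_mult_distrib nat_power_eq)
  ultimately show "card (near_tags l \<tau>) = (4 * DIM('a) + 4) ^ DIM('a) * (48 * DIM('a)\<^sup>2 + 3)"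
    unfolding \<tau> near_tags.simps using fin by (subst card_SigmaI) (auto simp: algebra_simps)
qed

lemma floor_cell:
  fixes x :: "'a::euclidean_space"
  assumes "\<And>b. b \<in> Basis \<Longrightarrow> \<bar>x \<bullet> b\<bar> \<le> 4 * a b"
  shows "grid_floor l x \<in> cells l a"
proof -
  have "\<lfloor>- (2 ^ l * (4 * a b))\<rfloor> \<le> \<lfloor>2 ^ l * (x \<bullet> b)\<rfloor> \<and> \<lfloor>2 ^ l * (x \<bullet> b)\<rfloor> \<le> \<lfloor>2 ^ l * (4 * a b)\<rfloor>"
    if b: "b \<in> Basis" for b
  proof (intro conjI floor_mono)
    have "x \<bullet> b \<le> 4 * a b" "- (4 * a b) \<le> x \<bullet> b" using assms[OF b] by linarith+
    from this(1) show "2 ^ l * (x \<bullet> b) \<le> 2 ^ l * (4 * a b)" by (intro mult_left_mono) auto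
    have "2 ^ l * (- (4 * a b)) \<le> 2 ^ l * (x \<bullet> b)" using \<open>- (4 * a b) \<le> x \<bullet> b\<close> by (intro mult_left_mono) auto
    then show "- (2 ^ l * (4 * a b)) \<le> 2 ^ l * (x \<bullet> b)" by simp
  qed
  then show ?thesis unfolding cells_def grid_floor_def by auto
qed

text \<open>Dyadic cells are nested, so halving the indices yields the parent cell.\<close>

lemma grid_floor_Suc: "(\<lambda>b\<in>Basis. grid_floor (Suc l) x b div 2) = grid_floor l x"
proof -
  have "\<lfloor>2 ^ Suc l * y\<rfloor> div 2 = \<lfloor>2 ^ l * y\<rfloor>" for y :: real
    using floor_divide_real_eq_div[of 2 "2 ^ Suc l * y"] by simp
  then show ?thesis by (auto simp: grid_floor_def restrict_def fun_eq_iff)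
qed

lemma floor_double_near:
  fixes x y :: real
  assumes "\<bar>x - y\<bar> \<le> real n"
  shows "2 * \<lfloor>y\<rfloor> - 2 * int n - 1 \<le> \<lfloor>2 * x\<rfloor> \<and> \<lfloor>2 * x\<rfloor> \<le> 2 * \<lfloor>y\<rfloor> + 2 * int n + 2"
proof -
  have "real_of_int (2 * \<lfloor>y\<rfloor> - 2 * int n - 1) \<le> 2 * x" "2 * x < real_of_int (2 * \<lfloor>y\<rfloor> + 2 * int n + 2) + 1"
    using assms floor_correct[of y] by simp_all linarith+
  then show ?thesis by (simp add: le_floor_iff floor_le_iff)
qed

lemma floor_near:
  fixes x y :: real
  assumes "\<bar>x - y\<bar> \<le> of_int c"
  shows "\<lfloor>y\<rfloor> - c - 1 \<le> \<lfloor>x\<rfloor> \<and> \<lfloor>x\<rfloor> \<le> \<lfloor>y\<rfloor> + c + 1"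
  using assms by linarith

lemma jet_tag_next:
  fixes J :: "('a::euclidean_space \<times> 'a \<times> real) set"
  assumes J: "convex_jets J"
    and bd: "\<And>u w z b. (u, w, z) \<in> J \<Longrightarrow> b \<in> Basis \<Longrightarrow> \<bar>u \<bullet> b\<bar> \<le> 2 * a b \<and> \<bar>w \<bullet> b\<bar> \<le> 2 * a b"
  shows "jet_tag (Suc l) ` J \<subseteq> next_tags l a (jet_tag l ` J)"
proof
  fix \<tau>' assume "\<tau>' \<in> jet_tag (Suc l) ` J"
  then obtain u w z where j: "(u, w, z) \<in> J" and \<tau>'_eq: "\<tau>' = jet_tag (Suc l) (u, w, z)"
    by (clarsimp simp del: jet_tag.simps)
  let ?q = "grid_floor (Suc l) (u + w)"
  \<comment> \<open>The picked tag may belong to another jet of \<open>J\<close>; sharing the coarse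
    cell is all that the prediction estimate asks for.\<close>
  define \<tau> where "\<tau> = (SOME \<tau>. \<tau> \<in> jet_tag l ` J \<and> fst \<tau> = (\<lambda>b\<in>Basis. ?q b div 2))"
  have "\<exists>\<tau>. \<tau> \<in> jet_tag l ` J \<and> fst \<tau> = (\<lambda>b\<in>Basis. ?q b div 2)"
    unfolding grid_floor_Suc by (rule exI[of _ "jet_tag l (u, w, z)"]) (use imageI[OF j, of "jet_tag l"] in simp)
  then have "\<tau> \<in> jet_tag l ` J \<and> fst \<tau> = (\<lambda>b\<in>Basis. ?q b div 2)" unfolding \<tau>_def by (rule someI_ex)
  then have "\<tau> \<in> jet_tag l ` J" "fst \<tau> = grid_floor l (u + w)" unfolding grid_floor_Suc by auto
  then obtain u0 w0 z0 where j0: "(u0, w0, z0) \<in> J" and \<tau>: "\<tau> = jet_tag l (u0, w0, z0)"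
    and cell: "grid_floor l (u + w) = grid_floor l (u0 + w0)" by auto
  define v0 where "v0 = \<lfloor>4 ^ l * (z0 + w0 \<bullet> (grid_pt l (grid_floor l u0) - u0))\<rfloor>"
  have \<tau>0: "\<tau> = (grid_floor l (u0 + w0), grid_floor l u0, v0)" unfolding \<tau> v0_def by simp
  have "norm (u - u0) \<le> real DIM('a) / 2 ^ l"
    using convex_jets_expansive(1)[OF J j j0] same_cell(2)[OF cell] by linarith
  then have ub: "\<bar>(u - u0) \<bullet> b\<bar> \<le> real DIM('a) / 2 ^ l" if "b \<in> Basis" for b
    using Basis_le_norm[OF that, of "u - u0"] by linarith
  have pos: "grid_floor (Suc l) u \<in> (\<Pi>\<^sub>E b\<in>Basis. {2 * grid_floor l u0 b - 2 * int DIM('a) - 1..2 * grid_floor l u0 b + 2 * int DIM('a) + 2})"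
  proof -
    have "2 * \<lfloor>2 ^ l * (u0 \<bullet> b)\<rfloor> - 2 * int DIM('a) - 1 \<le> \<lfloor>2 ^ Suc l * (u \<bullet> b)\<rfloor>
      \<and> \<lfloor>2 ^ Suc l * (u \<bullet> b)\<rfloor> \<le> 2 * \<lfloor>2 ^ l * (u0 \<bullet> b)\<rfloor> + 2 * int DIM('a) + 2" if "b \<in> Basis" for b
    proof -
      have "\<bar>2 ^ l * (u \<bullet> b) - 2 ^ l * (u0 \<bullet> b)\<bar> \<le> real DIM('a)"
      proof -
        have "\<bar>2 ^ l * (u \<bullet> b) - 2 ^ l * (u0 \<bullet> b)\<bar> = 2 ^ l * \<bar>(u - u0) \<bullet> b\<bar>"
          unfolding inner_diff_left right_diff_distrib[symmetric] abs_mult by simp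
        also have "\<dots> \<le> 2 ^ l * (real DIM('a) / 2 ^ l)" by (intro mult_left_mono ub that) auto
        finally show ?thesis by simp
      qed
      from floor_double_near[OF this] show ?thesis by (simp add: mult.assoc)
    qed
    then show ?thesis unfolding grid_floor_def by auto
  qed
  have "\<bar>4 ^ Suc l * (z + w \<bullet> (grid_pt (Suc l) (grid_floor (Suc l) u) - u))
     - 4 ^ Suc l * predict l \<tau> (grid_floor (Suc l) u)\<bar> \<le> 4 ^ Suc l * (6 * (real DIM('a))\<^sup>2 / 4 ^ l)"
    (is "\<bar>?c * ?x - ?c * ?y\<bar> \<le> _")
  proof -
    have "\<bar>?x - ?y\<bar> \<le> 6 * (real DIM('a))\<^sup>2 / 4 ^ l" unfolding \<tau> by (rule predict_error[OF J j j0 cell])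
    then have "?c * \<bar>?x - ?y\<bar> \<le> ?c * (6 * (real DIM('a))\<^sup>2 / 4 ^ l)" by (rule mult_left_mono) simp
    moreover have "\<bar>?c * ?x - ?c * ?y\<bar> = ?c * \<bar>?x - ?y\<bar>"
      unfolding right_diff_distrib[symmetric] abs_mult by simp
    ultimately show ?thesis by linarith
  qed
  also have "\<dots> = 24 * (real DIM('a))\<^sup>2" by simp
  finally have val: "\<bar>4 ^ Suc l * (z + w \<bullet> (grid_pt (Suc l) (grid_floor (Suc l) u) - u))
     - 4 ^ Suc l * predict l \<tau> (grid_floor (Suc l) u)\<bar> \<le> 24 * (real DIM('a))\<^sup>2" .
  have fl: "\<lfloor>y\<rfloor> - 24 * (int DIM('a))\<^sup>2 - 1 \<le> \<lfloor>x\<rfloor> \<and> \<lfloor>x\<rfloor> \<le> \<lfloor>y\<rfloor> + 24 * (int DIM('a))\<^sup>2 + 1"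
    if h: "\<bar>x - y\<bar> \<le> 24 * (real DIM('a))\<^sup>2" for x y :: real
  proof -
    have "real_of_int (24 * (int DIM('a))\<^sup>2) = 24 * (real DIM('a))\<^sup>2" by simp
    then have "\<bar>x - y\<bar> \<le> of_int (24 * (int DIM('a))\<^sup>2)" using h by simp
    from floor_near[OF this] show ?thesis .
  qed
  \<comment> \<open>Each of \<open>u\<close> and \<open>w\<close> is bounded by
    \<open>2 * a b\<close>; this is the origin of the factor 4 in \<open>cells\<close>.\<close>
  have q: "?q \<in> cells (Suc l) a"
  proof (rule floor_cell)
    show "\<bar>(u + w) \<bullet> b\<bar> \<le> 4 * a b" if "b \<in> Basis" for b
      using bd[OF j that] abs_triangle_ineq[of "u \<bullet> b" "w \<bullet> b"] unfolding inner_add_left by linarith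
  qed
  show "\<tau>' \<in> next_tags l a (jet_tag l ` J)"
    unfolding \<tau>'_eq next_tags_def jet_tag.simps
  proof (intro SigmaI q)
    show "(grid_floor (Suc l) u, \<lfloor>4 ^ Suc l * (z + w \<bullet> (grid_pt (Suc l) (grid_floor (Suc l) u) - u))\<rfloor>)
      \<in> near_tags l (SOME \<tau>. \<tau> \<in> jet_tag l ` J \<and> fst \<tau> = (\<lambda>b\<in>Basis. ?q b div 2))"
      unfolding \<tau>_def[symmetric] \<tau>0 near_tags.simps
      using pos fl[OF val] unfolding \<tau>0 by (intro SigmaI) auto
  qed
qed

lemma card_cells:
  fixes a :: "'a::euclidean_space \<Rightarrow> real"
  assumes "\<And>b. b \<in> Basis \<Longrightarrow> 0 \<le> a b"
  shows "real (card (cells l a)) \<le> (\<Prod>b\<in>Basis. 8 * 2 ^ l * a b + 2)"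
proof -
  have "real (card (cells l a)) = (\<Prod>b\<in>Basis. real (card {\<lfloor>- (2 ^ l * (4 * a b))\<rfloor>..\<lfloor>2 ^ l * (4 * a b)\<rfloor>}))"
    unfolding cells_def by (subst card_PiE) auto
  also have "\<dots> \<le> (\<Prod>b\<in>Basis. 8 * 2 ^ l * a b + 2)"
  proof (intro prod_mono conjI)
    fix b :: 'a assume "b \<in> Basis"
    then have "0 \<le> 2 ^ l * (4 * a b)" using assms by simp
    then show "real (card {\<lfloor>- (2 ^ l * (4 * a b))\<rfloor>..\<lfloor>2 ^ l * (4 * a b)\<rfloor>}) \<le> 8 * 2 ^ l * a b + 2"
      by (simp only: card_atLeastAtMost_int) linarith
  qed auto
  finally show ?thesis .
qed

lemma card_next_tags:
  fixes a :: "'a::euclidean_space \<Rightarrow> real"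
  assumes "\<And>b. b \<in> Basis \<Longrightarrow> 0 \<le> a b"
  shows "finite (next_tags l a T)"
    and "real (card (next_tags l a T)) \<le>
      real ((4 * DIM('a) + 4) ^ DIM('a) * (48 * DIM('a)\<^sup>2 + 3)) * (\<Prod>b\<in>Basis. 8 * 2 ^ Suc l * a b + 2)"
proof -
  show "finite (next_tags l a T)"
    unfolding next_tags_def by (intro finite_SigmaI finite_cells near_tags_bound)
  have "real (card (next_tags l a T)) = real (card (cells (Suc l) a)) * real ((4 * DIM('a) + 4) ^ DIM('a) * (48 * DIM('a)\<^sup>2 + 3))"
    unfolding next_tags_def
    by (subst card_SigmaI) (auto simp: near_tags_bound simp del: near_tags.simps)
  also have "\<dots> \<le> (\<Prod>b\<in>Basis. 8 * 2 ^ Suc l * a b + 2) * real ((4 * DIM('a) + 4) ^ DIM('a) * (48 * DIM('a)\<^sup>2 + 3))"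
    using card_cells[of a "Suc l"] assms by (intro mult_right_mono) auto
  finally show "real (card (next_tags l a T)) \<le>
      real ((4 * DIM('a) + 4) ^ DIM('a) * (48 * DIM('a)\<^sup>2 + 3)) * (\<Prod>b\<in>Basis. 8 * 2 ^ Suc l * a b + 2)"
    by (simp add: mult.commute)
qed

text \<open>A tag set at level l+1 is a subset of the candidates determined by the tag set at level
  l, so refining multiplies the number of tag sets by at most 2 to the number of candidates. The
  exponents add up over the levels.\<close>

lemma card_jet_tags:
  fixes J :: "'f \<Rightarrow> ('a::euclidean_space \<times> 'a \<times> real) set"
  assumes J: "\<And>f. f \<in> F \<Longrightarrow> convex_jets (J f)"
    and bd: "\<And>f u w z b. f \<in> F \<Longrightarrow> (u, w, z) \<in> J f \<Longrightarrow> b \<in> Basis \<Longrightarrow> \<bar>u \<bullet> b\<bar> \<le> 2 * a b \<and> \<bar>w \<bullet> b\<bar> \<le> 2 * a b"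
    and bz: "\<And>f u w z. f \<in> F \<Longrightarrow> (u, w, z) \<in> J f \<Longrightarrow> \<bar>z\<bar> \<le> 2"
    and a: "\<And>b. b \<in> Basis \<Longrightarrow> 0 \<le> a b" "\<And>b. b \<in> Basis \<Longrightarrow> a b \<le> 1"
  defines "B \<equiv> cells 0 (\<lambda>_::'a. 1) \<times> cells 0 (\<lambda>_::'a. 1) \<times> {- 3 - 2 * (int DIM('a))\<^sup>2..3 + 2 * (int DIM('a))\<^sup>2}"
    and "K \<equiv> real ((4 * DIM('a) + 4) ^ DIM('a) * (48 * DIM('a)\<^sup>2 + 3))"
  shows "finite ((\<lambda>f. jet_tag L ` J f) ` F) \<and> real (card ((\<lambda>f. jet_tag L ` J f) ` F)) \<le>
     2 powr (real (card B) + K * (\<Sum>l<L. \<Prod>b\<in>Basis. 8 * 2 ^ Suc l * a b + 2))"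
proof (induction L)
  case 0
  have finB: "finite B" unfolding B_def by simp
  have "jet_tag 0 ` J f \<subseteq> B" if f: "f \<in> F" for f
  proof
    fix \<tau> assume "\<tau> \<in> jet_tag 0 ` J f"
    then obtain u w z where j: "(u, w, z) \<in> J f" and \<tau>: "\<tau> = jet_tag 0 (u, w, z)"
      by (clarsimp simp del: jet_tag.simps)
    have ub: "\<bar>u \<bullet> b\<bar> \<le> 2" "\<bar>w \<bullet> b\<bar> \<le> 2" if b: "b \<in> Basis" for b
      using bd[OF f j b] a(2)[OF b] by linarith+
    have "grid_floor 0 (u + w) \<in> cells 0 (\<lambda>_. 1)"
    proof (rule floor_cell)
      show "\<bar>(u + w) \<bullet> b\<bar> \<le> 4 * 1" if "b \<in> Basis" for b
        using ub[OF that] by (simp add: inner_add_left)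
    qed
    moreover have "grid_floor 0 u \<in> cells 0 (\<lambda>_. 1)"
    proof (rule floor_cell)
      show "\<bar>u \<bullet> b\<bar> \<le> 4 * 1" if "b \<in> Basis" for b
        using ub[OF that] by simp
    qed
    \<comment> \<open>At level 0 the height is at most 2 from \<open>z\<close> plus
      \<open>2 * DIM('a)^2\<close> from the displacement to the corner; one more unit is for
      rounding.\<close>
    moreover have "\<lfloor>z + w \<bullet> (grid_pt 0 (grid_floor 0 u) - u)\<rfloor> \<in> {- 3 - 2 * (int DIM('a))\<^sup>2..3 + 2 * (int DIM('a))\<^sup>2}"
    proof -
      have "norm (grid_pt 0 (grid_floor 0 u) - u) \<le> real DIM('a)"
        using norm_grid_pt_floor[of u 0] by (simp add: norm_minus_commute)
      moreover have "norm w \<le> real DIM('a) * 2" by (rule norm_le_coords) (use ub in auto)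
      ultimately have "norm w * norm (grid_pt 0 (grid_floor 0 u) - u) \<le> (real DIM('a) * 2) * real DIM('a)"
        by (intro mult_mono) auto
      moreover have "(real DIM('a) * 2) * real DIM('a) = of_int (2 * (int DIM('a))\<^sup>2)" by (simp add: power2_eq_square)
      ultimately have "\<bar>w \<bullet> (grid_pt 0 (grid_floor 0 u) - u)\<bar> \<le> of_int (2 * (int DIM('a))\<^sup>2)"
        using Cauchy_Schwarz_ineq2[of w "grid_pt 0 (grid_floor 0 u) - u"] by linarith
      moreover have "\<bar>z\<bar> \<le> 2" using bz[OF f j] .
      ultimately show ?thesis unfolding atLeastAtMost_iff by linarith
    qed
    ultimately show "\<tau> \<in> B" unfolding B_def \<tau> by simp
  qed
  then have sub: "(\<lambda>f. jet_tag 0 ` J f) ` F \<subseteq> Pow B" by auto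
  have "real (card ((\<lambda>f. jet_tag 0 ` J f) ` F)) \<le> 2 ^ card B"
    using card_mono[OF _ sub] finB by (simp add: card_Pow)
  then show ?case using finite_subset[OF sub] finB by (simp add: powr_realpow)
next
  case (Suc L)
  let ?T = "\<lambda>l f. jet_tag l ` J f"
  have sub: "?T (Suc L) ` F \<subseteq> (\<Union>T\<in>?T L ` F. Pow (next_tags L a T))"
  proof clarify
    fix f assume f: "f \<in> F"
    have "?T (Suc L) f \<subseteq> next_tags L a (?T L f)"
      by (rule jet_tag_next[OF J[OF f] bd[OF f]]) auto
    then show "?T (Suc L) f \<in> (\<Union>T\<in>?T L ` F. Pow (next_tags L a T))" using f by blast
  qed
  let ?N = "K * (\<Prod>b\<in>Basis. 8 * 2 ^ Suc L * a b + 2)"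
  have fin: "finite (?T L ` F)" using Suc by simp
  have ft: "finite (next_tags L a T)" "real (card (next_tags L a T)) \<le> ?N" for T
    using card_next_tags[of a L T] a(1) unfolding K_def by auto
  have finU: "finite (\<Union>T\<in>?T L ` F. Pow (next_tags L a T))" by (intro finite_UN_I fin) (simp add: ft)
  have cp: "real (card (Pow (next_tags L a T))) \<le> 2 powr ?N" for T
  proof -
    have "real (card (Pow (next_tags L a T))) = 2 powr real (card (next_tags L a T))"
      using ft by (simp add: card_Pow powr_realpow)
    also have "\<dots> \<le> 2 powr ?N" using ft by (intro powr_mono) auto
    finally show ?thesis .
  qed
  have "real (card (?T (Suc L) ` F)) \<le> real (\<Sum>T\<in>?T L ` F. card (Pow (next_tags L a T)))"
    using card_mono[OF finU sub] card_UN_le[OF fin, of "\<lambda>T. Pow (next_tags L a T)"] by linarith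
  also have "\<dots> \<le> (\<Sum>T\<in>?T L ` F. 2 powr ?N)" using cp by (subst of_nat_sum) (intro sum_mono)
  also have "\<dots> = real (card (?T L ` F)) * 2 powr ?N" by simp
  also have "\<dots> \<le> 2 powr (real (card B) + K * (\<Sum>l<L. \<Prod>b\<in>Basis. 8 * 2 ^ Suc l * a b + 2)) * 2 powr ?N"
    using Suc by (intro mult_right_mono) auto
  also have "\<dots> = 2 powr (real (card B) + K * (\<Sum>l<Suc L. \<Prod>b\<in>Basis. 8 * 2 ^ Suc l * a b + 2))"
    by (simp add: powr_add[symmetric] algebra_simps)
  finally show ?case using finite_subset[OF sub finU] by simp
qed

lemma dyadic_scale:
  fixes r :: real
  assumes "0 < r" "r \<le> 1"
  obtains L :: nat where "1 / 2 ^ L \<le> r" "r * 2 ^ L \<le> 2"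
proof -
  define L where "L = (LEAST L. 1 / 2 ^ L \<le> r)"
  have ex: "\<exists>L. 1 / 2 ^ L \<le> r"
    using real_arch_pow_inv[OF assms(1), of "1/2"] by (auto simp: power_one_over intro: less_imp_le)
  have 1: "1 / 2 ^ L \<le> r" unfolding L_def by (rule LeastI_ex[OF ex])
  have 2: "r * 2 ^ L \<le> 2"
  proof (cases L)
    case 0 then show ?thesis using assms by simp
  next
    case (Suc k)
    have "\<not> 1 / 2 ^ k \<le> r" by (rule not_less_Least) (use Suc L_def in simp)
    then have "r * 2 ^ k \<le> 1" by (simp add: field_simps)
    then show ?thesis by (simp add: Suc)
  qed
  show ?thesis by (rule that[OF 1 2])
qed

text \<open>The full-width direction \<open>b0\<close> contributes a factor 2 per level, and all
  other factors are bounded by their finest values. The sum over levels is therefore dominated by a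
  geometric one and costs no factor \<open>L\<close>.\<close>

lemma sum_cells_le:
  fixes a :: "'a::euclidean_space \<Rightarrow> real"
  assumes a: "\<And>b. b \<in> Basis \<Longrightarrow> 1 \<le> 2 ^ L * a b" and b0: "b0 \<in> Basis" "a b0 = 1"
  shows "(\<Sum>l<L. \<Prod>b\<in>Basis. 8 * 2 ^ Suc l * a b + 2) \<le> 2 * 10 ^ DIM('a) * (\<Prod>b\<in>Basis. 2 ^ L * a b)"
proof -
  let ?P = "\<lambda>A. \<Prod>b\<in>A. 2 ^ L * a b"
  have apos: "0 < a b" if "b \<in> Basis" for b
    using a[OF that] by (metis less_le_trans zero_less_mult_pos zero_less_numeral zero_less_one zero_less_power)
  have geo: "(\<Sum>l<L. 2 ^ Suc l) = (2::real) * (2 ^ L - 1)" by (induction L) auto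
  have P: "?P Basis = 2 ^ L * ?P (Basis - {b0})" by (subst prod.remove[OF _ b0(1)]) (auto simp: b0)
  have "(\<Prod>b\<in>Basis. 8 * 2 ^ Suc l * a b + 2) \<le> 10 ^ DIM('a) * ?P (Basis - {b0}) * 2 ^ Suc l" if "l < L" for l
  proof -
    have le: "(2::real) ^ Suc l \<le> 2 ^ L" using that by (intro power_increasing) auto
    have "(\<Prod>b\<in>Basis. 8 * 2 ^ Suc l * a b + 2) = (8 * 2 ^ Suc l + 2) * (\<Prod>b\<in>Basis - {b0}. 8 * 2 ^ Suc l * a b + 2)"
      by (subst prod.remove[OF _ b0(1)]) (auto simp: b0)
    also have "\<dots> \<le> (10 * 2 ^ Suc l) * (\<Prod>b\<in>Basis - {b0}. 10 * (2 ^ L * a b))"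
    proof (intro mult_mono prod_mono conjI)
      show "8 * 2 ^ Suc l + 2 \<le> (10::real) * 2 ^ Suc l" using one_le_power[of "2::real" "Suc l"] by simp
      fix b assume b: "b \<in> Basis - {b0}"
      have "2 ^ Suc l * a b \<le> 2 ^ L * a b" using apos[of b] b by (intro mult_right_mono le) auto
      then show "8 * 2 ^ Suc l * a b + 2 \<le> 10 * (2 ^ L * a b)" using a[of b] b by auto
      show "0 \<le> 8 * 2 ^ Suc l * a b + 2" using apos[of b] b by auto
    next
      show "0 \<le> (\<Prod>b\<in>Basis - {b0}. 8 * 2 ^ Suc l * a b + 2)"
        using apos by (intro prod_nonneg) (simp add: less_imp_le)
    qed auto
    also have "\<dots> = (10 * 10 ^ (DIM('a) - 1)) * ?P (Basis - {b0}) * 2 ^ Suc l"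
      unfolding prod.distrib using b0 by (simp add: algebra_simps)
    also have "(10::real) * 10 ^ (DIM('a) - 1) = 10 ^ DIM('a)" by (simp flip: power_Suc)
    finally show ?thesis .
  qed
  then have "(\<Sum>l<L. \<Prod>b\<in>Basis. 8 * 2 ^ Suc l * a b + 2) \<le> (\<Sum>l<L. 10 ^ DIM('a) * ?P (Basis - {b0}) * 2 ^ Suc l)"
    by (intro sum_mono) auto
  also have "\<dots> = 10 ^ DIM('a) * ?P (Basis - {b0}) * (2 * (2 ^ L - 1))"
    unfolding sum_distrib_left[symmetric] by (simp only: geo)
  also have "\<dots> \<le> 10 ^ DIM('a) * ?P (Basis - {b0}) * (2 * 2 ^ L)"
    using apos by (intro mult_left_mono mult_nonneg_nonneg prod_nonneg) (auto simp: less_imp_le)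
  finally show ?thesis unfolding P by (simp add: algebra_simps)
qed

text \<open>With equal tags the two minorants agree up to order 4^-l at a common corner and their
  slopes up to order 2^-l, so over the displacement O(2^-l) from the corner they still agree to
  second order.\<close>

lemma same_tag:
  fixes u w :: "'a::euclidean_space"
  assumes "jet_tag l (u, w, z) = jet_tag l (u', w', z')"
  shows "z - 5 * (real DIM('a))\<^sup>2 / 4 ^ l \<le> z' + w' \<bullet> (u - u')"
proof -
  define a where "a = grid_pt l (grid_floor l u)"
  define D where "D = real DIM('a) / 2 ^ l"
  have eq: "grid_floor l (u + w) = grid_floor l (u' + w')" "grid_floor l u = grid_floor l u'"
    "\<lfloor>4 ^ l * (z + w \<bullet> (a - u))\<rfloor> = \<lfloor>4 ^ l * (z' + w' \<bullet> (a - u'))\<rfloor>"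
    using assms unfolding a_def by auto
  have D2: "D * D = (real DIM('a))\<^sup>2 / 4 ^ l"
    by (simp add: D_def power2_eq_square power_mult_distrib[symmetric])
  have dim: "real DIM('a) \<ge> 1" using DIM_positive[where 'a='a] by linarith
  have le: "1 / 4 ^ l \<le> D * D" unfolding D2 using dim by (intro divide_right_mono) (auto simp: one_le_power)
  have "4 ^ l * (z + w \<bullet> (a - u)) \<le> 4 ^ l * (z' + w' \<bullet> (a - u')) + 1" using eq(3) by linarith
  then have "z + w \<bullet> (a - u) \<le> (4 ^ l * (z' + w' \<bullet> (a - u')) + 1) / 4 ^ l"
    by (simp add: pos_le_divide_eq mult.commute)
  then have v: "z + w \<bullet> (a - u) \<le> z' + w' \<bullet> (a - u') + D * D" using le by (simp add: add_divide_distrib)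
  have nu: "norm (u - a) \<le> D" unfolding a_def D_def by (rule norm_grid_pt_floor)
  have "norm ((u + w) - (u' + w')) \<le> D" "norm (u - u') \<le> D" unfolding D_def using same_cell(2) eq by blast+
  moreover have e: "w - w' = ((u + w) - (u' + w')) - (u - u')" by simp
  have "norm (w - w') \<le> norm ((u + w) - (u' + w')) + norm (u - u')"
    by (subst e) (rule norm_triangle_ineq4)
  ultimately have nw: "norm (w - w') \<le> 2 * D" by linarith
  have "\<bar>(w - w') \<bullet> (u - a)\<bar> \<le> (2 * D) * D"
    using Cauchy_Schwarz_ineq2[of "w - w'" "u - a"] mult_mono[OF nw nu] by (auto simp: D_def)
  moreover have "z' + w' \<bullet> (u - u') = (z' + w' \<bullet> (a - u')) - (z + w \<bullet> (a - u)) + z - (w - w') \<bullet> (u - a)"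
    by (simp add: inner_diff_left inner_diff_right algebra_simps)
  ultimately show ?thesis using v D2 le by simp
qed

text \<open>\<open>a\<close> lists the half-widths of the jets up to a factor 2, the same for points
  and slopes since the grid lives on their sum. The finest level, with about the product of
  \<open>a b / r\<close> cells, determines the order of the entropy. When the jets of
  \<open>g\<close> consist of points, subgradients and values of a function, the right side of the
  conclusion lies below the value of that function at \<open>u\<close>.\<close>

lemma splits_convex_jets:
  "\<exists>K>0. \<forall>(F::'f set) (J :: 'f \<Rightarrow> ('a::euclidean_space \<times> 'a \<times> real) set) a r b0.
    (\<forall>f\<in>F. convex_jets (J f)) \<longrightarrow>
    (\<forall>f\<in>F. \<forall>(u, w, z)\<in>J f. \<bar>z\<bar> \<le> 2 \<and> (\<forall>b\<in>Basis. \<bar>u \<bullet> b\<bar> \<le> 2 * a b \<and> \<bar>w \<bullet> b\<bar> \<le> 2 * a b)) \<longrightarrow>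
    0 < r \<longrightarrow> (\<forall>b\<in>Basis. r \<le> a b \<and> a b \<le> 1) \<longrightarrow> b0 \<in> Basis \<longrightarrow> a b0 = 1 \<longrightarrow>
    splits F (K * (\<Prod>b\<in>Basis. a b / r))
      (\<lambda>f g. \<forall>(u, w, z)\<in>J f. \<exists>(u', w', z')\<in>J g. z - K * r\<^sup>2 \<le> z' + w' \<bullet> (u - u'))"
proof -
  define M where "M = real (card (cells 0 (\<lambda>_::'a. 1) \<times> cells 0 (\<lambda>_::'a. 1) \<times> {- 3 - 2 * (int DIM('a))\<^sup>2..3 + 2 * (int DIM('a))\<^sup>2}))"
  define K where "K = real ((4 * DIM('a) + 4) ^ DIM('a) * (48 * DIM('a)\<^sup>2 + 3))"
  define C where "C = 1 + M + K * (2 * 10 ^ DIM('a)) * 2 ^ DIM('a) + 5 * (real DIM('a))\<^sup>2"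
  have M0: "M \<ge> 0" "K \<ge> 0" by (simp_all add: M_def K_def)
  then have C: "C > 0" "5 * (real DIM('a))\<^sup>2 \<le> C" "M + K * (2 * 10 ^ DIM('a)) * 2 ^ DIM('a) \<le> C"
    by (auto simp: C_def add_pos_nonneg add_nonneg_nonneg)
  show ?thesis
  proof (intro exI[of _ C] conjI allI impI C(1))
    fix F :: "'f set" and J :: "'f \<Rightarrow> ('a \<times> 'a \<times> real) set" and a :: "'a \<Rightarrow> real" and r b0
    assume J: "\<forall>f\<in>F. convex_jets (J f)"
      and bd: "\<forall>f\<in>F. \<forall>(u, w, z)\<in>J f. \<bar>z\<bar> \<le> 2 \<and> (\<forall>b\<in>Basis. \<bar>u \<bullet> b\<bar> \<le> 2 * a b \<and> \<bar>w \<bullet> b\<bar> \<le> 2 * a b)"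
      and r: "0 < r" and a: "\<forall>b\<in>Basis. r \<le> a b \<and> a b \<le> 1" and b0: "b0 \<in> Basis" "a b0 = 1"
    have "r \<le> 1" using a b0 by auto
    obtain L :: nat where L: "1 / 2 ^ L \<le> r" "r * 2 ^ L \<le> 2" using dyadic_scale[OF r \<open>r \<le> 1\<close>] .
    have L1: "1 \<le> r * 2 ^ L" using L(1) by (simp add: field_simps)
    have aL: "1 \<le> 2 ^ L * a b" if "b \<in> Basis" for b
    proof -
      have "r * 2 ^ L \<le> a b * 2 ^ L" using a that by (intro mult_right_mono) auto
      then show ?thesis using L1 by (simp only: mult.commute)
    qed
    define P where "P = (\<Prod>b\<in>Basis. a b / r)"
    have "1 \<le> P" unfolding P_def using a r by (intro prod_ge_1) auto
    have P2: "(\<Prod>b\<in>Basis. 2 ^ L * a b) \<le> 2 ^ DIM('a) * P"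
    proof -
      have "(\<Prod>b\<in>Basis. 2 ^ L * a b) \<le> (\<Prod>b\<in>(Basis::'a set). 2 * (a b / r))"
      proof (intro prod_mono conjI)
        fix b :: 'a assume b: "b \<in> Basis"
        have "(r * 2 ^ L) * a b \<le> 2 * a b" using a b r L by (intro mult_right_mono) force+
        then show "2 ^ L * a b \<le> 2 * (a b / r)" using r by (simp add: field_simps)
        show "0 \<le> 2 ^ L * a b" using aL[OF b] by simp
      qed
      also have "\<dots> = 2 ^ DIM('a) * P" unfolding prod.distrib P_def by simp
      finally show ?thesis .
    qed
    let ?\<kappa> = "\<lambda>f. jet_tag L ` J f"
    have *: "finite (?\<kappa> ` F) \<and> real (card (?\<kappa> ` F)) \<le> 2 powr (M + K * (\<Sum>l<L. \<Prod>b\<in>Basis. 8 * 2 ^ Suc l * a b + 2))"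
      unfolding M_def K_def
    proof (rule card_jet_tags)
      show "\<bar>u \<bullet> b\<bar> \<le> 2 * a b \<and> \<bar>w \<bullet> b\<bar> \<le> 2 * a b" if "f \<in> F" "(u, w, z) \<in> J f" "b \<in> Basis" for f u w z b
        using bspec[OF bspec[OF bd that(1)] that(2)] that(3) by simp
      show "\<bar>z\<bar> \<le> 2" if "f \<in> F" "(u, w, z) \<in> J f" for f u w z
        using bspec[OF bspec[OF bd that(1)] that(2)] by simp
      show "0 \<le> a b" "a b \<le> 1" if "b \<in> Basis" for b using a r that by force+
    qed (use J in blast)
    have "M + K * (\<Sum>l<L. \<Prod>b\<in>Basis. 8 * 2 ^ Suc l * a b + 2) \<le> M * P + K * (2 * 10 ^ DIM('a) * (2 ^ DIM('a) * P))"
    proof (intro add_mono mult_left_mono)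
      show "M \<le> M * P" using \<open>1 \<le> P\<close> M0 by (simp add: mult_le_cancel_left1)
      show "(\<Sum>l<L. \<Prod>b\<in>Basis. 8 * 2 ^ Suc l * a b + 2) \<le> 2 * 10 ^ DIM('a) * (2 ^ DIM('a) * P)"
      proof -
        have "(\<Sum>l<L. \<Prod>b\<in>Basis. 8 * 2 ^ Suc l * a b + 2) \<le> 2 * 10 ^ DIM('a) * (\<Prod>b\<in>Basis. 2 ^ L * a b)"
          by (rule sum_cells_le[where ?b0.0 = b0]) (use aL b0 in auto)
        also have "\<dots> \<le> 2 * 10 ^ DIM('a) * (2 ^ DIM('a) * P)" by (rule mult_left_mono[OF P2]) simp
        finally show ?thesis .
      qed
    qed (use M0 in auto)
    also have "\<dots> = (M + K * (2 * 10 ^ DIM('a)) * 2 ^ DIM('a)) * P" by (simp add: algebra_simps)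
    also have "\<dots> \<le> C * P" using C \<open>1 \<le> P\<close> by (intro mult_right_mono) auto
    finally have "2 powr (M + K * (\<Sum>l<L. \<Prod>b\<in>Basis. 8 * 2 ^ Suc l * a b + 2)) \<le> 2 powr (C * P)" by simp
    also have "\<dots> \<le> exp (C * P)"
    proof -
      have "ln 2 \<le> (1::real)" using ln_le_minus_one[of 2] by simp
      then have "C * P * ln 2 \<le> C * P * 1" using C \<open>1 \<le> P\<close> by (intro mult_left_mono) auto
      then show ?thesis by (simp add: powr_def)
    qed
    finally have card: "2 powr (M + K * (\<Sum>l<L. \<Prod>b\<in>Basis. 8 * 2 ^ Suc l * a b + 2)) \<le> exp (C * P)" .
    have r2: "5 * (real DIM('a))\<^sup>2 / 4 ^ L \<le> C * r\<^sup>2"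
    proof -
      have "(1 / 2 ^ L)\<^sup>2 \<le> r\<^sup>2" using L by (intro power_mono) auto
      then have "1 / 4 ^ L \<le> r\<^sup>2" by (simp add: power2_eq_square power_mult_distrib[symmetric])
      then have "(5 * (real DIM('a))\<^sup>2) * (1 / 4 ^ L) \<le> C * r\<^sup>2" using C by (intro mult_mono) auto
      then show ?thesis by simp
    qed
    show "splits F (C * (\<Prod>b\<in>Basis. a b / r))
      (\<lambda>f g. \<forall>(u, w, z)\<in>J f. \<exists>(u', w', z')\<in>J g. z - C * r\<^sup>2 \<le> z' + w' \<bullet> (u - u'))"
      unfolding P_def[symmetric]
    proof (rule splitsI[of ?\<kappa>])
      show "finite (?\<kappa> ` F)" using * by simp
      show "real (card (?\<kappa> ` F)) \<le> exp (C * P)" using * card by linarith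
      fix f g assume fg: "f \<in> F" "g \<in> F" "jet_tag L ` J f = jet_tag L ` J g"
      show "\<forall>(u, w, z)\<in>J f. \<exists>(u', w', z')\<in>J g. z - C * r\<^sup>2 \<le> z' + w' \<bullet> (u - u')"
      proof clarify
        fix u w z assume "(u, w, z) \<in> J f"
        then have "jet_tag L (u, w, z) \<in> jet_tag L ` J g" using fg(3) by blast
        then obtain u' w' z' where j: "(u', w', z') \<in> J g" "jet_tag L (u, w, z) = jet_tag L (u', w', z')"
          by (metis (no_types, lifting) imageE prod_cases3)
        show "\<exists>(u', w', z')\<in>J g. z - C * r\<^sup>2 \<le> z' + w' \<bullet> (u - u')"
          using same_tag[OF j(2)] r2 by (intro bexI[OF _ j(1)]) auto
      qed
    qed
  qed
qed

section \<open>Least squares over a finite net\<close>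

text \<open>Taking the least minimising index resolves ties in a way that is measurable in the
  data.\<close>

definition erm_index ::
  "nat \<Rightarrow> nat set \<Rightarrow> (nat \<Rightarrow> 'a \<Rightarrow> real) \<Rightarrow> (nat \<Rightarrow> 'a \<times> real) \<Rightarrow> nat" where
  "erm_index n K g z = (LEAST k. k \<in> K \<and>
     (\<forall>k'\<in>K. (\<Sum>j\<in>{1..n}. (snd (z j) - g k (fst (z j)))\<^sup>2) \<le> (\<Sum>j\<in>{1..n}. (snd (z j) - g k' (fst (z j)))\<^sup>2)))"

lemma erm_index:
  assumes "finite K" "K \<noteq> {}"
  shows "erm_index n K g z \<in> K"
    and "k \<in> K \<Longrightarrow> (\<Sum>j\<in>{1..n}. (snd (z j) - g (erm_index n K g z) (fst (z j)))\<^sup>2) \<le> (\<Sum>j\<in>{1..n}. (snd (z j) - g k (fst (z j)))\<^sup>2)"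
proof -
  let ?s = "\<lambda>k. \<Sum>j\<in>{1..n}. (snd (z j) - g k (fst (z j)))\<^sup>2"
  have "Min (?s ` K) \<in> ?s ` K" using assms by (intro Min_in) auto
  then obtain k0 where "k0 \<in> K" "?s k0 = Min (?s ` K)" by auto
  moreover from this have "?s k0 \<le> ?s k'" if "k' \<in> K" for k' using that assms by simp
  ultimately have "\<exists>k. k \<in> K \<and> (\<forall>k'\<in>K. ?s k \<le> ?s k')" by blast
  from LeastI_ex[OF this] have "erm_index n K g z \<in> K \<and> (\<forall>k'\<in>K. ?s (erm_index n K g z) \<le> ?s k')"
    unfolding erm_index_def .
  then show "erm_index n K g z \<in> K" "k \<in> K \<Longrightarrow> ?s (erm_index n K g z) \<le> ?s k" by auto
qed

lemma measurable_erm_index: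
  assumes K: "finite K" and g [measurable]: "\<And>k. g k \<in> borel_measurable (borel :: 'a::euclidean_space measure)"
  shows "erm_index n K g \<in> measurable (\<Pi>\<^sub>M i\<in>{1..n}. borel \<Otimes>\<^sub>M borel) (count_space UNIV)"
proof -
  let ?M = "\<Pi>\<^sub>M i\<in>{1..n}. (borel \<Otimes>\<^sub>M borel :: ('a \<times> real) measure)"
  have [measurable]: "(\<lambda>z. z j) \<in> measurable ?M (borel \<Otimes>\<^sub>M borel)" if "j \<in> {1..n}" for j
    using measurable_component_singleton[OF that, of "\<lambda>_. borel \<Otimes>\<^sub>M borel"] .
  have s: "(\<lambda>z. \<Sum>j\<in>{1..n}. (snd (z j) - g k (fst (z j)))\<^sup>2) \<in> borel_measurable ?M" for k
    by measurable
  have [measurable]: "Measurable.pred ?M (\<lambda>z. (\<Sum>j\<in>{1..n}. (snd (z j) - g k (fst (z j)))\<^sup>2) \<le> (\<Sum>j\<in>{1..n}. (snd (z j) - g k' (fst (z j)))\<^sup>2))" for k k'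
    unfolding pred_def by (rule borel_measurable_le[OF s s])
  show ?thesis unfolding erm_index_def[abs_def] using K by measurable
qed

locale erm_net =
  fixes \<nu> :: "'a::euclidean_space measure" and Q n and \<sigma> \<Gamma> :: real and f :: "'a \<Rightarrow> real"
    and K :: "nat set" and g :: "nat \<Rightarrow> 'a \<Rightarrow> real"
  assumes prob_nu: "prob_space \<nu>" and sets_nu [measurable_cong]: "sets \<nu> = sets borel"
    and errors: "subgaussian_errors n \<sigma> Q" and n: "n \<ge> 1" and Gamma: "\<Gamma> > 0"
    and f_meas [measurable]: "f \<in> borel_measurable borel" and f_bd: "\<And>x. \<bar>f x\<bar> \<le> \<Gamma>"
    and K: "finite K" "K \<noteq> {}"
    and g_meas [measurable]: "\<And>k. g k \<in> borel_measurable borel" and g_bd: "\<And>k x. \<bar>g k x\<bar> \<le> \<Gamma>"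
begin

definition "h k x = f x - g k x"
definition "D k = (\<integral>x. (h k x)\<^sup>2 \<partial>\<nu>)"
text \<open>Small enough for both exponential estimates:
  \<open>\<theta> * \<sigma>^2 \<le> 1 / 4\<close> lets the term linear in the errors consume at
  most half of the quadratic one, and \<open>\<theta> * \<Gamma>^2 \<le> 1 / 4\<close> keeps
  \<open>\<theta> / 2 * (h k x)^2\<close> at most 1/2, where exp(-t) is below 1 - t/2.\<close>

definition "\<theta> = 1 / (4 * (\<sigma>\<^sup>2 + \<Gamma>\<^sup>2))"
definition "V = (\<Pi>\<^sub>M i\<in>{1..n}. \<nu>)"
text \<open>The square of \<open>\<epsilon> j + h k (X j)\<close> minus the square of
  \<open>\<epsilon> j\<close>, summed over the sample.\<close>

definition "excess k = (\<lambda>(X, \<epsilon>). \<Sum>j\<in>{1..n}. (h k (X j))\<^sup>2 + 2 * \<epsilon> j * h k (X j))"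

sublocale nu: prob_space \<nu> by (rule prob_nu)
sublocale V: prob_space V unfolding V_def by (intro prob_space_PiM prob_nu)
sublocale Q: prob_space Q using errors by (simp add: subgaussian_errors_def)
sublocale VQ: pair_prob_space V Q ..

lemma sets_Q [measurable_cong]: "sets Q = sets (\<Pi>\<^sub>M i\<in>{1..n}. borel)"
  using errors by (simp add: subgaussian_errors_def)

lemma sets_V [measurable_cong]: "sets V = sets (\<Pi>\<^sub>M i\<in>{1..n}. borel)"
  unfolding V_def by (intro sets_PiM_cong) (auto simp: sets_nu)

lemma h_meas [measurable]: "h k \<in> borel_measurable borel" unfolding h_def by measurable

lemma theta: "\<theta> > 0" "\<theta> * \<sigma>\<^sup>2 \<le> 1 / 4" "\<theta> * \<Gamma>\<^sup>2 \<le> 1 / 4"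
proof -
  have "\<sigma>\<^sup>2 + \<Gamma>\<^sup>2 > 0" using Gamma by (intro add_nonneg_pos) auto
  then show "\<theta> > 0" "\<theta> * \<sigma>\<^sup>2 \<le> 1 / 4" "\<theta> * \<Gamma>\<^sup>2 \<le> 1 / 4"
    unfolding \<theta>_def by (auto simp: field_simps)
qed

lemma h_bd: "\<bar>h k x\<bar> \<le> 2 * \<Gamma>" "(h k x)\<^sup>2 \<le> 4 * \<Gamma>\<^sup>2"
proof -
  show 1: "\<bar>h k x\<bar> \<le> 2 * \<Gamma>" using f_bd[of x] g_bd[of k x] unfolding h_def by linarith
  have "(h k x)\<^sup>2 \<le> (2 * \<Gamma>)\<^sup>2" using 1 Gamma by (subst abs_le_square_iff[symmetric]) auto
  then show "(h k x)\<^sup>2 \<le> 4 * \<Gamma>\<^sup>2" by (simp add: power_mult_distrib)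
qed

lemma integrable_h2 [simp]: "integrable \<nu> (\<lambda>x. (h k x)\<^sup>2)"
  by (rule nu.integrable_const_bound[of _ "4 * \<Gamma>\<^sup>2"]) (auto simp: h_bd)

lemma D_nonneg: "0 \<le> D k" unfolding D_def by simp

lemma comp_V: "j \<in> {1..n} \<Longrightarrow> (\<lambda>X. X j) \<in> borel_measurable V"
  by (subst measurable_cong_sets[OF sets_V refl]) (rule measurable_component_singleton)

lemma comp_Q: "j \<in> {1..n} \<Longrightarrow> (\<lambda>X. X j) \<in> borel_measurable Q"
  by (subst measurable_cong_sets[OF sets_Q refl]) (rule measurable_component_singleton)

lemma excess_meas [measurable]: "excess k \<in> borel_measurable (V \<Otimes>\<^sub>M Q)"
  unfolding excess_def by measurable

lemma mgf_errors:
  "(\<integral>\<^sup>+\<epsilon>. ennreal (exp (\<Sum>j\<in>{1..n}. t j * \<epsilon> j)) \<partial>Q) \<le> ennreal (exp (\<Sum>j\<in>{1..n}. (t j)\<^sup>2 * \<sigma>\<^sup>2 / 2))"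
proof -
  have ind: "Q.indep_vars (\<lambda>_. borel) (\<lambda>i e. e i) {1..n}" using errors by (simp add: subgaussian_errors_def)
  have ind': "Q.indep_vars (\<lambda>_. borel) (\<lambda>j e. ennreal (exp (t j * e j))) {1..n}"
    by (rule Q.indep_vars_compose2[OF ind]) measurable
  have "(\<integral>\<^sup>+\<epsilon>. ennreal (exp (\<Sum>j\<in>{1..n}. t j * \<epsilon> j)) \<partial>Q) = (\<integral>\<^sup>+\<epsilon>. (\<Prod>j\<in>{1..n}. ennreal (exp (t j * \<epsilon> j))) \<partial>Q)"
    by (simp add: exp_sum prod_ennreal)
  also have "\<dots> = (\<Prod>j\<in>{1..n}. \<integral>\<^sup>+\<epsilon>. ennreal (exp (t j * \<epsilon> j)) \<partial>Q)"
    by (rule Q.indep_vars_nn_integral[OF _ ind']) auto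
  also have "\<dots> \<le> (\<Prod>j\<in>{1..n}. ennreal (exp ((t j)\<^sup>2 * \<sigma>\<^sup>2 / 2)))"
    using errors by (intro prod_mono_ennreal) (auto simp: subgaussian_errors_def)
  also have "\<dots> = ennreal (exp (\<Sum>j\<in>{1..n}. (t j)\<^sup>2 * \<sigma>\<^sup>2 / 2))"
    by (simp add: exp_sum prod_ennreal)
  finally show ?thesis .
qed

text \<open>Boundedness of \<open>h\<close> replaces a variance computation: on [0, 1/2] the
  function exp(-t) lies below 1 - t/2, which integrates to \<open>1 - \<theta> / 4 * D k\<close>.
  The only loss is a factor 2 in the exponent.\<close>

lemma laplace_h:
  "(\<integral>\<^sup>+x. ennreal (exp (- (\<theta> / 2 * (h k x)\<^sup>2))) \<partial>\<nu>) \<le> ennreal (exp (- (\<theta> / 4 * D k)))"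
proof -
  have pt: "exp (- (\<theta> / 2 * (h k x)\<^sup>2)) \<le> 1 - \<theta> / 4 * (h k x)\<^sup>2" for x
  proof -
    define t where "t = \<theta> / 2 * (h k x)\<^sup>2"
    have t0: "0 \<le> t" unfolding t_def using theta by simp
    have "\<theta> * (h k x)\<^sup>2 \<le> \<theta> * (4 * \<Gamma>\<^sup>2)" using h_bd theta by (intro mult_left_mono) auto
    also have "\<dots> = 4 * (\<theta> * \<Gamma>\<^sup>2)" by simp
    finally have t1: "t \<le> 1 / 2" unfolding t_def using theta(3) by linarith
    have "1 + t \<le> exp t" by (rule exp_ge_add_one_self)
    then have "exp (- t) \<le> 1 / (1 + t)" using t0 by (simp add: exp_minus field_simps)
    also have "\<dots> \<le> 1 - t / 2"
    proof -
      have "1 * 1 \<le> (1 - t / 2) * (1 + t)" using t0 t1 mult_mono[of t 1 t t] by (simp add: algebra_simps)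
      then show ?thesis using t0 by (simp add: pos_divide_le_eq)
    qed
    finally show ?thesis unfolding t_def by simp
  qed
  have nn: "0 \<le> 1 - \<theta> / 4 * (h k x)\<^sup>2" for x using pt[of x] exp_ge_zero order_trans by blast
  have "(\<integral>\<^sup>+x. ennreal (exp (- (\<theta> / 2 * (h k x)\<^sup>2))) \<partial>\<nu>) \<le> (\<integral>\<^sup>+x. ennreal (1 - \<theta> / 4 * (h k x)\<^sup>2) \<partial>\<nu>)"
    using pt by (intro nn_integral_mono) (simp add: ennreal_leI)
  also have "\<dots> = ennreal (\<integral>x. 1 - \<theta> / 4 * (h k x)\<^sup>2 \<partial>\<nu>)"
    using nn by (intro nn_integral_eq_integral) auto
  also have "(\<integral>x. 1 - \<theta> / 4 * (h k x)\<^sup>2 \<partial>\<nu>) = 1 - \<theta> / 4 * D k"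
    unfolding D_def by (subst Bochner_Integration.integral_diff) (auto simp: nu.prob_space)
  also have "\<dots> \<le> exp (- (\<theta> / 4 * D k))" using exp_ge_add_one_self[of "- (\<theta> / 4 * D k)"] by simp
  finally show ?thesis by (simp add: ennreal_leI)
qed

text \<open>Conditionally on the design, the sub-Gaussian bound turns the linear term into at most
  half of the quadratic one, leaving exp(-\<theta> A / 2) with A the sum of the squares of
  \<open>h k\<close> over the design points. This factorises over the independent design
  points.\<close>

lemma mgf_excess:
  "(\<integral>\<^sup>+y. ennreal (exp (- \<theta> * excess k y + \<theta> / 4 * real n * D k)) \<partial>(V \<Otimes>\<^sub>M Q)) \<le> 1"
proof -
  let ?c = "exp (\<theta> / 4 * real n * D k)"
  have inner: "(\<integral>\<^sup>+\<epsilon>. ennreal (exp (- \<theta> * excess k (X, \<epsilon>))) \<partial>Q) \<le> (\<Prod>j\<in>{1..n}. ennreal (exp (- (\<theta> / 2 * (h k (X j))\<^sup>2))))" for X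
  proof -
    define A where "A = (\<Sum>j\<in>{1..n}. (h k (X j))\<^sup>2)"
    have A0: "0 \<le> A" unfolding A_def by (intro sum_nonneg) auto
    have e: "exp (- \<theta> * excess k (X, \<epsilon>)) = exp (- \<theta> * A) * exp (\<Sum>j\<in>{1..n}. (- 2 * \<theta> * h k (X j)) * \<epsilon> j)" for \<epsilon>
      unfolding exp_add[symmetric] excess_def A_def by (simp add: sum.distrib sum_distrib_left algebra_simps sum_negf)
    have [measurable]: "(\<lambda>\<epsilon>. exp (\<Sum>j\<in>{1..n}. (- 2 * \<theta> * h k (X j)) * \<epsilon> j)) \<in> borel_measurable Q" by measurable
    have "(\<integral>\<^sup>+\<epsilon>. ennreal (exp (- \<theta> * excess k (X, \<epsilon>))) \<partial>Q)
      = ennreal (exp (- \<theta> * A)) * (\<integral>\<^sup>+\<epsilon>. ennreal (exp (\<Sum>j\<in>{1..n}. (- 2 * \<theta> * h k (X j)) * \<epsilon> j)) \<partial>Q)"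
      unfolding e ennreal_mult'[OF exp_ge_zero] by (rule nn_integral_cmult) measurable
    also have "\<dots> \<le> ennreal (exp (- \<theta> * A)) * ennreal (exp (\<Sum>j\<in>{1..n}. (- 2 * \<theta> * h k (X j))\<^sup>2 * \<sigma>\<^sup>2 / 2))"
      by (intro mult_left_mono mgf_errors) auto
    also have "\<dots> = ennreal (exp (- \<theta> * A + 2 * \<theta> * (\<theta> * \<sigma>\<^sup>2) * A))"
      unfolding ennreal_mult''[OF exp_ge_zero, symmetric] exp_add[symmetric] A_def
      by (simp add: sum_distrib_left power_mult_distrib power2_eq_square algebra_simps)
    also have "\<dots> \<le> ennreal (exp (- (\<theta> / 2 * A)))"
    proof -
      have "2 * \<theta> * (\<theta> * \<sigma>\<^sup>2) * A \<le> 2 * \<theta> * (1 / 4) * A"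
        using theta A0 by (intro mult_right_mono mult_left_mono) auto
      then show ?thesis by (intro ennreal_leI) simp
    qed
    also have "\<dots> = (\<Prod>j\<in>{1..n}. ennreal (exp (- (\<theta> / 2 * (h k (X j))\<^sup>2))))"
      unfolding A_def by (simp add: prod_ennreal exp_sum[symmetric] sum_distrib_left sum_negf)
    finally show ?thesis .
  qed
  interpret PS: product_sigma_finite "\<lambda>_::nat. \<nu>" ..
  have "(\<integral>\<^sup>+y. ennreal (exp (- \<theta> * excess k y + \<theta> / 4 * real n * D k)) \<partial>(V \<Otimes>\<^sub>M Q))
     = (\<integral>\<^sup>+X. \<integral>\<^sup>+\<epsilon>. ennreal (exp (- \<theta> * excess k (X, \<epsilon>) + \<theta> / 4 * real n * D k)) \<partial>Q \<partial>V)"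
    by (rule Q.nn_integral_fst[symmetric]) measurable
  also have "\<dots> = (\<integral>\<^sup>+X. (\<integral>\<^sup>+\<epsilon>. ennreal (exp (- \<theta> * excess k (X, \<epsilon>))) \<partial>Q) * ennreal ?c \<partial>V)"
  proof (intro nn_integral_cong)
    fix X assume X: "X \<in> space V"
    have [measurable]: "(\<lambda>\<epsilon>. excess k (X, \<epsilon>)) \<in> borel_measurable Q" using X by measurable
    have m: "(\<lambda>\<epsilon>. ennreal (exp (- \<theta> * excess k (X, \<epsilon>)))) \<in> borel_measurable Q" by measurable
    show "(\<integral>\<^sup>+\<epsilon>. ennreal (exp (- \<theta> * excess k (X, \<epsilon>) + \<theta> / 4 * real n * D k)) \<partial>Q) =
      (\<integral>\<^sup>+\<epsilon>. ennreal (exp (- \<theta> * excess k (X, \<epsilon>))) \<partial>Q) * ennreal ?c"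
      unfolding exp_add ennreal_mult'[OF exp_ge_zero] by (rule nn_integral_multc[OF m])
  qed
  also have "\<dots> \<le> (\<integral>\<^sup>+X. (\<Prod>j\<in>{1..n}. ennreal (exp (- (\<theta> / 2 * (h k (X j))\<^sup>2)))) * ennreal ?c \<partial>V)"
    by (intro nn_integral_mono mult_right_mono inner) auto
  also have "\<dots> = (\<integral>\<^sup>+X. (\<Prod>j\<in>{1..n}. ennreal (exp (- (\<theta> / 2 * (h k (X j))\<^sup>2)))) \<partial>V) * ennreal ?c"
    by (rule nn_integral_multc) measurable
  also have "(\<integral>\<^sup>+X. (\<Prod>j\<in>{1..n}. ennreal (exp (- (\<theta> / 2 * (h k (X j))\<^sup>2)))) \<partial>V)
      = (\<Prod>j\<in>{1..n}. \<integral>\<^sup>+x. ennreal (exp (- (\<theta> / 2 * (h k x)\<^sup>2))) \<partial>\<nu>)"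
    unfolding V_def by (rule PS.product_nn_integral_prod) auto
  also have "(\<Prod>j\<in>{1..n}. \<integral>\<^sup>+x. ennreal (exp (- (\<theta> / 2 * (h k x)\<^sup>2))) \<partial>\<nu>) \<le> (\<Prod>j\<in>{1..n}. ennreal (exp (- (\<theta> / 4 * D k))))"
    by (intro prod_mono_ennreal laplace_h)
  also have "(\<Prod>j\<in>{1..n}. ennreal (exp (- (\<theta> / 4 * D k)))) * ennreal ?c = 1"
  proof -
    have "real n * - (\<theta> / 4 * D k) + \<theta> / 4 * real n * D k = 0" by simp
    then show ?thesis
      by (simp only: prod_constant card_atLeastAtMost diff_Suc_1 ennreal_power exp_ge_zero
          ennreal_mult''[symmetric] exp_of_nat_mult[symmetric] exp_add[symmetric] exp_zero ennreal_1)
  qed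
  finally show ?thesis by (simp add: mult_right_mono)
qed

lemma integrable_excess: "integrable (V \<Otimes>\<^sub>M Q) (excess k)"
  and integral_excess: "(\<integral>y. excess k y \<partial>(V \<Otimes>\<^sub>M Q)) = real n * D k"
proof -
  have one: "integrable (V \<Otimes>\<^sub>M Q) (\<lambda>(X, \<epsilon>). (h k (X j))\<^sup>2 + 2 * \<epsilon> j * h k (X j)) \<and>
     (\<integral>(X, \<epsilon>). (h k (X j))\<^sup>2 + 2 * \<epsilon> j * h k (X j) \<partial>(V \<Otimes>\<^sub>M Q)) = D k" if j: "j \<in> {1..n}" for j
  proof -
    let ?F = "\<lambda>(X, \<epsilon>). (h k (X j))\<^sup>2 + 2 * \<epsilon> j * h k (X j)"
    have [measurable]: "(\<lambda>X. X j) \<in> borel_measurable V" "(\<lambda>e. e j) \<in> borel_measurable Q"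
      using j by (auto intro: comp_V comp_Q)
    have Fm [measurable]: "?F \<in> borel_measurable (V \<Otimes>\<^sub>M Q)" by measurable
    have eint: "integrable Q (\<lambda>e. e j)" and e0: "(\<integral>e. e j \<partial>Q) = 0"
      using errors j by (auto simp: subgaussian_errors_def)
    have Fx: "integrable Q (\<lambda>e. ?F (X, e))" for X using eint by simp
    have Fint: "(\<integral>e. ?F (X, e) \<partial>Q) = (h k (X j))\<^sup>2" for X
      using eint e0 by (simp add: Q.prob_space)
    have m1: "(\<lambda>X. \<integral>e. norm (?F (X, e)) \<partial>Q) \<in> borel_measurable V"
      by (rule Q.borel_measurable_lebesgue_integral) (simp add: case_prod_beta')
    \<comment> \<open>A bound uniform in \<open>X\<close>, from boundedness of \<open>h\<close>,
      supplies the integrability that Fubini requires.\<close>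
    have bd: "norm (\<integral>e. norm (?F (X, e)) \<partial>Q) \<le> 4 * \<Gamma>\<^sup>2 + 4 * \<Gamma> * (\<integral>e. \<bar>e j\<bar> \<partial>Q)" for X
    proof -
      have "(\<integral>e. norm (?F (X, e)) \<partial>Q) \<le> (\<integral>e. 4 * \<Gamma>\<^sup>2 + 4 * \<Gamma> * \<bar>e j\<bar> \<partial>Q)"
      proof (rule integral_mono)
        show "norm (?F (X, e)) \<le> 4 * \<Gamma>\<^sup>2 + 4 * \<Gamma> * \<bar>e j\<bar>" for e
        proof -
          have "\<bar>e j\<bar> * \<bar>h k (X j)\<bar> \<le> \<bar>e j\<bar> * (2 * \<Gamma>)" by (intro mult_left_mono h_bd) auto
          moreover have "\<bar>(h k (X j))\<^sup>2 + 2 * e j * h k (X j)\<bar> \<le> (h k (X j))\<^sup>2 + 2 * (\<bar>e j\<bar> * \<bar>h k (X j)\<bar>)"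
            using abs_triangle_ineq[of "(h k (X j))\<^sup>2" "2 * e j * h k (X j)"] by (simp add: abs_mult)
          moreover have "2 * (\<bar>e j\<bar> * (2 * \<Gamma>)) = 4 * \<Gamma> * \<bar>e j\<bar>" by simp
          ultimately show ?thesis using h_bd(2)[of k "X j"] unfolding real_norm_def prod.case by linarith
        qed
      qed (use Fx[of X] eint in auto)
      also have "\<dots> = 4 * \<Gamma>\<^sup>2 + 4 * \<Gamma> * (\<integral>e. \<bar>e j\<bar> \<partial>Q)"
        using eint by (simp add: Q.prob_space)
      finally show ?thesis by simp
    qed
    have I: "integrable (V \<Otimes>\<^sub>M Q) ?F"
    proof (rule VQ.Fubini_integrable[OF Fm])
      show "integrable V (\<lambda>X. \<integral>e. norm (?F (X, e)) \<partial>Q)"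
        by (rule V.integrable_const_bound[OF _ m1]) (use bd in auto)
      show "AE X in V. integrable Q (\<lambda>e. ?F (X, e))" using Fx by simp
    qed
    have "(\<integral>y. ?F y \<partial>(V \<Otimes>\<^sub>M Q)) = (\<integral>X. (\<integral>e. ?F (X, e) \<partial>Q) \<partial>V)"
      by (rule VQ.integral_fst'[OF I, symmetric])
    also have "\<dots> = (\<integral>X. (h k (X j))\<^sup>2 \<partial>V)" unfolding Fint ..
    also have "\<dots> = (\<integral>x. (h k x)\<^sup>2 \<partial>distr V \<nu> (\<lambda>X. X j))"
    proof (rule integral_distr[symmetric])
      show "(\<lambda>X. X j) \<in> V \<rightarrow>\<^sub>M \<nu>" by (subst measurable_cong_sets[OF refl sets_nu]) measurable
      show "(\<lambda>x. (h k x)\<^sup>2) \<in> borel_measurable \<nu>" by (subst measurable_cong_sets[OF sets_nu refl]) measurable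
    qed
    also have "distr V \<nu> (\<lambda>X. X j) = \<nu>"
      unfolding V_def using j prob_nu by (intro distr_PiM_component) auto
    finally show ?thesis using I by (simp add: D_def)
  qed
  have e: "excess k = (\<lambda>y. \<Sum>j\<in>{1..n}. case y of (X, \<epsilon>) \<Rightarrow> (h k (X j))\<^sup>2 + 2 * \<epsilon> j * h k (X j))"
    by (auto simp: excess_def fun_eq_iff)
  show "integrable (V \<Otimes>\<^sub>M Q) (excess k)" unfolding e using one by (intro Bochner_Integration.integrable_sum) auto
  show "(\<integral>y. excess k y \<partial>(V \<Otimes>\<^sub>M Q)) = real n * D k"
    unfolding e using one by (subst Bochner_Integration.integral_sum) auto
qed

definition "sel = (\<lambda>(X, \<epsilon>). erm_index n K g (sample n f X \<epsilon>))"

lemma sel_in: "sel y \<in> K" unfolding sel_def by (cases y) (simp add: erm_index[OF K])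

lemma sel_min: assumes "k \<in> K" shows "excess (sel y) y \<le> excess k y"
proof -
  obtain X \<epsilon> where y: "y = (X, \<epsilon>)" by fastforce
  \<comment> \<open>The residual sum of squares differs from \<open>excess k\<close> by the sum of
    the squared errors, which is the same for every \<open>k\<close>; the minimisers
    coincide.\<close>
  have s: "(\<Sum>j\<in>{1..n}. (snd (sample n f X \<epsilon> j) - g k (fst (sample n f X \<epsilon> j)))\<^sup>2) = excess k (X, \<epsilon>) + (\<Sum>j\<in>{1..n}. (\<epsilon> j)\<^sup>2)" for k
    unfolding excess_def prod.case sum.distrib[symmetric]
    by (intro sum.cong) (simp_all add: sample_def h_def power2_eq_square algebra_simps)
  show ?thesis using erm_index(2)[OF K assms, where z = "sample n f X \<epsilon>" and n = n and g = g] unfolding s y sel_def by simp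
qed

lemma sample_meas: "(\<lambda>(X, \<epsilon>). sample n f X \<epsilon>) \<in> measurable (V \<Otimes>\<^sub>M Q) (\<Pi>\<^sub>M i\<in>{1..n}. borel \<Otimes>\<^sub>M borel)"
  unfolding sample_def case_prod_beta' by (rule measurable_restrict) measurable

lemma sel_meas [measurable]: "sel \<in> measurable (V \<Otimes>\<^sub>M Q) (count_space UNIV)"
proof -
  have "sel = erm_index n K g \<circ> (\<lambda>(X, \<epsilon>). sample n f X \<epsilon>)" unfolding sel_def by auto
  then show ?thesis using measurable_comp[OF sample_meas measurable_erm_index[OF K(1) g_meas]] by simp
qed

text \<open>The inequality \<open>w \<le> exp (w - E) - 1 + E\<close> replaces Jensen's inequality.\<close>

lemma erm_bound:
  assumes k: "k \<in> K" and E: "real (card K) \<le> exp E"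
  shows "(\<integral>\<^sup>+y. ennreal (D (sel y)) \<partial>(V \<Otimes>\<^sub>M Q)) \<le> ennreal (4 * D k + 16 * (\<sigma>\<^sup>2 + \<Gamma>\<^sup>2) * E / real n)"
proof -
  define W where "W k y = - \<theta> * excess k y + \<theta> / 4 * real n * D k" for k y
  \<comment> \<open>Summing the exponentials over the whole net bounds the one at the data-dependent
    index \<open>sel y\<close>, while the expectation of the sum is at most the cardinality of the
    net.\<close>
  define U where "U y = (\<Sum>k\<in>K. exp (W k y))" for y
  have [measurable]: "W k \<in> borel_measurable (V \<Otimes>\<^sub>M Q)" for k unfolding W_def by measurable
  have [measurable]: "U \<in> borel_measurable (V \<Otimes>\<^sub>M Q)" unfolding U_def by measurable
  have U0: "0 \<le> U y" for y unfolding U_def by (intro sum_nonneg) auto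
  have "(\<integral>\<^sup>+y. ennreal (U y) \<partial>(V \<Otimes>\<^sub>M Q)) = (\<Sum>k\<in>K. \<integral>\<^sup>+y. ennreal (exp (W k y)) \<partial>(V \<Otimes>\<^sub>M Q))"
    unfolding U_def by (subst nn_integral_sum[symmetric]) (auto simp: sum_ennreal)
  also have "\<dots> \<le> (\<Sum>k\<in>K. 1)" unfolding W_def by (intro sum_mono mgf_excess)
  also have "\<dots> = ennreal (real (card K))" by (simp add: ennreal_of_nat_eq_real_of_nat)
  finally have Uint: "(\<integral>\<^sup>+y. ennreal (U y) \<partial>(V \<Otimes>\<^sub>M Q)) \<le> ennreal (real (card K))" .
  have Ui: "integrable (V \<Otimes>\<^sub>M Q) U"
    using Uint U0 by (intro integrableI_nonneg) (auto intro: le_less_trans)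
  have UE: "(\<integral>y. U y \<partial>(V \<Otimes>\<^sub>M Q)) \<le> real (card K)"
    using Uint nn_integral_eq_integral[OF Ui] U0 by (simp add: ennreal_le_iff)
  have Db: "D k \<le> 4 * \<Gamma>\<^sup>2" for k
  proof -
    have "D k \<le> (\<integral>x. 4 * \<Gamma>\<^sup>2 \<partial>\<nu>)" unfolding D_def by (intro integral_mono) (auto simp: h_bd)
    then show ?thesis by (simp add: nu.prob_space)
  qed
  have Dm [measurable]: "(\<lambda>y. D (sel y)) \<in> borel_measurable (V \<Otimes>\<^sub>M Q)" by measurable
  have Di: "integrable (V \<Otimes>\<^sub>M Q) (\<lambda>y. D (sel y))"
    by (rule VQ.P.integrable_const_bound[of _ "4 * \<Gamma>\<^sup>2"]) (use Db D_nonneg in auto)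
  have pt: "\<theta> / 4 * real n * D (sel y) \<le> exp (- E) * U y - 1 + E + \<theta> * excess k y" for y
  proof -
    have "exp (W (sel y) y) \<le> U y" unfolding U_def using K sel_in by (intro member_le_sum) auto
    then have "exp (W (sel y) y - E) \<le> exp (- E) * U y"
      by (simp add: exp_diff exp_minus field_simps)
    moreover have "1 + (W (sel y) y - E) \<le> exp (W (sel y) y - E)" by (rule exp_ge_add_one_self)
    moreover have "\<theta> * excess (sel y) y \<le> \<theta> * excess k y" using sel_min[OF k] theta by (intro mult_left_mono) auto
    ultimately show ?thesis unfolding W_def by linarith
  qed
  have "\<theta> / 4 * real n * (\<integral>y. D (sel y) \<partial>(V \<Otimes>\<^sub>M Q)) = (\<integral>y. \<theta> / 4 * real n * D (sel y) \<partial>(V \<Otimes>\<^sub>M Q))"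
    by simp
  also have "\<dots> \<le> (\<integral>y. exp (- E) * U y - 1 + E + \<theta> * excess k y \<partial>(V \<Otimes>\<^sub>M Q))"
    using pt Ui Di integrable_excess by (intro integral_mono) auto
  also have "\<dots> = exp (- E) * (\<integral>y. U y \<partial>(V \<Otimes>\<^sub>M Q)) - 1 + E + \<theta> * (real n * D k)"
    using Ui integrable_excess[of k] by (simp add: VQ.P.prob_space integral_excess)
  \<comment> \<open>\<open>exp (- E)\<close> is calibrated to the cardinality of the net, so the
    first term is at most 1 and is cancelled by the \<open>- 1\<close>.\<close>
  also have "\<dots> \<le> E + \<theta> * (real n * D k)"
  proof -
    have "exp (- E) * (\<integral>y. U y \<partial>(V \<Otimes>\<^sub>M Q)) \<le> exp (- E) * exp E"
      using UE E by (intro mult_left_mono) auto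
    then show ?thesis by (simp flip: exp_add)
  qed
  finally have "\<theta> / 4 * real n * (\<integral>y. D (sel y) \<partial>(V \<Otimes>\<^sub>M Q)) \<le> E + \<theta> * (real n * D k)" .
  then have "(\<theta> * real n) * (\<integral>y. D (sel y) \<partial>(V \<Otimes>\<^sub>M Q)) \<le> (\<theta> * real n) * (4 * D k + 4 * E / (\<theta> * real n))"
  proof -
    have "(\<theta> * real n) * (4 * D k + 4 * E / (\<theta> * real n)) = 4 * (\<theta> * (real n * D k)) + 4 * E"
      using theta n by (simp add: distrib_left)
    moreover have "(\<theta> * real n) * (\<integral>y. D (sel y) \<partial>(V \<Otimes>\<^sub>M Q)) = 4 * (\<theta> / 4 * real n * (\<integral>y. D (sel y) \<partial>(V \<Otimes>\<^sub>M Q)))" by simp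
    ultimately show ?thesis using \<open>\<theta> / 4 * real n * (\<integral>y. D (sel y) \<partial>(V \<Otimes>\<^sub>M Q)) \<le> E + \<theta> * (real n * D k)\<close>
      by linarith
  qed
  then have "(\<integral>y. D (sel y) \<partial>(V \<Otimes>\<^sub>M Q)) \<le> 4 * D k + 4 * E / (\<theta> * real n)"
    by (rule mult_left_le_imp_le) (use theta n in auto)
  also have "4 * E / (\<theta> * real n) = 16 * (\<sigma>\<^sup>2 + \<Gamma>\<^sup>2) * E / real n"
    unfolding \<theta>_def by (simp add: field_simps)
  finally show ?thesis
    using nn_integral_eq_integral[OF Di] D_nonneg by (simp add: ennreal_leI)
qed

end

section \<open>Reduction of the minimax risk to metric entropy\<close>

lemma AE_interior_design:
  fixes \<Omega> :: "'a::euclidean_space set"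
  assumes "convex_body \<Omega>" "design_law \<Omega> \<nu> p"
  shows "AE x in \<nu>. x \<in> interior \<Omega>"
proof -
  have cl: "closed \<Omega>" "convex \<Omega>" using assms(1) by (auto simp: convex_body_def compact_imp_closed)
  have [measurable]: "\<Omega> \<in> sets borel" "p \<in> borel_measurable borel" using cl assms by (auto simp: design_law_def)
  have nu: "\<nu> = density lborel (\<lambda>x. p x * indicator \<Omega> x)" using assms by (simp add: design_law_def)
  have "frontier \<Omega> \<in> null_sets lborel"
    using negligible_convex_frontier[OF cl(2)] by (simp add: negligible_iff_null_sets null_sets_completion_iff frontier_closed)
  then have "AE x in lborel. x \<notin> frontier \<Omega>" by (rule AE_not_in)
  then have "AE x in lborel. 0 < p x * indicator \<Omega> x \<longrightarrow> x \<in> interior \<Omega>"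
    by eventually_elim (auto simp: frontier_def indicator_def closure_closed[OF cl(1)] split: if_splits)
  then show ?thesis unfolding nu by (subst AE_density) auto
qed

lemma sets_design: "design_law \<Omega> \<nu> p \<Longrightarrow> sets \<nu> = sets borel"
  by (auto simp: design_law_def)

lemma AE_in_design:
  assumes "convex_body \<Omega>" "design_law \<Omega> \<nu> p"
  shows "AE x in \<nu>. x \<in> \<Omega>"
  using AE_interior_design[OF assms] by eventually_elim (use interior_subset in auto)

text \<open>The lower integral respects almost-everywhere equality even for functions that are not
  Borel, so a convex function that is irregular on the boundary can be exchanged for its
  truncation.\<close>

lemma sq_loss_cong:
  assumes "convex_body \<Omega>" "design_law \<Omega> \<nu> p"
    and "\<And>x. x \<in> interior \<Omega> \<Longrightarrow> f x = f' x" "\<And>x. x \<in> interior \<Omega> \<Longrightarrow> g x = g' x"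
  shows "sq_loss \<Omega> \<nu> f g = sq_loss \<Omega> \<nu> f' g'"
  unfolding sq_loss_def
  by (rule nn_integral_cong_AE) (use AE_interior_design[OF assms(1,2)] in eventually_elim, simp add: assms)

text \<open>The label classes of \<open>splits\<close> supply the net: one representative per label,
  and the one sharing the label of the truth is within squared distance \<open>e\<close>. The
  constants are those of the oracle inequality, where \<open>4 * E / (\<theta> * n)\<close> becomes
  \<open>16 * (\<sigma>^2 + \<Gamma>^2) * E / n\<close>.\<close>

lemma minimax_risk_le_splits:
  fixes \<Omega> :: "'a::euclidean_space set"
  assumes \<Omega>: "convex_body \<Omega>" and dl: "design_law \<Omega> \<nu> p" and \<Gamma>: "\<Gamma> > 0" and n: "n \<ge> 1"
    and err: "subgaussian_errors n \<sigma> Q" and e: "0 \<le> e"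
    and sp: "splits (bounded_convex \<Omega> \<Gamma>) E (\<lambda>f g. sq_loss \<Omega> \<nu> f g \<le> ennreal e)"
  shows "minimax_risk \<Omega> \<nu> Q n (bounded_convex \<Omega> \<Gamma>) \<le> ennreal (4 * e + 16 * (\<sigma>\<^sup>2 + \<Gamma>\<^sup>2) * E / real n)"
proof -
  let ?F = "bounded_convex \<Omega> \<Gamma>" and ?S = "interior \<Omega>"
  interpret nu: prob_space \<nu> using dl unfolding design_law_def by blast
  note AE_S = AE_interior_design[OF \<Omega> dl]
  have sets_nu [measurable_cong]: "sets \<nu> = sets borel" by (rule sets_design[OF dl])
  \<comment> \<open>Setting the function to 0 off the interior makes it Borel, since a convex
    function is continuous on an open set, and alters it only on a null set of the design.\<close>
  define tr where "tr f = (\<lambda>x. if x \<in> ?S then f x else 0)" for f :: "'a \<Rightarrow> real"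
  have tr_meas: "tr f \<in> borel_measurable borel" if "f \<in> ?F" for f
  proof -
    have "convex_on ?S f"
      using that \<Omega> by (intro convex_on_subset[of \<Omega> f ?S] interior_subset convex_interior)
        (auto simp: bounded_convex_def convex_body_def)
    then have "continuous_on ?S f" by (intro convex_on_continuous) auto
    then have "(\<lambda>x. indicator ?S x *\<^sub>R f x) \<in> borel_measurable borel"
      by (intro borel_measurable_continuous_on_indicator) auto
    moreover have "tr f = (\<lambda>x. indicator ?S x *\<^sub>R f x)" by (auto simp: tr_def indicator_def fun_eq_iff)
    ultimately show ?thesis by simp
  qed
  have tr_bd: "\<bar>tr f x\<bar> \<le> \<Gamma>" if "f \<in> ?F" for f x
    using that \<Gamma> interior_subset[of \<Omega>] by (auto simp: tr_def bounded_convex_def)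
  obtain \<kappa> :: "('a \<Rightarrow> real) \<Rightarrow> nat" where \<kappa>: "finite (\<kappa> ` ?F)" "real (card (\<kappa> ` ?F)) \<le> exp E"
    "\<And>f g. f \<in> ?F \<Longrightarrow> g \<in> ?F \<Longrightarrow> \<kappa> f = \<kappa> g \<Longrightarrow> sq_loss \<Omega> \<nu> f g \<le> ennreal e"
    using sp unfolding splits_def by blast
  define K where "K = \<kappa> ` ?F"
  define rep where "rep k = (SOME f. f \<in> ?F \<and> \<kappa> f = k)" for k
  have rep: "rep k \<in> ?F" "\<kappa> (rep k) = k" if "k \<in> K" for k
  proof -
    have "\<exists>f. f \<in> ?F \<and> \<kappa> f = k" using that unfolding K_def by auto
    then have "rep k \<in> ?F \<and> \<kappa> (rep k) = k" unfolding rep_def by (rule someI_ex)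
    then show "rep k \<in> ?F" "\<kappa> (rep k) = k" by auto
  qed
  \<comment> \<open>The zero default makes \<open>g k\<close> Borel and bounded for every index, as
    \<open>erm_net\<close> demands, and not only for the labels that occur.\<close>
  define g where "g k = (if k \<in> K then tr (rep k) else (\<lambda>_. 0))" for k
  have g_meas [measurable]: "g k \<in> borel_measurable borel" for k
    using tr_meas[OF rep(1)] by (auto simp: g_def)
  have g_bd: "\<bar>g k x\<bar> \<le> \<Gamma>" for k x using tr_bd[OF rep(1)] \<Gamma> by (auto simp: g_def)
  have K: "finite K" using \<kappa> by (simp add: K_def)
  define fhat where "fhat z = g (erm_index n K g z)" for z
  have fhat: "fhat \<in> estimators n"
  proof -
    \<comment> \<open>The index takes countably many values, so joint measurability of the estimator
      reduces to that of the index and of each \<open>g k\<close>.\<close>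
    have m: "(\<lambda>(z, x). erm_index n K g z) \<in> measurable ((\<Pi>\<^sub>M i\<in>{1..n}. borel \<Otimes>\<^sub>M borel) \<Otimes>\<^sub>M borel) (count_space UNIV)"
      unfolding case_prod_beta'
      by (rule measurable_compose[OF measurable_fst measurable_erm_index[OF K g_meas]])
    have "(\<lambda>y. (\<lambda>k y. g k (snd y)) (case y of (z, x) \<Rightarrow> erm_index n K g z) y) \<in> borel_measurable ((\<Pi>\<^sub>M i\<in>{1..n}. borel \<Otimes>\<^sub>M borel) \<Otimes>\<^sub>M borel)"
      by (rule measurable_compose_countable[OF _ m]) measurable
    then show ?thesis unfolding estimators_def fhat_def by (simp add: case_prod_beta')
  qed
  have "risk \<Omega> \<nu> Q n f fhat \<le> ennreal (4 * e + 16 * (\<sigma>\<^sup>2 + \<Gamma>\<^sup>2) * E / real n)" if f: "f \<in> ?F" for f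
  proof -
    have kf: "\<kappa> f \<in> K" using f by (simp add: K_def)
    interpret erm_net \<nu> Q n \<sigma> \<Gamma> "tr f" K g
      by unfold_locales (use sets_nu err n \<Gamma> tr_meas[OF f] tr_bd[OF f] K kf g_meas g_bd in auto)
    have loss: "sq_loss \<Omega> \<nu> f (g k) = ennreal (D k)" for k
    proof -
      have "sq_loss \<Omega> \<nu> f (g k) = sq_loss \<Omega> \<nu> (tr f) (g k)"
        by (rule sq_loss_cong[OF \<Omega> dl]) (auto simp: tr_def)
      also have "\<dots> = (\<integral>\<^sup>+x. ennreal ((h k x)\<^sup>2) \<partial>\<nu>)" unfolding sq_loss_def h_def
        by (rule nn_integral_cong_AE) (use AE_in_design[OF \<Omega> dl] in eventually_elim, simp)
      also have "\<dots> = ennreal (D k)" unfolding D_def by (rule nn_integral_eq_integral) auto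
      finally show ?thesis .
    qed
    have "ennreal (D (\<kappa> f)) = sq_loss \<Omega> \<nu> f (rep (\<kappa> f))"
      unfolding loss[symmetric] by (rule sq_loss_cong[OF \<Omega> dl]) (auto simp: g_def tr_def kf)
    also have "\<dots> \<le> ennreal e" using \<kappa>(3)[OF f rep(1)[OF kf]] rep(2)[OF kf] by simp
    finally have De: "D (\<kappa> f) \<le> e" using e by simp
    have sm: "{y \<in> space (V \<Otimes>\<^sub>M Q). \<forall>j\<in>{1..n}. fst y j \<in> ?S} \<in> sets (V \<Otimes>\<^sub>M Q)"
    proof -
      have [measurable]: "?S \<in> sets borel" by simp
      show ?thesis by measurable
    qed
    \<comment> \<open>Almost surely all design points are interior, so the samples generated by
      \<open>f\<close> and by its truncation coincide.\<close>
    have "AE X in V. \<forall>j\<in>{1..n}. X j \<in> ?S" unfolding V_def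
      using AE_S by (intro AE_finite_allI AE_PiM_component prob_nu) auto
    then have "AE y in V \<Otimes>\<^sub>M Q. \<forall>j\<in>{1..n}. fst y j \<in> ?S"
      by (intro VQ.AE_pair_measure sm) (auto elim: eventually_mono)
    then have AE: "AE y in V \<Otimes>\<^sub>M Q. (case y of (X, \<epsilon>) \<Rightarrow> sq_loss \<Omega> \<nu> f (fhat (sample n f X \<epsilon>))) = ennreal (D (sel y))"
    proof eventually_elim
      case (elim y)
      obtain X \<epsilon> where y: "y = (X, \<epsilon>)" by fastforce
      have "sample n f X \<epsilon> = sample n (tr f) X \<epsilon>"
        unfolding sample_def by (rule restrict_ext) (use elim in \<open>simp add: tr_def y\<close>)
      then show ?case by (simp add: y fhat_def sel_def loss)
    qed
    have "risk \<Omega> \<nu> Q n f fhat = (\<integral>\<^sup>+y. ennreal (D (sel y)) \<partial>(V \<Otimes>\<^sub>M Q))"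
      unfolding risk_def V_def[symmetric] by (rule nn_integral_cong_AE[OF AE])
    also have "\<dots> \<le> ennreal (4 * D (\<kappa> f) + 16 * (\<sigma>\<^sup>2 + \<Gamma>\<^sup>2) * E / real n)"
      using \<kappa>(2) by (intro erm_bound[OF kf]) (simp add: K_def)
    also have "\<dots> \<le> ennreal (4 * e + 16 * (\<sigma>\<^sup>2 + \<Gamma>\<^sup>2) * E / real n)" using De by (intro ennreal_leI) simp
    finally show ?thesis .
  qed
  then show ?thesis unfolding minimax_risk_def by (intro INF_lower2[OF fhat] SUP_least)
qed

section \<open>Subgradients and slope charts\<close>

definition subgradient :: "('a::euclidean_space \<Rightarrow> real) \<Rightarrow> 'a set \<Rightarrow> 'a \<Rightarrow> 'a \<Rightarrow> bool" where
  "subgradient \<phi> S x p \<longleftrightarrow> (\<forall>y\<in>S. \<phi> x + p \<bullet> (y - x) \<le> \<phi> y)"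

text \<open>The epigraph is separated from the open vertical ray below the point of the graph. The
  separating hyperplane cannot be vertical because \<open>x\<close> is interior, and its slope is
  the subgradient.\<close>

lemma subgradient_exists:
  fixes \<phi> :: "'a::euclidean_space \<Rightarrow> real"
  assumes "convex_on S \<phi>" "x \<in> interior S"
  shows "\<exists>p. subgradient \<phi> S x p"
proof -
  have xS: "x \<in> S" using assms(2) interior_subset by auto
  let ?R = "{x} \<times> {..<\<phi> x}" and ?E = "epigraph S \<phi>"
  have "convex ?R" by (intro convex_Times) auto
  moreover have "convex ?E" using assms(1) by (rule convex_epigraphI)
  moreover have "?R \<noteq> {}" by (auto intro: exI[of _ "\<phi> x - 1"])
  moreover have "?E \<noteq> {}" using xS by (auto simp: epigraph_def)
  moreover have "?R \<inter> ?E = {}" by (auto simp: epigraph_def)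
  ultimately obtain a b where ab: "a \<noteq> 0" "\<forall>z\<in>?R. a \<bullet> z \<le> b" "\<forall>z\<in>?E. b \<le> a \<bullet> z"
    using separating_hyperplane_sets[of ?R ?E] by blast
  obtain a1 a2 where a: "a = (a1, a2)" by fastforce
  have 1: "a1 \<bullet> x + a2 * t \<le> b" if "t < \<phi> x" for t using ab(2) that by (force simp: a)
  have 2: "b \<le> a1 \<bullet> y + a2 * s" if "y \<in> S" "\<phi> y \<le> s" for y s
    using ab(3) that by (auto simp: a epigraph_def)
  have a2: "a2 \<ge> 0"
  proof -
    have "a1 \<bullet> x + a2 * (\<phi> x - 1) \<le> a1 \<bullet> x + a2 * \<phi> x" using 1[of "\<phi> x - 1"] 2[OF xS order_refl] by linarith
    then show ?thesis by (simp add: algebra_simps)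
  qed
  have lim: "a1 \<bullet> x + a2 * \<phi> x \<le> b"
  proof (rule tendsto_upperbound)
    show "((\<lambda>t. a1 \<bullet> x + a2 * t) \<longlongrightarrow> a1 \<bullet> x + a2 * \<phi> x) (at_left (\<phi> x))"
      by (intro tendsto_intros)
    show "\<forall>\<^sub>F t in at_left (\<phi> x). a1 \<bullet> x + a2 * t \<le> b"
      using 1 by (auto simp: eventually_at_filter)
  qed auto
  have 3: "a1 \<bullet> (y - x) + a2 * (\<phi> y - \<phi> x) \<ge> 0" if "y \<in> S" for y
    using 2[OF that order_refl] lim by (simp add: algebra_simps)
  \<comment> \<open>A vertical hyperplane would have all of \<open>S\<close> on one side of
    \<open>x\<close>, but \<open>S\<close> contains a step from \<open>x\<close> against the normal
    \<open>a1\<close>.\<close>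
  have "a2 \<noteq> 0"
  proof
    assume z: "a2 = 0"
    then have "a1 \<noteq> 0" using ab(1) by (auto simp: a zero_prod_def)
    obtain e where e: "e > 0" "cball x e \<subseteq> S" using assms(2) by (auto simp: mem_interior_cball)
    let ?y = "x - (e / norm a1) *\<^sub>R a1"
    have "?y \<in> cball x e" using e \<open>a1 \<noteq> 0\<close> by (simp add: dist_norm)
    then have "?y \<in> S" using e by blast
    then have "a1 \<bullet> (?y - x) \<ge> 0" using 3[of ?y] z by simp
    then have "(e / norm a1) * (a1 \<bullet> a1) \<le> 0" by simp
    moreover have "(e / norm a1) * (a1 \<bullet> a1) > 0" using e \<open>a1 \<noteq> 0\<close> by simp
    ultimately show False by simp
  qed
  with a2 have a2p: "a2 > 0" by simp
  have "\<phi> x + (- (1 / a2) *\<^sub>R a1) \<bullet> (y - x) \<le> \<phi> y" if "y \<in> S" for y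
  proof -
    have "0 \<le> (a1 \<bullet> (y - x) + a2 * (\<phi> y - \<phi> x)) / a2" using 3[OF that] a2p by simp
    also have "\<dots> = (1 / a2) * (a1 \<bullet> (y - x)) + (\<phi> y - \<phi> x)" using a2p by (simp add: add_divide_distrib)
    finally show ?thesis by simp
  qed
  then show ?thesis unfolding subgradient_def by blast
qed

text \<open>A diagonal map. Scaling points by some factors and slopes by their reciprocals preserves
  the pairing, hence convexity of jets.\<close>

definition chart_scale :: "('a::euclidean_space \<Rightarrow> real) \<Rightarrow> 'a \<Rightarrow> 'a" where
  "chart_scale c x = (\<Sum>b\<in>Basis. (c b * (x \<bullet> b)) *\<^sub>R b)"

lemma chart_scale_inner: "b \<in> Basis \<Longrightarrow> chart_scale c x \<bullet> b = c b * (x \<bullet> b)"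
  unfolding chart_scale_def by (simp add: inner_sum_left inner_Basis if_distrib sum.If_cases cong: if_cong)

lemma chart_scale_dual:
  assumes "\<And>b. b \<in> Basis \<Longrightarrow> c b * c' b = 1"
  shows "chart_scale c p \<bullet> (chart_scale c' x - chart_scale c' y) = p \<bullet> (x - y)"
proof -
  have "chart_scale c p \<bullet> (chart_scale c' x - chart_scale c' y) = (\<Sum>b\<in>Basis. (c b * c' b) * ((p \<bullet> b) * ((x - y) \<bullet> b)))"
    by (subst euclidean_inner) (auto intro!: sum.cong simp: chart_scale_inner inner_diff_left algebra_simps)
  also have "\<dots> = p \<bullet> (x - y)" using assms by (subst euclidean_inner) (auto intro!: sum.cong)
  finally show ?thesis .
qed

text \<open>Diagonal scaling brings points of size 2^-i and slopes of size 2^i into one fixed box,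
  so the entropy does not depend on the exponents \<open>i\<close>. Only jets inside the chart are
  recorded; the estimate is therefore claimed only at points where \<open>\<phi> f\<close> has a
  subgradient in the chart.\<close>

lemma splits_slope_chart:
  "\<exists>K>0. \<forall>(F::'f set) (\<phi> :: 'f \<Rightarrow> 'a::euclidean_space \<Rightarrow> real) T (i :: 'a \<Rightarrow> nat) r.
     (\<forall>f\<in>F. \<forall>y\<in>T. \<bar>\<phi> f y\<bar> \<le> 1) \<longrightarrow> 0 < r \<longrightarrow>
     splits F (K / r ^ DIM('a)) (\<lambda>f g. \<forall>y\<in>T. \<forall>p. subgradient (\<phi> f) T y p \<longrightarrow>
        (\<forall>b\<in>Basis. \<bar>y \<bullet> b\<bar> \<le> 4 / 2 ^ i b \<and> \<bar>p \<bullet> b\<bar> \<le> 2 ^ i b) \<longrightarrow> \<phi> f y - \<phi> g y \<le> K * r\<^sup>2)"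
proof -
  obtain K0 :: real where K0: "K0 > 0" and
    K: "\<And>(F::'f set) (J :: 'f \<Rightarrow> ('a \<times> 'a \<times> real) set) a r b0.
    \<lbrakk>\<forall>f\<in>F. convex_jets (J f);
    \<forall>f\<in>F. \<forall>(u, w, z)\<in>J f. \<bar>z\<bar> \<le> 2 \<and> (\<forall>b\<in>Basis. \<bar>u \<bullet> b\<bar> \<le> 2 * a b \<and> \<bar>w \<bullet> b\<bar> \<le> 2 * a b);
    0 < r; \<forall>b\<in>Basis. r \<le> a b \<and> a b \<le> 1; b0 \<in> Basis; a b0 = 1\<rbrakk> \<Longrightarrow>
    splits F (K0 * (\<Prod>b\<in>Basis. a b / r))
      (\<lambda>f g. \<forall>(u, w, z)\<in>J f. \<exists>(u', w', z')\<in>J g. z - K0 * r\<^sup>2 \<le> z' + w' \<bullet> (u - u'))"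
    using splits_convex_jets[where 'f='f and 'a='a] by blast
  \<comment> \<open>The added 2 covers \<open>r > 1\<close>, where two values in [-1, 1] differ by
    at most \<open>2 * r^2\<close>.\<close>
  define K1 where "K1 = K0 + 2"
  show ?thesis
  proof (intro exI[of _ K1] conjI allI impI)
    show "K1 > 0" using K0 by (simp add: K1_def)
    fix F :: "'f set" and \<phi> :: "'f \<Rightarrow> 'a \<Rightarrow> real" and T :: "'a set" and i :: "'a \<Rightarrow> nat" and r :: real
    assume bd: "\<forall>f\<in>F. \<forall>y\<in>T. \<bar>\<phi> f y\<bar> \<le> 1" and r: "0 < r"
    let ?R = "\<lambda>f g. \<forall>y\<in>T. \<forall>p. subgradient (\<phi> f) T y p \<longrightarrow>
        (\<forall>b\<in>Basis. \<bar>y \<bullet> b\<bar> \<le> 4 / 2 ^ i b \<and> \<bar>p \<bullet> b\<bar> \<le> 2 ^ i b) \<longrightarrow> \<phi> f y - \<phi> g y \<le> K1 * r\<^sup>2"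
    show "splits F (K1 / r ^ DIM('a)) ?R"
    proof (cases "r \<le> 1")
      case False
      show ?thesis
      proof (rule splits_trivial)
        show "0 \<le> K1 / r ^ DIM('a)" using r K0 by (simp add: K1_def)
        fix f g assume fg: "f \<in> F" "g \<in> F"
        have "\<phi> f y - \<phi> g y \<le> K1 * r\<^sup>2" if "y \<in> T" for y
        proof -
          have "\<bar>\<phi> f y\<bar> \<le> 1" "\<bar>\<phi> g y\<bar> \<le> 1" using bd fg that by auto
          moreover have "2 * 1 \<le> K1 * r\<^sup>2" using False K0 by (intro mult_mono) (auto simp: K1_def one_le_power)
          ultimately show ?thesis by linarith
        qed
        then show "?R f g" by blast
      qed
    next
      case True
      define J where "J f = {(u, w, z). \<exists>y p. y \<in> T \<and> subgradient (\<phi> f) T y p \<and>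
         (\<forall>b\<in>Basis. \<bar>y \<bullet> b\<bar> \<le> 4 / 2 ^ i b \<and> \<bar>p \<bullet> b\<bar> \<le> 2 ^ i b) \<and>
         u = chart_scale (\<lambda>b. 2 ^ i b / 2) y \<and> w = chart_scale (\<lambda>b. 2 / 2 ^ i b) p \<and> z = \<phi> f y}" for f
      have dual: "chart_scale (\<lambda>b. 2 / 2 ^ i b) p \<bullet> (chart_scale (\<lambda>b. 2 ^ i b / 2) x - chart_scale (\<lambda>b. 2 ^ i b / 2) y) = p \<bullet> (x - y)" for p x y :: 'a
        by (rule chart_scale_dual) simp
      obtain b0 :: 'a where b0: "b0 \<in> Basis" using nonempty_Basis by blast
      have sp: "splits F (K0 * (\<Prod>b\<in>(Basis::'a set). 1 / r)) (\<lambda>f g. \<forall>(u, w, z)\<in>J f. \<exists>(u', w', z')\<in>J g. z - K0 * r\<^sup>2 \<le> z' + w' \<bullet> (u - u'))"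
      proof (rule K[where a = "\<lambda>_. 1" and ?b0.0 = b0])
        show "\<forall>f\<in>F. convex_jets (J f)"
          unfolding convex_jets_def J_def by (auto simp: dual subgradient_def)
        show "\<forall>f\<in>F. \<forall>(u, w, z)\<in>J f. \<bar>z\<bar> \<le> 2 \<and> (\<forall>b\<in>Basis. \<bar>u \<bullet> b\<bar> \<le> 2 * 1 \<and> \<bar>w \<bullet> b\<bar> \<le> 2 * 1)"
        proof (intro ballI, clarify)
          fix f u w z assume f: "f \<in> F" and "(u, w, z) \<in> J f"
          then obtain y p where y: "y \<in> T" "\<forall>b\<in>Basis. \<bar>y \<bullet> b\<bar> \<le> 4 / 2 ^ i b \<and> \<bar>p \<bullet> b\<bar> \<le> 2 ^ i b"
            "u = chart_scale (\<lambda>b. 2 ^ i b / 2) y" "w = chart_scale (\<lambda>b. 2 / 2 ^ i b) p" "z = \<phi> f y"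
            unfolding J_def by auto
          have "\<bar>z\<bar> \<le> 2" using bd f y by force
          moreover have "\<bar>u \<bullet> b\<bar> \<le> 2 * 1 \<and> \<bar>w \<bullet> b\<bar> \<le> 2 * 1" if "b \<in> Basis" for b
            using y(2) that by (auto simp: y chart_scale_inner abs_mult field_simps)
          ultimately show "\<bar>z\<bar> \<le> 2 \<and> (\<forall>b\<in>Basis. \<bar>u \<bullet> b\<bar> \<le> 2 * 1 \<and> \<bar>w \<bullet> b\<bar> \<le> 2 * 1)" by blast
        qed
      qed (use r True b0 in auto)
      show ?thesis
      proof (rule splits_mono[OF sp])
        have "K0 * (\<Prod>b\<in>(Basis::'a set). 1 / r) = K0 / r ^ DIM('a)" by (simp add: power_one_over)
        also have "\<dots> \<le> K1 / r ^ DIM('a)" using r by (intro divide_right_mono) (auto simp: K1_def)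
        finally show "K0 * (\<Prod>b\<in>(Basis::'a set). 1 / r) \<le> K1 / r ^ DIM('a)" .
        fix f g assume fg: "f \<in> F" "g \<in> F"
          and close: "\<forall>(u, w, z)\<in>J f. \<exists>(u', w', z')\<in>J g. z - K0 * r\<^sup>2 \<le> z' + w' \<bullet> (u - u')"
        show "?R f g"
        proof (intro ballI allI impI)
          fix y p assume y: "y \<in> T" "subgradient (\<phi> f) T y p" "\<forall>b\<in>Basis. \<bar>y \<bullet> b\<bar> \<le> 4 / 2 ^ i b \<and> \<bar>p \<bullet> b\<bar> \<le> 2 ^ i b"
          then have "(chart_scale (\<lambda>b. 2 ^ i b / 2) y, chart_scale (\<lambda>b. 2 / 2 ^ i b) p, \<phi> f y) \<in> J f"
            unfolding J_def by blast
          from bspec[OF close this] obtain u' w' z' where j: "(u', w', z') \<in> J g"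
            "\<phi> f y - K0 * r\<^sup>2 \<le> z' + w' \<bullet> (chart_scale (\<lambda>b. 2 ^ i b / 2) y - u')" by auto
          \<comment> \<open>The matching jet of \<open>g\<close> may sit at another point
            \<open>y'\<close>, but its minorant lies below \<open>\<phi> g\<close> on all of
            \<open>T\<close> and so bounds \<open>\<phi> g y\<close> from below.\<close>
          from j(1) obtain y' p' where y': "y' \<in> T" "subgradient (\<phi> g) T y' p'"
            "u' = chart_scale (\<lambda>b. 2 ^ i b / 2) y'" "w' = chart_scale (\<lambda>b. 2 / 2 ^ i b) p'" "z' = \<phi> g y'"
            unfolding J_def by blast
          have "\<phi> f y - K0 * r\<^sup>2 \<le> \<phi> g y' + p' \<bullet> (y - y')" using j(2) unfolding y' dual .
          also have "\<dots> \<le> \<phi> g y" using y' y by (auto simp: subgradient_def)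
          finally have "\<phi> f y - \<phi> g y \<le> K0 * r\<^sup>2" by simp
          also have "\<dots> \<le> K1 * r\<^sup>2" by (intro mult_right_mono) (auto simp: K1_def)
          finally show "\<phi> f y - \<phi> g y \<le> K1 * r\<^sup>2" .
        qed
      qed
    qed
  qed
qed

section \<open>Bounded convex functions on simplices\<close>

text \<open>An upper-integral version of the squared L2 distance on \<open>S\<close>: the Borel
  majorant stands in for the squared difference, which may fail to be Borel. Majorants on
  overlapping sets add, which suits a cover by charts.\<close>

definition dominated :: "'a::euclidean_space set \<Rightarrow> real \<Rightarrow> ('a \<Rightarrow> real) \<Rightarrow> ('a \<Rightarrow> real) \<Rightarrow> bool" where
  "dominated S e f g \<longleftrightarrow> (\<exists>B\<in>borel_measurable borel. (\<forall>x\<in>S. ennreal ((f x - g x)\<^sup>2) \<le> B x) \<and>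
     (\<integral>\<^sup>+x. B x \<partial>lborel) \<le> ennreal e)"

lemma dominated_UN:
  assumes I: "finite I" and d: "\<And>i. i \<in> I \<Longrightarrow> dominated (S i) (e i) f g" and e: "\<And>i. i \<in> I \<Longrightarrow> 0 \<le> e i"
  shows "dominated (\<Union>i\<in>I. S i) (\<Sum>i\<in>I. e i) f g"
proof -
  from d have "\<forall>i\<in>I. \<exists>B. B \<in> borel_measurable borel \<and> (\<forall>x\<in>S i. ennreal ((f x - g x)\<^sup>2) \<le> B x) \<and>
     (\<integral>\<^sup>+x. B x \<partial>lborel) \<le> ennreal (e i)" unfolding dominated_def by blast
  from bchoice[OF this] obtain B where "\<forall>i\<in>I. B i \<in> borel_measurable borel \<and> (\<forall>x\<in>S i. ennreal ((f x - g x)\<^sup>2) \<le> B i x) \<and>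
     (\<integral>\<^sup>+x. B i x \<partial>lborel) \<le> ennreal (e i)" by blast
  then have B: "\<And>i. i \<in> I \<Longrightarrow> B i \<in> borel_measurable borel"
    "\<And>i x. i \<in> I \<Longrightarrow> x \<in> S i \<Longrightarrow> ennreal ((f x - g x)\<^sup>2) \<le> B i x"
    "\<And>i. i \<in> I \<Longrightarrow> (\<integral>\<^sup>+x. B i x \<partial>lborel) \<le> ennreal (e i)" by auto
  have "(\<lambda>x. \<Sum>i\<in>I. B i x) \<in> borel_measurable borel" using B by (intro borel_measurable_sum) auto
  moreover have "ennreal ((f x - g x)\<^sup>2) \<le> (\<Sum>i\<in>I. B i x)" if "x \<in> (\<Union>i\<in>I. S i)" for x
  proof -
    from that obtain i where i: "i \<in> I" "x \<in> S i" by auto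
    have "B i x \<le> (\<Sum>i\<in>I. B i x)" using I i by (intro member_le_sum) auto
    then show ?thesis using B(2)[OF i] by (rule order_trans[rotated])
  qed
  moreover have "(\<integral>\<^sup>+x. (\<Sum>i\<in>I. B i x) \<partial>lborel) \<le> ennreal (\<Sum>i\<in>I. e i)"
  proof -
    have "(\<integral>\<^sup>+x. (\<Sum>i\<in>I. B i x) \<partial>lborel) = (\<Sum>i\<in>I. \<integral>\<^sup>+x. B i x \<partial>lborel)"
      using B by (intro nn_integral_sum) auto
    also have "\<dots> \<le> (\<Sum>i\<in>I. ennreal (e i))" by (intro sum_mono B)
    also have "\<dots> = ennreal (\<Sum>i\<in>I. e i)" using e by (simp add: sum_ennreal)
    finally show ?thesis .
  qed
  ultimately show ?thesis unfolding dominated_def by (intro bexI[of _ "\<lambda>x. \<Sum>i\<in>I. B i x"]) auto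
qed

lemma dominated_mono:
  assumes "dominated S e f g" "S' \<subseteq> S" "e \<le> e'"
  shows "dominated S' e' f g"
proof -
  obtain B where B: "B \<in> borel_measurable borel" "\<forall>x\<in>S. ennreal ((f x - g x)\<^sup>2) \<le> B x" "(\<integral>\<^sup>+x. B x \<partial>lborel) \<le> ennreal e"
    using assms(1) unfolding dominated_def by auto
  have "(\<integral>\<^sup>+x. B x \<partial>lborel) \<le> ennreal e'" using B(3) ennreal_leI[OF assms(3)] by (rule order_trans)
  then show ?thesis unfolding dominated_def using B(1,2) assms(2) by (intro bexI[of _ B]) auto
qed

section \<open>Parallelepipeds at a vertex of a simplex\<close>

definition slab_box :: "('a \<Rightarrow> 'a) \<Rightarrow> 'a \<Rightarrow> ('a::euclidean_space \<Rightarrow> real) \<Rightarrow> 'a set" where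
  "slab_box M v c = {x. \<forall>b\<in>Basis. 0 \<le> M (x - v) \<bullet> b \<and> M (x - v) \<bullet> b < c b}"

lemma slab_box_measurable [measurable]:
  assumes "linear M"
  shows "slab_box M v c \<in> sets borel"
proof -
  have "continuous_on UNIV M" using assms by (simp add: linear_continuous_on linear_conv_bounded_linear)
  then have [measurable]: "M \<in> borel_measurable borel" by (rule borel_measurable_continuous_onI)
  show ?thesis unfolding slab_box_def by measurable
qed

lemma emeasure_translate:
  assumes "A \<in> sets borel"
  shows "emeasure lborel {x :: 'a::euclidean_space. x - a \<in> A} = emeasure lborel A"
proof -
  have "emeasure lborel A = emeasure (distr lborel borel ((+) (- a))) A" by (simp add: lborel_distr_plus)
  also have "\<dots> = emeasure lborel {x. x - a \<in> A}"
    using assms by (subst emeasure_distr) (auto simp: vimage_def)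
  finally show ?thesis ..
qed

text \<open>The two halves are translates of each other along \<open>L b\<close>, and half-open
  sides make them disjoint. Translation invariance thus gives all dyadic volume ratios without a
  determinant.\<close>

lemma slab_box_halve:
  fixes L M :: "'a::euclidean_space \<Rightarrow> 'a"
  assumes L: "linear L" "linear M" "\<And>y. M (L y) = y" and b: "b \<in> Basis" and c: "0 \<le> c b"
  shows "emeasure lborel (slab_box M v c) = 2 * emeasure lborel (slab_box M v (c(b := c b / 2)))"
proof -
  let ?A = "slab_box M v (c(b := c b / 2))"
  define a where "a = (c b / 2) *\<^sub>R L b"
  let ?A' = "{x. x - a \<in> ?A}"
  have Ma: "M (x - a - v) \<bullet> b' = M (x - v) \<bullet> b' - (if b' = b then c b / 2 else 0)" if "b' \<in> Basis" for x b'
  proof -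
    have "M (x - a - v) = M ((x - v) - a)" by (simp add: algebra_simps)
    also have "\<dots> = M (x - v) - (c b / 2) *\<^sub>R b" using L by (simp add: linear_diff a_def linear_scale)
    finally show ?thesis using that b by (simp add: inner_diff_left inner_Basis)
  qed
  have iff: "x \<in> ?A' \<longleftrightarrow> (\<forall>b'\<in>Basis. (if b' = b then c b / 2 else 0) \<le> M (x - v) \<bullet> b' \<and> M (x - v) \<bullet> b' < c b')" for x
    unfolding slab_box_def mem_Collect_eq by (rule ball_cong) (auto simp: Ma)
  have un: "slab_box M v c = ?A \<union> ?A'"
  proof (rule set_eqI)
    fix x
    show "x \<in> slab_box M v c \<longleftrightarrow> x \<in> ?A \<union> ?A'"
    proof
      assume x: "x \<in> slab_box M v c"
      show "x \<in> ?A \<union> ?A'"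
      proof (cases "M (x - v) \<bullet> b < c b / 2")
        case True
        then have "x \<in> ?A" using x by (auto simp: slab_box_def)
        then show ?thesis by simp
      next
        case False
        then have "x \<in> ?A'" unfolding iff using x by (auto simp: slab_box_def)
        then show ?thesis by simp
      qed
    next
      assume "x \<in> ?A \<union> ?A'"
      then show "x \<in> slab_box M v c"
      proof
        assume "x \<in> ?A"
        then have "0 \<le> M (x - v) \<bullet> b' \<and> M (x - v) \<bullet> b' < (if b' = b then c b / 2 else c b')" if "b' \<in> Basis" for b'
          using that by (auto simp: slab_box_def)
        moreover have "(if b' = b then c b / 2 else c b') \<le> c b'" for b' using c by simp
        ultimately have "\<forall>b'\<in>Basis. 0 \<le> M (x - v) \<bullet> b' \<and> M (x - v) \<bullet> b' < c b'" by (meson less_le_trans)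
        then show ?thesis by (simp add: slab_box_def)
      next
        assume "x \<in> ?A'"
        then have "(if b' = b then c b / 2 else 0) \<le> M (x - v) \<bullet> b' \<and> M (x - v) \<bullet> b' < c b'" if "b' \<in> Basis" for b'
          unfolding iff using that by blast
        moreover have "0 \<le> (if b' = b then c b / 2 else 0)" for b' using c by simp
        ultimately have "\<forall>b'\<in>Basis. 0 \<le> M (x - v) \<bullet> b' \<and> M (x - v) \<bullet> b' < c b'" by (meson order_trans)
        then show ?thesis by (simp add: slab_box_def)
      qed
    qed
  qed
  have disj: "?A \<inter> ?A' = {}" unfolding disjoint_iff iff using b by (auto simp: slab_box_def)
  have m: "?A \<in> sets borel" using L by measurable
  have "continuous_on UNIV (\<lambda>x. x - a)" by (intro continuous_intros)
  then have [measurable]: "(\<lambda>x. x - a) \<in> borel_measurable borel" by (rule borel_measurable_continuous_onI)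
  have m': "?A' \<in> sets borel" using m by measurable
  have "emeasure lborel (slab_box M v c) = emeasure lborel ?A + emeasure lborel ?A'"
    unfolding un using m m' disj by (intro plus_emeasure[symmetric]) auto
  then show ?thesis unfolding emeasure_translate[OF m] by (simp add: mult_2)
qed

lemma slab_box_dyadic:
  fixes L M :: "'a::euclidean_space \<Rightarrow> 'a"
  assumes L: "linear L" "linear M" "\<And>y. M (L y) = y" and s: "0 \<le> s"
  shows "emeasure lborel (slab_box M v (\<lambda>_. s)) = 2 ^ (\<Sum>b\<in>Basis. i b) * emeasure lborel (slab_box M v (\<lambda>b. s / 2 ^ i b))"
proof (induction "\<Sum>b\<in>(Basis::'a set). i b" arbitrary: i)
  case 0
  then have "\<And>b. b \<in> Basis \<Longrightarrow> i b = 0" by simp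
  then have "slab_box M v (\<lambda>b. s / 2 ^ i b) = slab_box M v (\<lambda>_. s)" by (auto simp: slab_box_def)
  then show ?case using 0 by simp
next
  case (Suc n)
  have "\<exists>b\<in>Basis. i b \<noteq> 0"
  proof (rule ccontr)
    assume "\<not> (\<exists>b\<in>Basis. i b \<noteq> 0)"
    then show False using Suc(2) by simp
  qed
  then obtain b where b: "b \<in> Basis" "i b \<noteq> 0" by blast
  define j where "j = i(b := i b - 1)"
  have ib: "i b = Suc (j b)" using b by (simp add: j_def)
  have "(\<Sum>b\<in>(Basis::'a set). i b) = i b + (\<Sum>b\<in>Basis - {b}. i b)" using b by (simp add: sum.remove)
  moreover have "(\<Sum>b\<in>(Basis::'a set). j b) = j b + (\<Sum>b\<in>Basis - {b}. j b)" using b by (simp add: sum.remove)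
  moreover have "(\<Sum>b\<in>Basis - {b}. j b) = (\<Sum>b\<in>Basis - {b}. i b)" by (intro sum.cong) (auto simp: j_def)
  ultimately have S: "(\<Sum>b\<in>(Basis::'a set). i b) = Suc (\<Sum>b\<in>(Basis::'a set). j b)" using ib by simp
  have "emeasure lborel (slab_box M v (\<lambda>_. s)) = 2 ^ (\<Sum>b\<in>Basis. j b) * emeasure lborel (slab_box M v (\<lambda>b. s / 2 ^ j b))"
    using Suc S by (intro Suc(1)) simp
  also have "emeasure lborel (slab_box M v (\<lambda>b. s / 2 ^ j b)) = 2 * emeasure lborel (slab_box M v ((\<lambda>b. s / 2 ^ j b)(b := (s / 2 ^ j b) / 2)))"
    using s by (intro slab_box_halve[OF L b(1)]) auto
  also have "(\<lambda>b. s / 2 ^ j b)(b := (s / 2 ^ j b) / 2) = (\<lambda>b. s / 2 ^ i b)"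
  proof
    fix b' show "((\<lambda>b. s / 2 ^ j b)(b := (s / 2 ^ j b) / 2)) b' = s / 2 ^ i b'"
    proof (cases "b' = b")
      case True
      have "(2::real) ^ i b = 2 ^ j b * 2" unfolding ib by simp
      then show ?thesis using True by simp
    qed (auto simp: j_def)
  qed
  finally show ?case unfolding S by (simp add: algebra_simps)
qed

lemma sum_geometric_le:
  fixes s :: real
  assumes "0 \<le> s" "s < 1"
  shows "(\<Sum>k\<le>I. s ^ k) \<le> 1 / (1 - s)"
proof -
  have "(\<Sum>k\<le>I. s ^ k) \<le> (\<Sum>k. s ^ k)" using assms by (intro sum_le_suminf summable_geometric) auto
  also have "\<dots> = 1 / (1 - s)" using assms by (intro suminf_geometric) auto
  finally show ?thesis .
qed

lemma sum_PiE_geometric_le: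
  fixes s :: real
  assumes "0 \<le> s" "s < 1"
  shows "(\<Sum>i\<in>(\<Pi>\<^sub>E b\<in>(Basis::'a::euclidean_space set). {..I}). \<Prod>b\<in>Basis. s ^ i b) \<le> (1 / (1 - s)) ^ DIM('a)"
proof -
  have "(\<Sum>i\<in>(\<Pi>\<^sub>E b\<in>(Basis::'a set). {..I}). \<Prod>b\<in>Basis. s ^ i b) = (\<Prod>b\<in>(Basis::'a set). \<Sum>k\<le>I. s ^ k)"
    by (rule prod_sum_PiE[symmetric]) auto
  also have "\<dots> \<le> (\<Prod>b\<in>(Basis::'a set). 1 / (1 - s))"
    using assms sum_geometric_le[OF assms] by (intro prod_mono) (auto intro!: sum_nonneg)
  finally show ?thesis by simp
qed

section \<open>Slopes in a corner of the standard simplex\<close>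

definition std_interior :: "'a::euclidean_space set" where
  "std_interior = {y. (\<forall>b\<in>Basis. 0 < y \<bullet> b) \<and> (\<Sum>b\<in>Basis. y \<bullet> b) < 1}"

text \<open>The part of the standard simplex in which the barycentric coordinate of the vertex 0 is the largest.\<close>

definition std_corner :: "'a::euclidean_space set" where
  "std_corner = {y \<in> std_interior. \<forall>b\<in>Basis. y \<bullet> b \<le> 1 - (\<Sum>b\<in>Basis. y \<bullet> b)}"

lemma open_std_interior: "open (std_interior :: 'a::euclidean_space set)"
proof -
  have eq: "(std_interior :: 'a set) = (\<Inter>b\<in>Basis. {y::'a. 0 < y \<bullet> b}) \<inter> {y. (\<Sum>b\<in>Basis. y \<bullet> b) < 1}"
    by (auto simp: std_interior_def)
  have 1: "open (\<Inter>b\<in>Basis. {y::'a. 0 < y \<bullet> b})"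
    by (intro open_INT finite_Basis ballI open_Collect_less continuous_intros)
  have 2: "open {y::'a. (\<Sum>b\<in>Basis. y \<bullet> b) < 1}" by (intro open_Collect_less continuous_intros)
  show ?thesis unfolding eq by (rule open_Int[OF 1 2])
qed

lemma convex_std_interior: "convex (std_interior :: 'a::euclidean_space set)"
proof -
  have "(\<Sum>b\<in>Basis. y \<bullet> b) = (\<Sum>b\<in>Basis. b) \<bullet> y" for y :: 'a
    unfolding inner_sum_left by (intro sum.cong refl inner_commute)
  then have eq: "(std_interior :: 'a set) = (\<Inter>b\<in>Basis. {y::'a. b \<bullet> y > 0}) \<inter> {y. (\<Sum>b\<in>Basis. b) \<bullet> y < 1}"
    unfolding std_interior_def by (auto simp: inner_commute)
  show ?thesis unfolding eq by (intro convex_Int convex_INT convex_halfspace_gt convex_halfspace_lt)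
qed

lemma std_interior_le1:
  assumes "y \<in> std_interior" "b \<in> Basis"
  shows "0 < y \<bullet> b" "y \<bullet> b < 1"
proof -
  show "0 < y \<bullet> b" using assms by (auto simp: std_interior_def)
  have "y \<bullet> b \<le> (\<Sum>b\<in>Basis. y \<bullet> b)"
    using assms by (intro member_le_sum) (auto simp: std_interior_def less_imp_le)
  then show "y \<bullet> b < 1" using assms by (auto simp: std_interior_def)
qed

text \<open>In the corner the slack to the face opposite 0 is at least \<open>y \<bullet> b\<close>,
  so one can move along \<open>b\<close> in both directions by almost \<open>y \<bullet> b\<close>.
  A function bounded by 1 changes by at most 2 on the way.\<close>

lemma corner_slope:
  fixes y p :: "'a::euclidean_space"
  assumes bd: "\<And>y. y \<in> std_interior \<Longrightarrow> \<bar>\<phi> y\<bar> \<le> 1" and y: "y \<in> std_corner"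
    and p: "subgradient \<phi> std_interior y p" and b: "b \<in> Basis"
  shows "\<bar>p \<bullet> b\<bar> * (y \<bullet> b) \<le> 2"
proof (rule ccontr)
  assume "\<not> \<bar>p \<bullet> b\<bar> * (y \<bullet> b) \<le> 2"
  then have gt: "2 < \<bar>p \<bullet> b\<bar> * (y \<bullet> b)" by simp
  have yi: "y \<in> std_interior" and le: "y \<bullet> b \<le> 1 - (\<Sum>b\<in>Basis. y \<bullet> b)" using y b by (auto simp: std_corner_def)
  have pos: "0 < y \<bullet> b" using std_interior_le1[OF yi b] by simp
  have "p \<bullet> b \<noteq> 0" using gt by auto
  then have "0 < \<bar>p \<bullet> b\<bar>" by simp
  then have "2 / \<bar>p \<bullet> b\<bar> < y \<bullet> b" using gt by (simp add: pos_divide_less_eq mult.commute)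
  \<comment> \<open>A step strictly shorter than \<open>y \<bullet> b\<close> keeps both moved
    points in the open simplex, where \<open>\<phi>\<close> is controlled.\<close>
  then obtain t where t: "2 / \<bar>p \<bullet> b\<bar> < t" "t < y \<bullet> b" using dense by blast
  have t0: "0 < t" using t(1) \<open>0 < \<bar>p \<bullet> b\<bar>\<close> by (metis divide_pos_pos less_trans zero_less_numeral)
  have pt: "2 < \<bar>p \<bullet> b\<bar> * t" using t(1) \<open>0 < \<bar>p \<bullet> b\<bar>\<close> by (simp add: pos_divide_less_eq mult.commute)
  have sumb: "(\<Sum>b'\<in>Basis. (y + s *\<^sub>R b) \<bullet> b') = (\<Sum>b'\<in>Basis. y \<bullet> b') + s" for s
  proof -
    have "(\<Sum>b'\<in>Basis. b \<bullet> b') = (\<Sum>b'\<in>Basis. if b' = b then 1 else 0)"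
      using b by (intro sum.cong) (auto simp: inner_Basis)
    also have "\<dots> = 1" using b by simp
    finally show ?thesis unfolding inner_add_left inner_scaleR_left sum.distrib sum_distrib_left[symmetric] by simp
  qed
  have mem: "y + s *\<^sub>R b \<in> std_interior" if "\<bar>s\<bar> \<le> t" for s
    unfolding std_interior_def mem_Collect_eq sumb
  proof (intro conjI ballI)
    fix b' :: 'a assume b': "b' \<in> Basis"
    show "0 < (y + s *\<^sub>R b) \<bullet> b'"
      using that t std_interior_le1[OF yi b'] b b' by (auto simp: inner_add_left inner_Basis)
  qed (use that t le in linarith)
  have sg: "\<phi> y + p \<bullet> (s *\<^sub>R b) \<le> \<phi> (y + s *\<^sub>R b)" if "\<bar>s\<bar> \<le> t" for s
    using p mem[OF that] unfolding subgradient_def by fastforce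
  have "s * (p \<bullet> b) \<le> 2" if s: "\<bar>s\<bar> \<le> t" for s
  proof -
    show ?thesis using sg[OF s] bd[OF yi] bd[OF mem[OF s]] unfolding inner_scaleR_right by linarith
  qed
  from this[of t] this[of "- t"] t0 have "\<bar>t * (p \<bullet> b)\<bar> \<le> 2" by simp
  then show False using pt t0 by (simp add: abs_mult mult.commute)
qed

text \<open>The least admissible exponent is taken in each direction. Minimality makes the slope
  large whenever the exponent is positive, and in a corner a large slope confines the point to a
  thin slab.\<close>

lemma subgradient_in_chart:
  fixes p :: "'a::euclidean_space"
  assumes "\<And>b. b \<in> Basis \<Longrightarrow> \<bar>p \<bullet> b\<bar> \<le> 2 ^ I"
  obtains i where "i \<in> (\<Pi>\<^sub>E b\<in>Basis. {..I})" "\<And>b. b \<in> Basis \<Longrightarrow> \<bar>p \<bullet> b\<bar> \<le> 2 ^ i b"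
    "\<And>b. b \<in> Basis \<Longrightarrow> i b = 0 \<or> 2 ^ i b < 2 * \<bar>p \<bullet> b\<bar>"
proof -
  define i where "i = (\<lambda>b\<in>Basis. LEAST k. \<bar>p \<bullet> b\<bar> \<le> 2 ^ k)"
  have 1: "\<bar>p \<bullet> b\<bar> \<le> 2 ^ i b" if "b \<in> Basis" for b
    using LeastI[of "\<lambda>k. \<bar>p \<bullet> b\<bar> \<le> 2 ^ k", OF assms[OF that]] that by (simp add: i_def)
  have 2: "i b \<le> I" if "b \<in> Basis" for b
    using Least_le[of "\<lambda>k. \<bar>p \<bullet> b\<bar> \<le> 2 ^ k", OF assms[OF that]] that by (simp add: i_def)
  have 3: "i b = 0 \<or> 2 ^ i b < 2 * \<bar>p \<bullet> b\<bar>" if "b \<in> Basis" for b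
  proof (cases "i b")
    case (Suc k)
    have "k < (LEAST k. \<bar>p \<bullet> b\<bar> \<le> 2 ^ k)" using Suc that by (simp add: i_def)
    from not_less_Least[OF this] show ?thesis using Suc by simp
  qed simp
  show ?thesis by (rule that[of i]) (use 1 2 3 in \<open>auto simp: i_def\<close>)
qed

text \<open>With all exponents equal to \<open>3 + DIM('a)\<close> the sides are 2^-d for d =
  \<open>DIM('a)\<close>, and d / 2^d <= 1 puts this box inside \<open>D\<close>. Every other box is
  compared with it by halving, so the bound in terms of \<open>vol D\<close> is affinely
  invariant.\<close>

lemma slab_box_corner:
  fixes L M :: "'a::euclidean_space \<Rightarrow> 'a"
  assumes L: "linear L" "linear M" "\<And>y. M (L y) = y" "\<And>x. L (M x) = x"
    and D: "compact D" "\<And>y. (\<And>b. b \<in> Basis \<Longrightarrow> 0 \<le> y \<bullet> b) \<Longrightarrow> (\<Sum>b\<in>Basis. y \<bullet> b) \<le> 1 \<Longrightarrow> v + L y \<in> D"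
  shows "emeasure lborel (slab_box M v (\<lambda>b. 8 / 2 ^ i b))
    \<le> ennreal (2 ^ ((3 + DIM('a)) * DIM('a)) * (\<Prod>b\<in>Basis. (1 / 2) ^ i b) * vol D)"
proof -
  let ?m = "\<lambda>c. emeasure lborel (slab_box M v c)"
  have "slab_box M v (\<lambda>b. 8 / 2 ^ (3 + DIM('a))) \<subseteq> D"
  proof
    fix x assume x: "x \<in> slab_box M v (\<lambda>b. 8 / 2 ^ (3 + DIM('a)))"
    have "(\<Sum>b\<in>Basis. M (x - v) \<bullet> b) \<le> (\<Sum>b\<in>(Basis::'a set). 1 / 2 ^ DIM('a))"
      using x by (intro sum_mono) (auto simp: slab_box_def power_add less_imp_le)
    also have "\<dots> = real DIM('a) / 2 ^ DIM('a)" by simp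
    also have "\<dots> \<le> 1" using of_nat_less_two_power[of "DIM('a)"] by (simp add: less_imp_le)
    finally have "v + L (M (x - v)) \<in> D" using x by (intro D) (auto simp: slab_box_def)
    then show "x \<in> D" by (simp add: L)
  qed
  then have "?m (\<lambda>b. 8 / 2 ^ (3 + DIM('a))) \<le> emeasure lborel D"
    using D(1) by (intro emeasure_mono) (auto simp: compact_imp_closed)
  also have "\<dots> = ennreal (vol D)" using emeasure_compact_finite[OF D(1)] by (simp add: emeasure_eq_ennreal_measure)
  finally have le: "?m (\<lambda>b. 8 / 2 ^ (3 + DIM('a))) \<le> ennreal (vol D)" .
  have "2 ^ (\<Sum>b\<in>Basis. i b) * ?m (\<lambda>b. 8 / 2 ^ i b) = ?m (\<lambda>_. 8)"
    by (rule slab_box_dyadic[OF L(1-3), symmetric]) simp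
  also have "\<dots> = 2 ^ (\<Sum>b\<in>(Basis::'a set). 3 + DIM('a)) * ?m (\<lambda>b. 8 / 2 ^ (3 + DIM('a)))"
    by (rule slab_box_dyadic[OF L(1-3)]) simp
  also have "\<dots> \<le> 2 ^ ((3 + DIM('a)) * DIM('a)) * ennreal (vol D)"
  proof -
    have e: "(\<Sum>b\<in>(Basis::'a set). 3 + DIM('a)) = (3 + DIM('a)) * DIM('a)" by simp
    show ?thesis unfolding e by (rule mult_left_mono[OF le]) simp
  qed
  finally have "2 ^ (\<Sum>b\<in>Basis. i b) * ?m (\<lambda>b. 8 / 2 ^ i b) \<le> 2 ^ ((3 + DIM('a)) * DIM('a)) * ennreal (vol D)" .
  then have "ennreal ((1 / 2) ^ (\<Sum>b\<in>Basis. i b)) * (2 ^ (\<Sum>b\<in>Basis. i b) * ?m (\<lambda>b. 8 / 2 ^ i b))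
     \<le> ennreal ((1 / 2) ^ (\<Sum>b\<in>Basis. i b)) * (2 ^ ((3 + DIM('a)) * DIM('a)) * ennreal (vol D))"
    by (rule mult_left_mono) simp
  moreover have can: "ennreal ((1 / 2) ^ k) * (2 ^ k * x) = x" for k x
  proof -
    have "ennreal ((1 / 2) ^ k) * 2 ^ k = ennreal ((1 / 2) ^ k * 2 ^ k)"
      by (simp add: ennreal_mult ennreal_power flip: ennreal_numeral)
    also have "(1 / 2) ^ k * 2 ^ k = (1::real)" by (simp flip: power_mult_distrib)
    finally show ?thesis by (simp flip: mult.assoc)
  qed
  moreover have com: "ennreal ((1 / 2) ^ k) * (2 ^ l * ennreal (vol D)) = ennreal (2 ^ l * (1 / 2) ^ k * vol D)" for k l
    by (simp add: ennreal_mult ennreal_power mult_ac flip: ennreal_numeral)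
  ultimately have "?m (\<lambda>b. 8 / 2 ^ i b) \<le> ennreal (2 ^ ((3 + DIM('a)) * DIM('a)) * (1 / 2) ^ (\<Sum>b\<in>Basis. i b) * vol D)"
    by (simp only: can com)
  then show ?thesis unfolding power_sum .
qed

lemma sum_ennreal_mult:
  assumes "\<And>i. 0 \<le> a i" "\<And>i. 0 \<le> b i"
  shows "(\<Sum>i\<in>I. ennreal (a i) * ennreal (b i)) = ennreal (\<Sum>i\<in>I. a i * b i)"
  using assms by (subst sum_ennreal[symmetric]) (auto simp: ennreal_mult)

text \<open>Each vector \<open>i\<close> of slope exponents gets its own mesh. A point of chart
  \<open>i\<close> lies in a box with sides \<open>8 / 2 ^ i b\<close>, since a steep slope forces a
  small coordinate, and this small volume pays for a coarser mesh. The resulting sums over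
  \<open>i\<close> are geometric, so no logarithm appears.\<close>

lemma splits_corner:
  "\<exists>K>0. \<forall>(F :: ('a::euclidean_space \<Rightarrow> real) set) (L :: 'a \<Rightarrow> 'a) M v D \<Gamma> \<eta>.
    linear L \<longrightarrow> linear M \<longrightarrow> (\<forall>y. M (L y) = y) \<longrightarrow> (\<forall>x. L (M x) = x) \<longrightarrow> compact D \<longrightarrow>
    (\<forall>y. (\<forall>b\<in>Basis. 0 \<le> y \<bullet> b) \<longrightarrow> (\<Sum>b\<in>Basis. y \<bullet> b) \<le> 1 \<longrightarrow> v + L y \<in> D) \<longrightarrow>
    0 < \<Gamma> \<longrightarrow> 0 < \<eta> \<longrightarrow> (\<forall>f\<in>F. convex_on D f \<and> (\<forall>x\<in>D. \<bar>f x\<bar> \<le> \<Gamma>)) \<longrightarrow>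
    splits F (K / \<eta> ^ DIM('a)) (dominated ((\<lambda>y. v + L y) ` std_corner) (K * \<Gamma>\<^sup>2 * \<eta> ^ 4 * vol D))"
proof -
  obtain K0 :: real where K0: "K0 > 0" and
   chart: "\<And>(F::('a \<Rightarrow> real) set) (\<phi> :: ('a \<Rightarrow> real) \<Rightarrow> 'a \<Rightarrow> real) T (i :: 'a \<Rightarrow> nat) r.
     (\<forall>f\<in>F. \<forall>y\<in>T. \<bar>\<phi> f y\<bar> \<le> 1) \<Longrightarrow> 0 < r \<Longrightarrow>
     splits F (K0 / r ^ DIM('a)) (\<lambda>f g. \<forall>y\<in>T. \<forall>p. subgradient (\<phi> f) T y p \<longrightarrow>
        (\<forall>b\<in>Basis. \<bar>y \<bullet> b\<bar> \<le> 4 / 2 ^ i b \<and> \<bar>p \<bullet> b\<bar> \<le> 2 ^ i b) \<longrightarrow> \<phi> f y - \<phi> g y \<le> K0 * r\<^sup>2)"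
    using splits_slope_chart[where 'f="'a \<Rightarrow> real" and 'a='a] by blast
  \<comment> \<open>The meshes grow like q to the sum of the exponents. Any q strictly between 1 and
    2^(1/4) gives convergence: each unit of exponent multiplies the entropy by q^-d and the squared
    error times volume by q^4 / 2, here sqrt 2 / 2.\<close>
  define q :: real where "q = 2 powr (1 / 8)"
  have q: "q > 1" "q ^ 4 = sqrt 2"
    by (auto simp: q_def powr_power powr_half_sqrt)
  define d where "d = DIM('a)"
  have d: "d > 0" by (simp add: d_def)
  define s1 where "s1 = 1 / q ^ d"
  define s2 where "s2 = sqrt 2 / (2::real)"
  have s1: "0 \<le> s1" "s1 < 1" using q d by (auto simp: s1_def)
  have s2: "0 \<le> s2" "s2 < 1" using sqrt2_less_2 by (auto simp: s2_def)
  define Cd :: real where "Cd = 2 ^ ((3 + d) * d)"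
  define K where "K = K0 * (1 / (1 - s1)) ^ d + (K0\<^sup>2 * Cd * (1 / (1 - s2)) ^ d + 4 * Cd * real d)"
  have Cd: "Cd > 0" by (simp add: Cd_def)
  have parts: "0 < K0 * (1 / (1 - s1)) ^ d" "0 \<le> K0\<^sup>2 * Cd * (1 / (1 - s2)) ^ d + 4 * Cd * real d"
    using K0 s1 s2 Cd by (auto intro!: mult_pos_pos add_nonneg_nonneg)
  show ?thesis
  proof (intro exI[of _ K] conjI allI impI)
    show "K > 0" using parts unfolding K_def by linarith
    fix F :: "('a \<Rightarrow> real) set" and L M :: "'a \<Rightarrow> 'a" and v :: 'a and D :: "'a set" and \<Gamma> \<eta> :: real
    assume L: "linear L" "linear M" "\<forall>y. M (L y) = y" "\<forall>x. L (M x) = x" and D: "compact D"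
      "\<forall>y. (\<forall>b\<in>Basis. 0 \<le> y \<bullet> b) \<longrightarrow> (\<Sum>b\<in>Basis. y \<bullet> b) \<le> 1 \<longrightarrow> v + L y \<in> D"
      and \<Gamma>: "0 < \<Gamma>" and \<eta>: "0 < \<eta>" and F: "\<forall>f\<in>F. convex_on D f \<and> (\<forall>x\<in>D. \<bar>f x\<bar> \<le> \<Gamma>)"
    note D2 = D(2)[rule_format]
    define T where "T = (std_interior :: 'a set)"
    define \<phi> where "\<phi> f y = f (v + L y) / \<Gamma>" for f y
    have TD: "v + L y \<in> D" if "y \<in> T" for y
      using that by (intro D2) (auto simp: T_def std_interior_def less_imp_le)
    have bd: "\<bar>\<phi> f y\<bar> \<le> 1" if "f \<in> F" "y \<in> T" for f y
      using F that(1) TD[OF that(2)] \<Gamma> by (auto simp: \<phi>_def)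
    have cvx: "convex_on T (\<phi> f)" if f: "f \<in> F" for f
    proof -
      have fD: "convex_on D f" using F f by blast
      have "convex_on T (\<lambda>y. f (v + L y))"
      proof (rule convex_onI)
        fix t :: real and x y assume t: "0 < t" "t < 1" and xy: "x \<in> T" "y \<in> T"
        have "v + L ((1 - t) *\<^sub>R x + t *\<^sub>R y) = (1 - t) *\<^sub>R (v + L x) + t *\<^sub>R (v + L y)"
          unfolding linear_add[OF L(1)] linear_scale[OF L(1)] by (simp add: scaleR_add_right scaleR_diff_left)
        then show "f (v + L ((1 - t) *\<^sub>R x + t *\<^sub>R y)) \<le> (1 - t) * f (v + L x) + t * f (v + L y)"
          using convex_onD[OF fD, of t "v + L x" "v + L y"] t TD xy by simp
      qed (simp add: T_def convex_std_interior)
      then have "convex_on T (\<lambda>y. (1 / \<Gamma>) * f (v + L y))" using \<Gamma> by (intro convex_on_cmul) auto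
      then show ?thesis by (simp add: \<phi>_def[abs_def])
    qed
    have sg: "\<exists>p. subgradient (\<phi> f) T y p" if "f \<in> F" "y \<in> T" for f y
    proof (rule subgradient_exists[OF cvx[OF that(1)]])
      show "y \<in> interior T" using that(2) interior_open[OF open_std_interior] unfolding T_def by blast
    qed
    \<comment> \<open>Slopes above 2^I are left unrecorded: they occur only in slabs of volume
      O(2^-I) relative to \<open>D\<close>, which stays within the target error
      \<open>\<eta> ^ 4\<close>.\<close>
    obtain I :: nat where I: "(1 / 2) ^ I < \<eta> ^ 4" using real_arch_pow_inv[of "\<eta> ^ 4" "1 / 2"] \<eta> by auto
    define Ch where "Ch = (\<Pi>\<^sub>E b\<in>(Basis::'a set). {..I})"
    have finCh: "finite Ch" unfolding Ch_def by (intro finite_PiE) auto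
    define r where "r i = \<eta> * (\<Prod>b\<in>(Basis::'a set). q ^ i b)" for i
    have r: "0 < r i" for i unfolding r_def using \<eta> q by (intro mult_pos_pos prod_pos) auto
    define R where "R i f g \<longleftrightarrow> (\<forall>y\<in>T. \<forall>p. subgradient (\<phi> f) T y p \<longrightarrow>
        (\<forall>b\<in>Basis. \<bar>y \<bullet> b\<bar> \<le> 4 / 2 ^ i b \<and> \<bar>p \<bullet> b\<bar> \<le> 2 ^ i b) \<longrightarrow> \<phi> f y - \<phi> g y \<le> K0 * (r i)\<^sup>2)" for i f g
    have "splits F (K0 / r i ^ DIM('a)) (R i)" for i
      unfolding R_def[abs_def] by (rule chart) (use bd r in auto)
    then have sp: "splits F (\<Sum>i\<in>Ch. K0 / r i ^ DIM('a)) (\<lambda>f g. \<forall>i\<in>Ch. R i f g)"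
      by (intro splits_Ball finCh)
    show "splits F (K / \<eta> ^ DIM('a)) (dominated ((\<lambda>y. v + L y) ` std_corner) (K * \<Gamma>\<^sup>2 * \<eta> ^ 4 * vol D))"
    proof -
      have ent: "(\<Sum>i\<in>Ch. K0 / r i ^ DIM('a)) \<le> K / \<eta> ^ DIM('a)"
      proof -
        have "K0 / r i ^ DIM('a) = (K0 / \<eta> ^ d) * (\<Prod>b\<in>Basis. s1 ^ i b)" for i
          by (simp add: r_def s1_def d_def power_mult_distrib prod_power_distrib prod_dividef power_mult[symmetric] power_one_over mult.commute)
        then have "(\<Sum>i\<in>Ch. K0 / r i ^ DIM('a)) = (K0 / \<eta> ^ d) * (\<Sum>i\<in>Ch. \<Prod>b\<in>Basis. s1 ^ i b)"
          by (simp add: sum_distrib_left)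
        also have "\<dots> \<le> (K0 / \<eta> ^ d) * (1 / (1 - s1)) ^ d"
          unfolding Ch_def d_def using K0 \<eta> by (intro mult_left_mono sum_PiE_geometric_le s1) auto
        also have "\<dots> = (K0 * (1 / (1 - s1)) ^ d) / \<eta> ^ d" by simp
        also have "\<dots> \<le> K / \<eta> ^ d" using parts \<eta> unfolding K_def by (intro divide_right_mono) auto
        finally show ?thesis by (simp add: d_def)
      qed
      have dom: "dominated ((\<lambda>y. v + L y) ` std_corner) (K * \<Gamma>\<^sup>2 * \<eta> ^ 4 * vol D) f g"
        if fg: "f \<in> F" "g \<in> F" and Rfg: "\<forall>i\<in>Ch. R i f g" "\<forall>i\<in>Ch. R i g f" for f g
      proof -
        \<comment> \<open>Exponent \<open>I\<close> in the single direction \<open>b\<close> and 0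
          elsewhere: the box becomes a slab of width \<open>8 / 2 ^ I\<close>.\<close>
        define cut where "cut b = (\<lambda>b'. if b' = b then I else 0)" for b :: 'a
        let ?box = "\<lambda>i. slab_box M v (\<lambda>b. 8 / 2 ^ i b)"
        define B where "B x = (\<Sum>i\<in>Ch. ennreal (\<Gamma>\<^sup>2 * (K0 * (r i)\<^sup>2)\<^sup>2) * indicator (?box i) x)
           + (\<Sum>b\<in>Basis. ennreal (4 * \<Gamma>\<^sup>2) * indicator (?box (cut b)) x)" for x
        have [measurable]: "?box i \<in> sets borel" for i using L by measurable
        have Bm: "B \<in> borel_measurable borel" unfolding B_def[abs_def] by measurable
        \<comment> \<open>One-sided alternative: either the subgradient of \<open>\<phi> f\<close>
          fits a chart, and the label and the box of that chart both apply, or some slope exceeds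
          2^I and the point lies in a thin slab.\<close>
        have key: "(\<exists>i\<in>Ch. \<phi> f y - \<phi> g y \<le> K0 * (r i)\<^sup>2 \<and> v + L y \<in> ?box i) \<or> (\<exists>b\<in>Basis. v + L y \<in> ?box (cut b))"
          if fg: "f \<in> F" "g \<in> F" "\<forall>i\<in>Ch. R i f g" and y: "y \<in> std_corner" for f g y
        proof -
          have yT: "y \<in> T" using y by (auto simp: T_def std_corner_def)
          obtain p where p: "subgradient (\<phi> f) T y p" using sg[OF fg(1) yT] by blast
          have Mv: "M (v + L y - v) = y" using L by simp
          have y01: "0 \<le> y \<bullet> b" "y \<bullet> b < 1" if "b \<in> Basis" for b
            using std_interior_le1[of y b] yT that by (auto simp: T_def less_imp_le)
          have slope: "\<bar>p \<bullet> b\<bar> * (y \<bullet> b) \<le> 2" if "b \<in> Basis" for b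
            using corner_slope[OF _ y _ that, of "\<phi> f" p] bd[OF fg(1)] p by (simp add: T_def)
          show ?thesis
          proof (cases "\<forall>b\<in>Basis. \<bar>p \<bullet> b\<bar> \<le> 2 ^ I")
            case True
            obtain i where i: "i \<in> Ch" "\<And>b. b \<in> Basis \<Longrightarrow> \<bar>p \<bullet> b\<bar> \<le> 2 ^ i b"
              "\<And>b. b \<in> Basis \<Longrightarrow> i b = 0 \<or> 2 ^ i b < 2 * \<bar>p \<bullet> b\<bar>"
              using subgradient_in_chart[of p I] True unfolding Ch_def by blast
            have yb: "y \<bullet> b \<le> 4 / 2 ^ i b" if "b \<in> Basis" for b
            proof (cases "i b = 0")
              case True then show ?thesis using y01[OF that] by simp
            next
              case False
              then have "2 ^ i b * (y \<bullet> b) \<le> (2 * \<bar>p \<bullet> b\<bar>) * (y \<bullet> b)"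
                using i(3)[OF that] y01[OF that] by (intro mult_right_mono) auto
              then have "2 ^ i b * (y \<bullet> b) \<le> 4" using slope[OF that] by linarith
              then show ?thesis by (simp add: pos_le_divide_eq mult.commute)
            qed
            have "\<phi> f y - \<phi> g y \<le> K0 * (r i)\<^sup>2"
              using fg(3) i(1,2) yT p yb y01 unfolding R_def by auto
            moreover have "v + L y \<in> ?box i"
              unfolding slab_box_def mem_Collect_eq Mv
            proof (intro ballI conjI)
              fix b :: 'a assume b: "b \<in> Basis"
              \<comment> \<open>Sides 8 instead of 4 turn the closed bound into the strict one of
                the half-open box.\<close>
              have "4 / 2 ^ i b < (8::real) / 2 ^ i b" by (intro divide_strict_right_mono) auto
              then show "y \<bullet> b < 8 / 2 ^ i b" using yb[OF b] by linarith
            qed (use y01 in auto)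
            ultimately show ?thesis using i(1) by blast
          next
            case False
            then obtain b where b: "b \<in> Basis" "2 ^ I < \<bar>p \<bullet> b\<bar>" by (auto simp: not_le)
            have "2 ^ I * (y \<bullet> b) \<le> \<bar>p \<bullet> b\<bar> * (y \<bullet> b)" using b y01 by (intro mult_right_mono) auto
            then have "2 ^ I * (y \<bullet> b) < 8" using slope[OF b(1)] by linarith
            then have "y \<bullet> b < 8 / 2 ^ I" by (simp add: pos_less_divide_eq mult.commute)
            then have "v + L y \<in> ?box (cut b)"
              unfolding slab_box_def mem_Collect_eq Mv using y01 by (force simp: cut_def)
            then show ?thesis using b by blast
          qed
        qed
        have pt: "ennreal ((f x - g x)\<^sup>2) \<le> B x" if x: "x = v + L y" "y \<in> std_corner" for x y
        proof -
          have yT: "y \<in> T" using x by (auto simp: T_def std_corner_def)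
          have fx: "(f x - g x)\<^sup>2 = \<Gamma>\<^sup>2 * (\<phi> f y - \<phi> g y)\<^sup>2"
            using \<Gamma> by (simp add: x \<phi>_def power_divide diff_divide_distrib[symmetric])
          have ub: "\<bar>\<phi> f y - \<phi> g y\<bar> \<le> 2" using bd[OF fg(1) yT] bd[OF fg(2) yT] by linarith
          have "(\<exists>i\<in>Ch. \<bar>\<phi> f y - \<phi> g y\<bar> \<le> K0 * (r i)\<^sup>2 \<and> x \<in> ?box i) \<or> (\<exists>b\<in>Basis. x \<in> ?box (cut b))"
          proof (cases "\<phi> f y \<ge> \<phi> g y")
            case True
            then show ?thesis using key[OF fg Rfg(1) x(2)] unfolding x(1) by auto
          next
            case False
            then have "\<bar>\<phi> f y - \<phi> g y\<bar> = \<phi> g y - \<phi> f y" by simp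
            then show ?thesis using key[OF fg(2,1) Rfg(2) x(2)] unfolding x(1) by auto
          qed
          then show ?thesis
          proof
            assume "\<exists>i\<in>Ch. \<bar>\<phi> f y - \<phi> g y\<bar> \<le> K0 * (r i)\<^sup>2 \<and> x \<in> ?box i"
            then obtain i where i: "i \<in> Ch" "\<bar>\<phi> f y - \<phi> g y\<bar> \<le> K0 * (r i)\<^sup>2" "x \<in> ?box i" by blast
            have "(\<phi> f y - \<phi> g y)\<^sup>2 \<le> (K0 * (r i)\<^sup>2)\<^sup>2" using i(2) by (rule abs_le_square_iff[THEN iffD1, OF order_trans]) (use K0 in simp)
            then have "ennreal ((f x - g x)\<^sup>2) \<le> ennreal (\<Gamma>\<^sup>2 * (K0 * (r i)\<^sup>2)\<^sup>2) * indicator (?box i) x"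
              unfolding fx using i(3) by (simp add: ennreal_leI mult_left_mono)
            also have "\<dots> \<le> (\<Sum>i\<in>Ch. ennreal (\<Gamma>\<^sup>2 * (K0 * (r i)\<^sup>2)\<^sup>2) * indicator (?box i) x)"
              using finCh i(1) by (intro member_le_sum) auto
            also have "\<dots> \<le> B x" unfolding B_def by simp
            finally show ?thesis .
          next
            assume "\<exists>b\<in>Basis. x \<in> ?box (cut b)"
            then obtain b where b: "b \<in> Basis" "x \<in> ?box (cut b)" by blast
            have "(\<phi> f y - \<phi> g y)\<^sup>2 \<le> 2\<^sup>2" using ub by (intro abs_le_square_iff[THEN iffD1]) simp
            then have "ennreal ((f x - g x)\<^sup>2) \<le> ennreal (4 * \<Gamma>\<^sup>2) * indicator (?box (cut b)) x"
              unfolding fx using b(2) \<Gamma> by (simp add: ennreal_leI)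
            also have "\<dots> \<le> (\<Sum>b\<in>Basis. ennreal (4 * \<Gamma>\<^sup>2) * indicator (?box (cut b)) x)"
              using b(1) by (intro member_le_sum) auto
            also have "\<dots> \<le> B x" unfolding B_def by simp
            finally show ?thesis .
          qed
        qed
        have m: "emeasure lborel (?box i) \<le> ennreal (Cd * (\<Prod>b\<in>Basis. (1 / 2) ^ i b) * vol D)" for i
          unfolding Cd_def d_def by (rule slab_box_corner[OF L(1,2) L(3)[rule_format] L(4)[rule_format] D(1) D2]) auto
        have "(\<integral>\<^sup>+x. B x \<partial>lborel) = (\<Sum>i\<in>Ch. ennreal (\<Gamma>\<^sup>2 * (K0 * (r i)\<^sup>2)\<^sup>2) * emeasure lborel (?box i))
           + (\<Sum>b\<in>Basis. ennreal (4 * \<Gamma>\<^sup>2) * emeasure lborel (?box (cut b)))"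
        proof -
          have "(\<integral>\<^sup>+x. B x \<partial>lborel) = (\<integral>\<^sup>+x. (\<Sum>i\<in>Ch. ennreal (\<Gamma>\<^sup>2 * (K0 * (r i)\<^sup>2)\<^sup>2) * indicator (?box i) x) \<partial>lborel)
            + (\<integral>\<^sup>+x. (\<Sum>b\<in>Basis. ennreal (4 * \<Gamma>\<^sup>2) * indicator (?box (cut b)) x) \<partial>lborel)"
            unfolding B_def by (rule nn_integral_add) measurable
          also have "(\<integral>\<^sup>+x. (\<Sum>i\<in>Ch. ennreal (\<Gamma>\<^sup>2 * (K0 * (r i)\<^sup>2)\<^sup>2) * indicator (?box i) x) \<partial>lborel)
            = (\<Sum>i\<in>Ch. ennreal (\<Gamma>\<^sup>2 * (K0 * (r i)\<^sup>2)\<^sup>2) * emeasure lborel (?box i))"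
            by (subst nn_integral_sum) (auto intro!: sum.cong nn_integral_cmult_indicator)
          also have "(\<integral>\<^sup>+x. (\<Sum>b\<in>Basis. ennreal (4 * \<Gamma>\<^sup>2) * indicator (?box (cut b)) x) \<partial>lborel)
            = (\<Sum>b\<in>Basis. ennreal (4 * \<Gamma>\<^sup>2) * emeasure lborel (?box (cut b)))"
            by (subst nn_integral_sum) (auto intro!: sum.cong nn_integral_cmult_indicator)
          finally show ?thesis .
        qed
        also have "\<dots> \<le> (\<Sum>i\<in>Ch. ennreal (\<Gamma>\<^sup>2 * (K0 * (r i)\<^sup>2)\<^sup>2) * ennreal (Cd * (\<Prod>b\<in>Basis. (1 / 2) ^ i b) * vol D))
           + (\<Sum>b\<in>(Basis::'a set). ennreal (4 * \<Gamma>\<^sup>2) * ennreal (Cd * (\<Prod>b'\<in>Basis. (1 / 2) ^ cut b b') * vol D))"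
          by (intro add_mono sum_mono mult_left_mono m) auto
        also have "\<dots> = ennreal ((\<Sum>i\<in>Ch. \<Gamma>\<^sup>2 * (K0 * (r i)\<^sup>2)\<^sup>2 * (Cd * (\<Prod>b\<in>Basis. (1 / 2) ^ i b) * vol D))
           + (\<Sum>b\<in>(Basis::'a set). 4 * \<Gamma>\<^sup>2 * (Cd * (\<Prod>b'\<in>Basis. (1 / 2) ^ cut b b') * vol D)))"
        proof -
          have nn: "0 \<le> Cd * (\<Prod>b\<in>(Basis::'a set). (1 / 2) ^ i b) * vol D" for i
            using Cd by (intro mult_nonneg_nonneg prod_nonneg) auto
          show ?thesis
            using nn less_imp_le[OF Cd] by (subst (1 2) sum_ennreal_mult) (auto intro!: ennreal_plus[symmetric] sum_nonneg mult_nonneg_nonneg prod_nonneg)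
        qed
        also have "\<dots> \<le> ennreal (K * \<Gamma>\<^sup>2 * \<eta> ^ 4 * vol D)"
        proof (rule ennreal_leI)
          have e1: "\<Gamma>\<^sup>2 * (K0 * (r i)\<^sup>2)\<^sup>2 * (Cd * (\<Prod>b\<in>Basis. (1 / 2) ^ i b) * vol D)
             = (\<Gamma>\<^sup>2 * K0\<^sup>2 * Cd * \<eta> ^ 4 * vol D) * (\<Prod>b\<in>Basis. s2 ^ i b)" for i
          proof -
            have A: "((r i)\<^sup>2)\<^sup>2 = \<eta> ^ 4 * (\<Prod>b\<in>Basis. sqrt 2 ^ i b)"
              unfolding r_def q(2)[symmetric]
              by (simp add: power_mult_distrib prod_power_distrib power_mult[symmetric] mult.commute)
            have S: "(\<Prod>b\<in>(Basis::'a set). sqrt 2 ^ i b) * (\<Prod>b\<in>Basis. (1 / 2) ^ i b) = (\<Prod>b\<in>Basis. s2 ^ i b)"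
              unfolding prod.distrib[symmetric] power_mult_distrib[symmetric] s2_def by simp
            have "\<Gamma>\<^sup>2 * (K0 * (r i)\<^sup>2)\<^sup>2 * (Cd * (\<Prod>b\<in>Basis. (1 / 2) ^ i b) * vol D)
              = (\<Gamma>\<^sup>2 * K0\<^sup>2 * Cd * vol D) * (((r i)\<^sup>2)\<^sup>2 * (\<Prod>b\<in>Basis. (1 / 2) ^ i b))"
              by (simp only: power_mult_distrib mult.assoc mult.commute mult.left_commute)
            also have "\<dots> = (\<Gamma>\<^sup>2 * K0\<^sup>2 * Cd * vol D) * (\<eta> ^ 4 * (\<Prod>b\<in>Basis. s2 ^ i b))"
              unfolding A S[symmetric] by (simp only: mult.assoc)
            finally show ?thesis by (simp only: mult.assoc mult.commute mult.left_commute)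
          qed
          have "(\<Sum>i\<in>Ch. \<Gamma>\<^sup>2 * (K0 * (r i)\<^sup>2)\<^sup>2 * (Cd * (\<Prod>b\<in>Basis. (1 / 2) ^ i b) * vol D))
             = (\<Gamma>\<^sup>2 * K0\<^sup>2 * Cd * \<eta> ^ 4 * vol D) * (\<Sum>i\<in>Ch. \<Prod>b\<in>Basis. s2 ^ i b)"
            unfolding e1 by (simp add: sum_distrib_left)
          also have "\<dots> \<le> (\<Gamma>\<^sup>2 * K0\<^sup>2 * Cd * \<eta> ^ 4 * vol D) * (1 / (1 - s2)) ^ d"
            unfolding Ch_def d_def using Cd by (intro mult_left_mono sum_PiE_geometric_le s2) auto
          finally have S1: "(\<Sum>i\<in>Ch. \<Gamma>\<^sup>2 * (K0 * (r i)\<^sup>2)\<^sup>2 * (Cd * (\<Prod>b\<in>Basis. (1 / 2) ^ i b) * vol D))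
             \<le> (\<Gamma>\<^sup>2 * K0\<^sup>2 * Cd * \<eta> ^ 4 * vol D) * (1 / (1 - s2)) ^ d" .
          have cutp: "(\<Prod>b'\<in>Basis. (1 / 2) ^ cut b b') = (1 / 2 :: real) ^ I" if "b \<in> Basis" for b :: 'a
          proof -
            have "(\<Prod>b'\<in>Basis. (1 / 2) ^ cut b b') = (\<Prod>b'\<in>Basis. if b' = b then (1 / 2 :: real) ^ I else 1)"
              by (intro prod.cong) (auto simp: cut_def)
            then show ?thesis using that by (simp add: prod.delta)
          qed
          have "(\<Sum>b\<in>(Basis::'a set). 4 * \<Gamma>\<^sup>2 * (Cd * (\<Prod>b'\<in>Basis. (1 / 2) ^ cut b b') * vol D))
             = (\<Sum>b\<in>(Basis::'a set). 4 * \<Gamma>\<^sup>2 * (Cd * (1 / 2) ^ I * vol D))"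
            by (intro sum.cong) (auto simp: cutp)
          also have "\<dots> \<le> (\<Sum>b\<in>(Basis::'a set). 4 * \<Gamma>\<^sup>2 * (Cd * \<eta> ^ 4 * vol D))"
            using I Cd by (intro sum_mono mult_left_mono mult_right_mono) (auto simp: less_imp_le)
          also have "\<dots> = real d * (4 * \<Gamma>\<^sup>2 * (Cd * \<eta> ^ 4 * vol D))" by (simp add: d_def)
          finally have S2: "(\<Sum>b\<in>(Basis::'a set). 4 * \<Gamma>\<^sup>2 * (Cd * (\<Prod>b'\<in>Basis. (1 / 2) ^ cut b b') * vol D))
             \<le> real d * (4 * \<Gamma>\<^sup>2 * (Cd * \<eta> ^ 4 * vol D))" .
          have "(\<Sum>i\<in>Ch. \<Gamma>\<^sup>2 * (K0 * (r i)\<^sup>2)\<^sup>2 * (Cd * (\<Prod>b\<in>Basis. (1 / 2) ^ i b) * vol D))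
           + (\<Sum>b\<in>(Basis::'a set). 4 * \<Gamma>\<^sup>2 * (Cd * (\<Prod>b'\<in>Basis. (1 / 2) ^ cut b b') * vol D))
            \<le> (\<Gamma>\<^sup>2 * K0\<^sup>2 * Cd * \<eta> ^ 4 * vol D) * (1 / (1 - s2)) ^ d + real d * (4 * \<Gamma>\<^sup>2 * (Cd * \<eta> ^ 4 * vol D))"
            using S1 S2 by (rule add_mono)
          also have "\<dots> = (K0\<^sup>2 * Cd * (1 / (1 - s2)) ^ d + 4 * Cd * real d) * (\<Gamma>\<^sup>2 * \<eta> ^ 4 * vol D)"
            by (simp add: algebra_simps)
          also have "\<dots> \<le> K * (\<Gamma>\<^sup>2 * \<eta> ^ 4 * vol D)" using parts unfolding K_def by (intro mult_right_mono) auto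
          finally show "(\<Sum>i\<in>Ch. \<Gamma>\<^sup>2 * (K0 * (r i)\<^sup>2)\<^sup>2 * (Cd * (\<Prod>b\<in>Basis. (1 / 2) ^ i b) * vol D))
           + (\<Sum>b\<in>(Basis::'a set). 4 * \<Gamma>\<^sup>2 * (Cd * (\<Prod>b'\<in>Basis. (1 / 2) ^ cut b b') * vol D))
            \<le> K * \<Gamma>\<^sup>2 * \<eta> ^ 4 * vol D" by (simp add: mult.assoc)
        qed
        finally show ?thesis unfolding dominated_def using Bm pt by (intro bexI[of _ B]) auto
      qed
      have "splits F (K / \<eta> ^ DIM('a)) (\<lambda>f g. (\<forall>i\<in>Ch. R i f g) \<and> (\<forall>i\<in>Ch. R i g f))"
      proof (rule splits_mono[OF splits_sym[OF sp] ent])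
      qed auto
      then show ?thesis by (rule splits_mono) (use dom in auto)
    qed
  qed
qed

section \<open>Barycentric coordinates and whole simplices\<close>

lemma sum_bij_remove:
  fixes h :: "'a \<Rightarrow> 'c::comm_monoid_add"
  assumes "finite C" "v \<in> C" "bij_betw e B (C - {v})"
  shows "sum h C = h v + (\<Sum>b\<in>B. h (e b))"
  using assms sum.reindex_bij_betw[OF assms(3), of h] by (simp add: sum.remove)

text \<open>The affine chart in which \<open>v\<close> becomes 0 and the other vertices become the
  basis vectors. The last property, that \<open>M\<close> reads off barycentric coordinates, serves
  to recognise the corner in which a point lies.\<close>

lemma simplex_coordinates:
  fixes C :: "'a::euclidean_space set"
  assumes C: "\<not> affine_dependent C" "card C = DIM('a) + 1" and v: "v \<in> C"
  obtains L M :: "'a \<Rightarrow> 'a" and e :: "'a \<Rightarrow> 'a" where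
    "linear L" "linear M" "\<And>y. M (L y) = y" "\<And>x. L (M x) = x" "bij_betw e Basis (C - {v})"
    "\<And>y. (\<And>b. b \<in> Basis \<Longrightarrow> 0 \<le> y \<bullet> b) \<Longrightarrow> (\<Sum>b\<in>Basis. y \<bullet> b) \<le> 1 \<Longrightarrow> v + L y \<in> convex hull C"
    "\<And>u b. sum u C = 1 \<Longrightarrow> b \<in> Basis \<Longrightarrow> M ((\<Sum>c\<in>C. u c *\<^sub>R c) - v) \<bullet> b = u (e b)"
proof -
  have finC: "finite C" using C by (simp add: aff_independent_finite)
  have "card (C - {v}) = DIM('a)" using C v finC by simp
  then obtain e where e: "bij_betw e (Basis::'a set) (C - {v})"
    using finC by (metis finite_Basis finite_Diff finite_same_card_bij)
  have eC: "e b \<in> C" "e b \<noteq> v" if "b \<in> Basis" for b using e that by (auto simp: bij_betw_def)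
  define W where "W = (\<lambda>x. - v + x) ` (C - {v})"
  have ind: "independent W" using C v unfolding W_def by (simp add: affine_dependent_iff_dependent2)
  define L where "L y = (\<Sum>b\<in>Basis. (y \<bullet> b) *\<^sub>R (e b - v))" for y
  have linL: "linear L" unfolding L_def[abs_def]
    by (rule linearI) (simp_all add: inner_add_left scaleR_add_left sum.distrib scaleR_sum_right)
  obtain M where M: "linear M" "\<forall>x\<in>W. M x = inv_into Basis e (x + v)"
    using linear_independent_extend[OF ind, of "\<lambda>x. inv_into Basis e (x + v)"] by blast
  have Me: "M (e b - v) = b" if "b \<in> Basis" for b
  proof -
    have "e b - v \<in> W" unfolding W_def using eC[OF that] by (intro image_eqI[of _ _ "e b"]) auto
    then have "M (e b - v) = inv_into Basis e (e b)" using M(2) by simp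
    also have "\<dots> = b" using e that by (simp add: bij_betw_def inv_into_f_f)
    finally show ?thesis .
  qed
  have M_L: "M (L y) = y" for y
  proof -
    have "M (L y) = (\<Sum>b\<in>Basis. (y \<bullet> b) *\<^sub>R M (e b - v))"
      unfolding L_def by (simp add: linear_sum[OF M(1)] linear_scale[OF M(1)])
    also have "\<dots> = (\<Sum>b\<in>Basis. (y \<bullet> b) *\<^sub>R b)" by (intro sum.cong) (auto simp: Me)
    finally show ?thesis by (simp add: euclidean_representation)
  qed
  then have "M \<circ> L = id" by (simp add: fun_eq_iff)
  then have "L \<circ> M = id" using linear_inverse_left[OF M(1) linL] by simp
  then have LM: "L (M x) = x" for x by (metis comp_apply id_apply)
  show ?thesis
  proof (rule that[OF linL M(1) M_L LM e])
    fix y :: 'a assume y: "\<And>b. b \<in> Basis \<Longrightarrow> 0 \<le> y \<bullet> b" "(\<Sum>b\<in>Basis. y \<bullet> b) \<le> 1"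
    have "(1 - (\<Sum>b\<in>Basis. y \<bullet> b)) *\<^sub>R v + (\<Sum>b\<in>Basis. (y \<bullet> b) *\<^sub>R e b) \<in> convex hull C"
    proof -
      define u where "u c = (if c = v then 1 - (\<Sum>b\<in>Basis. y \<bullet> b) else y \<bullet> inv_into Basis e c)" for c
      have ue: "u (e b) = y \<bullet> b" if "b \<in> Basis" for b
        using e eC[OF that] that by (simp add: u_def bij_betw_def inv_into_f_f)
      have u0: "0 \<le> u c" if "c \<in> C" for c
      proof (cases "c = v")
        case False
        then obtain b where "b \<in> Basis" "c = e b" using e \<open>c \<in> C\<close> by (auto simp: bij_betw_def)
        then show ?thesis using y ue by simp
      qed (use y in \<open>simp add: u_def\<close>)
      have "sum u C = 1" unfolding sum_bij_remove[OF finC v e] by (simp add: ue) (simp add: u_def)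
      then have "(\<Sum>c\<in>C. u c *\<^sub>R c) \<in> convex hull C" using u0 finC
        by (auto simp: convex_hull_finite)
      moreover have "(\<Sum>c\<in>C. u c *\<^sub>R c) = (1 - (\<Sum>b\<in>Basis. y \<bullet> b)) *\<^sub>R v + (\<Sum>b\<in>Basis. (y \<bullet> b) *\<^sub>R e b)"
        unfolding sum_bij_remove[OF finC v e] by (simp add: ue) (simp add: u_def)
      ultimately show ?thesis by simp
    qed
    also have "(1 - (\<Sum>b\<in>Basis. y \<bullet> b)) *\<^sub>R v + (\<Sum>b\<in>Basis. (y \<bullet> b) *\<^sub>R e b) = v + L y"
      unfolding L_def by (simp add: scaleR_diff_left scaleR_diff_right sum_subtractf scaleR_sum_left)
    finally show "v + L y \<in> convex hull C" .
  next
    fix u :: "'a \<Rightarrow> real" and b :: 'a assume u: "sum u C = 1" and b: "b \<in> Basis"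
    have "(\<Sum>c\<in>C. u c *\<^sub>R c) - v = (\<Sum>c\<in>C. u c *\<^sub>R c) - sum u C *\<^sub>R v" by (simp add: u)
    also have "\<dots> = (\<Sum>c\<in>C. u c *\<^sub>R (c - v))" by (simp add: scaleR_sum_left scaleR_diff_right sum_subtractf)
    also have "\<dots> = (\<Sum>b\<in>Basis. u (e b) *\<^sub>R (e b - v))" unfolding sum_bij_remove[OF finC v e] by simp
    finally have "M ((\<Sum>c\<in>C. u c *\<^sub>R c) - v) = (\<Sum>b\<in>Basis. u (e b) *\<^sub>R M (e b - v))"
      by (simp add: linear_sum[OF M(1)] linear_scale[OF M(1)])
    also have "\<dots> = (\<Sum>b\<in>Basis. u (e b) *\<^sub>R b)" by (intro sum.cong) (auto simp: Me)
    finally show "M ((\<Sum>c\<in>C. u c *\<^sub>R c) - v) \<bullet> b = u (e b)" using b by simp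
  qed
qed

text \<open>An interior point belongs to the corner at the vertex with its largest barycentric
  coordinate, so \<open>DIM('a) + 1\<close> corners cover the interior. Affine invariance of the
  corner estimate makes \<open>K\<close> independent of the shape of the simplex.\<close>

lemma splits_simplex:
  "\<exists>K>0. \<forall>(F :: ('a::euclidean_space \<Rightarrow> real) set) D \<Gamma> \<eta>. full_simplex D \<longrightarrow>
    0 < \<Gamma> \<longrightarrow> 0 < \<eta> \<longrightarrow> (\<forall>f\<in>F. convex_on D f \<and> (\<forall>x\<in>D. \<bar>f x\<bar> \<le> \<Gamma>)) \<longrightarrow>
    splits F (K / \<eta> ^ DIM('a)) (dominated (interior D) (K * \<Gamma>\<^sup>2 * \<eta> ^ 4 * vol D))"
proof -
  obtain K0 :: real where K0: "K0 > 0" and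
    corner: "\<And>(F :: ('a \<Rightarrow> real) set) (L :: 'a \<Rightarrow> 'a) M v D \<Gamma> \<eta>.
    \<lbrakk>linear L; linear M; \<forall>y. M (L y) = y; \<forall>x. L (M x) = x; compact D;
    \<forall>y. (\<forall>b\<in>Basis. 0 \<le> y \<bullet> b) \<longrightarrow> (\<Sum>b\<in>Basis. y \<bullet> b) \<le> 1 \<longrightarrow> v + L y \<in> D;
    0 < \<Gamma>; 0 < \<eta>; \<forall>f\<in>F. convex_on D f \<and> (\<forall>x\<in>D. \<bar>f x\<bar> \<le> \<Gamma>)\<rbrakk> \<Longrightarrow>
    splits F (K0 / \<eta> ^ DIM('a)) (dominated ((\<lambda>y. v + L y) ` std_corner) (K0 * \<Gamma>\<^sup>2 * \<eta> ^ 4 * vol D))"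
    using splits_corner[where 'a='a] by blast
  define K where "K = real (DIM('a) + 1) * K0"
  show ?thesis
  proof (intro exI[of _ K] conjI allI impI)
    show "K > 0" using K0 by (simp add: K_def)
    fix F :: "('a \<Rightarrow> real) set" and D :: "'a set" and \<Gamma> \<eta> :: real
    assume sx: "full_simplex D" and \<Gamma>: "0 < \<Gamma>" and \<eta>: "0 < \<eta>"
      and F: "\<forall>f\<in>F. convex_on D f \<and> (\<forall>x\<in>D. \<bar>f x\<bar> \<le> \<Gamma>)"
    obtain C where C: "\<not> affine_dependent C" "int (card C) = int DIM('a) + 1" "D = convex hull C"
      using sx by (auto simp: simplex_def)
    have cardC: "card C = DIM('a) + 1" using C(2) by linarith
    have finC: "finite C" using C by (simp add: aff_independent_finite)
    have cD: "compact D" unfolding C(3) by (rule finite_imp_compact_convex_hull[OF finC])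
    define coords where "coords v LMe = (case LMe of (L, M, e) \<Rightarrow>
      linear L \<and> linear M \<and> (\<forall>y. M (L y) = y) \<and> (\<forall>x. L (M x) = x) \<and> bij_betw e Basis (C - {v}) \<and>
      (\<forall>y. (\<forall>b\<in>Basis. 0 \<le> y \<bullet> b) \<longrightarrow> (\<Sum>b\<in>Basis. y \<bullet> b) \<le> 1 \<longrightarrow> v + L y \<in> D) \<and>
      (\<forall>u. sum u C = 1 \<longrightarrow> (\<forall>b\<in>Basis. M ((\<Sum>c\<in>C. u c *\<^sub>R c) - v) \<bullet> b = u (e b))))"
      for v and LMe :: "('a \<Rightarrow> 'a) \<times> ('a \<Rightarrow> 'a) \<times> ('a \<Rightarrow> 'a)"
    have "\<exists>LMe. coords v LMe" if vC: "v \<in> C" for v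
    proof -
      obtain L M e where "linear L" "linear M" "\<And>y. M (L y) = y" "\<And>x. L (M x) = x" "bij_betw e (Basis :: 'a set) (C - {v})"
        "\<And>y. (\<And>b. b \<in> Basis \<Longrightarrow> 0 \<le> y \<bullet> b) \<Longrightarrow> (\<Sum>b\<in>Basis. y \<bullet> b) \<le> 1 \<Longrightarrow> v + L y \<in> convex hull C"
        "\<And>u b. sum u C = 1 \<Longrightarrow> b \<in> Basis \<Longrightarrow> M ((\<Sum>c\<in>C. u c *\<^sub>R c) - v) \<bullet> b = u (e b)"
        using simplex_coordinates[OF C(1) cardC vC] by blast
      then have "coords v (L, M, e)" unfolding coords_def C(3) by simp
      then show ?thesis by blast
    qed
    then obtain Z where Z: "\<And>v. v \<in> C \<Longrightarrow> coords v (Z v)" by metis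
    define L M e where "L v = fst (Z v)" and "M v = fst (snd (Z v))" and "e v = snd (snd (Z v))" for v
    have co: "linear (L v)" "linear (M v)" "\<forall>y. M v (L v y) = y" "\<forall>x. L v (M v x) = x" "bij_betw (e v) Basis (C - {v})"
      "\<forall>y. (\<forall>b\<in>Basis. 0 \<le> y \<bullet> b) \<longrightarrow> (\<Sum>b\<in>Basis. y \<bullet> b) \<le> 1 \<longrightarrow> v + L v y \<in> D"
      "\<And>u b. sum u C = 1 \<Longrightarrow> b \<in> Basis \<Longrightarrow> M v ((\<Sum>c\<in>C. u c *\<^sub>R c) - v) \<bullet> b = u (e v b)" if "v \<in> C" for v
      using Z[OF that] unfolding coords_def L_def M_def e_def by (auto simp: case_prod_beta)
    let ?S = "\<lambda>v. (\<lambda>y. v + L v y) ` std_corner"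
    let ?e = "K0 * \<Gamma>\<^sup>2 * \<eta> ^ 4 * vol D"
    have "splits F (K0 / \<eta> ^ DIM('a)) (dominated (?S v) ?e)" if "v \<in> C" for v
      by (rule corner[OF co(1-4)[OF that] cD co(6)[OF that] \<Gamma> \<eta> F])
    then have "splits F (\<Sum>v\<in>C. K0 / \<eta> ^ DIM('a)) (\<lambda>f g. \<forall>v\<in>C. dominated (?S v) ?e f g)"
      by (intro splits_Ball finC)
    then show "splits F (K / \<eta> ^ DIM('a)) (dominated (interior D) (K * \<Gamma>\<^sup>2 * \<eta> ^ 4 * vol D))"
    proof (rule splits_mono)
      show "(\<Sum>v\<in>C. K0 / \<eta> ^ DIM('a)) \<le> K / \<eta> ^ DIM('a)" by (simp add: cardC K_def)
      fix f g assume "\<forall>v\<in>C. dominated (?S v) ?e f g"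
      then have 1: "dominated (\<Union>v\<in>C. ?S v) (\<Sum>v\<in>C. ?e) f g"
      proof (intro dominated_UN[OF finC])
        show "0 \<le> ?e" using K0 by simp
      qed blast
      have 2: "interior D \<subseteq> (\<Union>v\<in>C. ?S v)"
      proof
        fix x assume "x \<in> interior D"
        then have "x \<in> rel_interior D" using interior_subset_rel_interior by blast
        then obtain u where u: "\<forall>c\<in>C. 0 < u c" "sum u C = 1" "(\<Sum>c\<in>C. u c *\<^sub>R c) = x"
          unfolding C(3) rel_interior_convex_hull_explicit[OF C(1)] by blast
        have "C \<noteq> {}" using cardC by auto
        then have "Max (u ` C) \<in> u ` C" using finC by (intro Max_in) auto
        then obtain v where v: "v \<in> C" "u v = Max (u ` C)" by auto
        have umax: "u c \<le> u v" if "c \<in> C" for c using that finC unfolding v(2) by simp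
        define y where "y = M v (x - v)"
        have yb: "y \<bullet> b = u (e v b)" if "b \<in> Basis" for b
          unfolding y_def u(3)[symmetric] by (rule co(7)[OF v(1) u(2) that])
        have eb: "e v b \<in> C" if "b \<in> Basis" for b using co(5)[OF v(1)] that by (auto simp: bij_betw_def)
        have "(\<Sum>b\<in>Basis. y \<bullet> b) = (\<Sum>b\<in>Basis. u (e v b))" by (intro sum.cong refl yb)
        also have "\<dots> = sum u (C - {v})" by (rule sum.reindex_bij_betw[OF co(5)[OF v(1)]])
        also have "\<dots> = 1 - u v" using sum.remove[OF finC v(1), of u] u(2) by linarith
        finally have s: "(\<Sum>b\<in>Basis. y \<bullet> b) = 1 - u v" .
        have "\<forall>b\<in>Basis. 0 < y \<bullet> b" "\<forall>b\<in>Basis. y \<bullet> b \<le> u v" "0 < u v"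
          using u(1) v(1) eb umax by (simp_all add: yb)
        then have "y \<in> std_corner" unfolding std_corner_def std_interior_def mem_Collect_eq s by simp
        moreover have "x = v + L v y" using co(4)[OF v(1)] by (simp add: y_def)
        ultimately show "x \<in> (\<Union>v\<in>C. ?S v)" using v(1) by blast
      qed
      have 3: "(\<Sum>v\<in>C. ?e) \<le> K * \<Gamma>\<^sup>2 * \<eta> ^ 4 * vol D" by (simp add: cardC K_def)
      show "dominated (interior D) (K * \<Gamma>\<^sup>2 * \<eta> ^ 4 * vol D) f g"
        by (rule dominated_mono[OF 1 2 3])
    qed
  qed
qed

section \<open>From simplices to polytopes\<close>

lemma sq_loss_le_dominated:
  assumes \<Omega>: "convex_body \<Omega>" and dl: "design_law \<Omega> \<nu> p" and S: "negligible (\<Omega> - S)" "dominated S e f g"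
    and e: "0 \<le> e"
  shows "sq_loss \<Omega> \<nu> f g \<le> ennreal (enn2real (density_sup \<Omega> p) * e)"
proof -
  have nu: "\<nu> = density lborel (\<lambda>x. p x * indicator \<Omega> x)" and fin: "density_sup \<Omega> p < \<infinity>" using dl by (auto simp: design_law_def)
  have \<Omega>m [measurable]: "\<Omega> \<in> sets borel" using \<Omega> by (auto simp: convex_body_def compact_imp_closed)
  have [measurable]: "p \<in> borel_measurable borel" using dl by (auto simp: design_law_def)
  obtain B where B [measurable]: "B \<in> borel_measurable borel" and Bx: "\<forall>x\<in>S. ennreal ((f x - g x)\<^sup>2) \<le> B x"
    and Bi: "(\<integral>\<^sup>+x. B x \<partial>lborel) \<le> ennreal e" using S(2) unfolding dominated_def by blast
  have "AE x in lebesgue. x \<notin> \<Omega> - S" using S(1) by (intro AE_not_in) (simp add: negligible_iff_null_sets)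
  then have "AE x in lborel. x \<notin> \<Omega> - S" by (simp add: AE_completion_iff)
  then have "AE x in \<nu>. x \<in> \<Omega> \<longrightarrow> x \<in> S" unfolding nu by (subst AE_density) (auto elim: eventually_mono)
  then have "sq_loss \<Omega> \<nu> f g \<le> (\<integral>\<^sup>+x. B x * indicator \<Omega> x \<partial>\<nu>)" unfolding sq_loss_def
    by (intro nn_integral_mono_AE) (auto elim!: eventually_mono simp: Bx indicator_def)
  also have "\<dots> = (\<integral>\<^sup>+x. (p x * indicator \<Omega> x) * (B x * indicator \<Omega> x) \<partial>lborel)"
    unfolding nu by (rule nn_integral_density) measurable
  also have "\<dots> \<le> (\<integral>\<^sup>+x. density_sup \<Omega> p * B x \<partial>lborel)"
    by (intro nn_integral_mono) (auto simp: indicator_def density_sup_def intro!: mult_right_mono SUP_upper)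
  also have "\<dots> = density_sup \<Omega> p * (\<integral>\<^sup>+x. B x \<partial>lborel)" by (rule nn_integral_cmult) measurable
  also have "\<dots> \<le> density_sup \<Omega> p * ennreal e" by (intro mult_left_mono Bi) auto
  also have "density_sup \<Omega> p = ennreal (enn2real (density_sup \<Omega> p))" using fin by simp
  also have "ennreal (enn2real (density_sup \<Omega> p)) * ennreal e = ennreal (enn2real (density_sup \<Omega> p) * e)"
    using e by (simp add: ennreal_mult)
  finally show ?thesis .
qed

text \<open>Entropies add up to a factor \<open>k\<close>, but the squared errors are proportional
  to \<open>vol D\<close>, and since the interiors are disjoint these add up to at most
  \<open>vol \<Omega>\<close>: the radius of the net is free of \<open>k\<close>.\<close>

lemma splits_simplicial_polytope:
  "\<exists>K>0. \<forall>(\<Omega> :: 'a::euclidean_space set) k \<nu> p \<Gamma> \<eta>. convex_body \<Omega> \<longrightarrow> \<Omega> \<in> simplicial_polytopes k \<longrightarrow>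
    design_law \<Omega> \<nu> p \<longrightarrow> 0 < \<Gamma> \<longrightarrow> 0 < \<eta> \<longrightarrow>
    splits (bounded_convex \<Omega> \<Gamma>) (K * real k / \<eta> ^ DIM('a))
      (\<lambda>f g. sq_loss \<Omega> \<nu> f g \<le> ennreal (enn2real (density_sup \<Omega> p) * (K * \<Gamma>\<^sup>2 * \<eta> ^ 4 * vol \<Omega>)))"
proof -
  obtain K0 :: real where K0: "K0 > 0" and simplex: "\<And>(F :: ('a \<Rightarrow> real) set) D \<Gamma> \<eta>. \<lbrakk>full_simplex D;
    0 < \<Gamma>; 0 < \<eta>; \<forall>f\<in>F. convex_on D f \<and> (\<forall>x\<in>D. \<bar>f x\<bar> \<le> \<Gamma>)\<rbrakk> \<Longrightarrow>
    splits F (K0 / \<eta> ^ DIM('a)) (dominated (interior D) (K0 * \<Gamma>\<^sup>2 * \<eta> ^ 4 * vol D))"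
    using splits_simplex[where 'a='a] by blast
  show ?thesis
  proof (intro exI[of _ K0] conjI allI impI K0)
    fix \<Omega> :: "'a set" and k \<nu> p and \<Gamma> \<eta> :: real
    assume \<Omega>: "convex_body \<Omega>" "\<Omega> \<in> simplicial_polytopes k" and dl: "design_law \<Omega> \<nu> p" and \<Gamma>: "0 < \<Gamma>" and \<eta>: "0 < \<eta>"
    obtain \<D> where D: "finite \<D>" "card \<D> \<le> k" "\<forall>D\<in>\<D>. full_simplex D"
      "pairwise (\<lambda>D D'. interior D \<inter> interior D' = {}) \<D>" "\<Omega> = \<Union>\<D>"
      using \<Omega>(2) unfolding simplicial_polytopes_def by blast
    have cvx: "convex D" "compact D" if "D \<in> \<D>" for D using D(3) that by (auto intro: convex_simplex compact_simplex)
    have "splits (bounded_convex \<Omega> \<Gamma>) (K0 / \<eta> ^ DIM('a)) (dominated (interior D) (K0 * \<Gamma>\<^sup>2 * \<eta> ^ 4 * vol D))" if DD: "D \<in> \<D>" for D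
    proof (rule simplex[OF _ \<Gamma> \<eta>])
      show "\<forall>f\<in>bounded_convex \<Omega> \<Gamma>. convex_on D f \<and> (\<forall>x\<in>D. \<bar>f x\<bar> \<le> \<Gamma>)"
      proof (intro ballI conjI)
        fix f assume f: "f \<in> bounded_convex \<Omega> \<Gamma>"
        show "convex_on D f"
          by (rule convex_on_subset[of \<Omega>]) (use f DD D(5) cvx[OF DD] in \<open>auto simp: bounded_convex_def\<close>)
        show "\<bar>f x\<bar> \<le> \<Gamma>" if "x \<in> D" for x using f that DD D(5) by (auto simp: bounded_convex_def)
      qed
    qed (use D(3) DD in auto)
    then have "splits (bounded_convex \<Omega> \<Gamma>) (\<Sum>D\<in>\<D>. K0 / \<eta> ^ DIM('a)) (\<lambda>f g. \<forall>D\<in>\<D>. dominated (interior D) (K0 * \<Gamma>\<^sup>2 * \<eta> ^ 4 * vol D) f g)"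
      by (intro splits_Ball D(1))
    then show "splits (bounded_convex \<Omega> \<Gamma>) (K0 * real k / \<eta> ^ DIM('a))
      (\<lambda>f g. sq_loss \<Omega> \<nu> f g \<le> ennreal (enn2real (density_sup \<Omega> p) * (K0 * \<Gamma>\<^sup>2 * \<eta> ^ 4 * vol \<Omega>)))"
    proof (rule splits_mono)
      have "(\<Sum>D\<in>\<D>. K0 / \<eta> ^ DIM('a)) = (K0 / \<eta> ^ DIM('a)) * real (card \<D>)" by simp
      also have "\<dots> \<le> (K0 / \<eta> ^ DIM('a)) * real k" using K0 \<eta> D(2) by (intro mult_left_mono) auto
      finally show "(\<Sum>D\<in>\<D>. K0 / \<eta> ^ DIM('a)) \<le> K0 * real k / \<eta> ^ DIM('a)" by simp
      fix f g assume d: "\<forall>D\<in>\<D>. dominated (interior D) (K0 * \<Gamma>\<^sup>2 * \<eta> ^ 4 * vol D) f g"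
      have dUN: "dominated (\<Union>D\<in>\<D>. interior D) (\<Sum>D\<in>\<D>. K0 * \<Gamma>\<^sup>2 * \<eta> ^ 4 * vol D) f g"
      proof (intro dominated_UN[OF D(1)])
        show "0 \<le> K0 * \<Gamma>\<^sup>2 * \<eta> ^ 4 * vol D" for D :: "'a set" using K0 by simp
      qed (use d in blast)
      have "(\<Sum>D\<in>\<D>. vol D) \<le> vol \<Omega>"
      proof -
        have fm: "D \<in> fmeasurable lborel" "interior D \<in> fmeasurable lborel" if "D \<in> \<D>" for D
        proof -
          show 1: "D \<in> fmeasurable lborel" using cvx[OF that] by (intro fmeasurable_compact)
          show "interior D \<in> fmeasurable lborel" by (rule fmeasurableI2[OF 1 interior_subset]) simp
        qed
        have "vol D = vol (interior D)" if "D \<in> \<D>" for D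
        proof -
          have "frontier D \<in> null_sets lborel"
            using negligible_convex_frontier[OF cvx(1)[OF that]] by (simp add: negligible_iff_null_sets null_sets_completion_iff frontier_closed)
          moreover have "D = interior D \<union> frontier D"
            using cvx[OF that] by (simp add: frontier_def compact_imp_closed closure_closed interior_subset Un_absorb1)
          ultimately show ?thesis
            using measure_Un_null_set[of "interior D" lborel "frontier D"] by (simp add: borel_open)
        qed
        then have "(\<Sum>D\<in>\<D>. vol D) = (\<Sum>D\<in>\<D>. vol (interior D))" by simp
        also have "\<dots> = vol (\<Union>D\<in>\<D>. interior D)"
          using D(4) fm by (intro measure_UNION_AE[symmetric] D(1)) (auto simp: pairwise_def disjoint_iff)
        also have "\<dots> \<le> vol \<Omega>"
        proof (rule measure_mono_fmeasurable)
          show "(\<Union>D\<in>\<D>. interior D) \<subseteq> \<Omega>" using D(5) interior_subset by fastforce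
          show "\<Omega> \<in> fmeasurable lborel" using \<Omega>(1) by (intro fmeasurable_compact) (simp add: convex_body_def)
          show "(\<Union>D\<in>\<D>. interior D) \<in> sets lborel" by (simp add: borel_open open_UN)
        qed
        finally show ?thesis .
      qed
      then have "(\<Sum>D\<in>\<D>. K0 * \<Gamma>\<^sup>2 * \<eta> ^ 4 * vol D) \<le> K0 * \<Gamma>\<^sup>2 * \<eta> ^ 4 * vol \<Omega>"
        unfolding sum_distrib_left[symmetric] using K0 by (intro mult_left_mono) auto
      then have dom: "dominated (\<Union>D\<in>\<D>. interior D) (K0 * \<Gamma>\<^sup>2 * \<eta> ^ 4 * vol \<Omega>) f g"
        by (rule dominated_mono[OF dUN order_refl])
      have neg: "negligible (\<Omega> - (\<Union>D\<in>\<D>. interior D))"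
      proof (rule negligible_subset)
        show "negligible (\<Union>D\<in>\<D>. frontier D)"
          using D(1) by (intro negligible_Union) (auto intro: negligible_convex_frontier cvx)
        show "\<Omega> - (\<Union>D\<in>\<D>. interior D) \<subseteq> (\<Union>D\<in>\<D>. frontier D)"
        proof
          fix x assume x: "x \<in> \<Omega> - (\<Union>D\<in>\<D>. interior D)"
          then obtain D' where D': "D' \<in> \<D>" "x \<in> D'" using D(5) by blast
          then have "x \<in> frontier D'" using x closure_subset by (auto simp: frontier_def)
          then show "x \<in> (\<Union>D\<in>\<D>. frontier D)" using D'(1) by blast
        qed
      qed
      show "sq_loss \<Omega> \<nu> f g \<le> ennreal (enn2real (density_sup \<Omega> p) * (K0 * \<Gamma>\<^sup>2 * \<eta> ^ 4 * vol \<Omega>))"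
        by (rule sq_loss_le_dominated[OF \<Omega>(1) dl neg dom]) (use K0 in simp)
    qed
  qed
qed

lemma sq_loss_bounded:
  assumes dl: "design_law \<Omega> \<nu> p" and f: "\<And>x. x \<in> \<Omega> \<Longrightarrow> \<bar>f x\<bar> \<le> \<Gamma>" "\<And>x. x \<in> \<Omega> \<Longrightarrow> \<bar>g x\<bar> \<le> \<Gamma>"
  shows "sq_loss \<Omega> \<nu> f g \<le> ennreal (4 * \<Gamma>\<^sup>2)"
proof -
  interpret prob_space \<nu> using dl unfolding design_law_def by blast
  have "(f x - g x)\<^sup>2 \<le> (2 * \<Gamma>)\<^sup>2" if "x \<in> \<Omega>" for x
    using f[OF that] by (intro power2_le_iff_abs_le[THEN iffD2]) linarith+
  then have "sq_loss \<Omega> \<nu> f g \<le> (\<integral>\<^sup>+x. ennreal (4 * \<Gamma>\<^sup>2) \<partial>\<nu>)" unfolding sq_loss_def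
    by (intro nn_integral_mono) (auto simp: indicator_def power_mult_distrib intro!: ennreal_leI)
  then show ?thesis by (simp add: emeasure_space_1)
qed

lemma simplicial_polytopes_pos:
  assumes "convex_body \<Omega>" "\<Omega> \<in> simplicial_polytopes k"
  shows "k > 0"
proof (rule ccontr)
  assume "\<not> k > 0"
  then have "\<Omega> = {}" using assms(2) by (auto simp: simplicial_polytopes_def)
  then show False using assms(1) by (simp add: convex_body_def)
qed

lemma minimax_risk_polytope:
  "\<exists>C :: real \<Rightarrow> real \<Rightarrow> real \<Rightarrow> ennreal \<Rightarrow> ennreal \<Rightarrow> real.
      \<forall>(\<Omega> :: 'a::euclidean_space set) \<nu> p (\<Gamma> :: real) (\<sigma> :: real) (k :: nat) (n :: nat) Q.
        convex_body \<Omega> \<longrightarrow> \<Omega> \<in> simplicial_polytopes k \<longrightarrow> design_law \<Omega> \<nu> p \<longrightarrow>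
        \<Gamma> > 0 \<longrightarrow> n \<ge> 1 \<longrightarrow> subgaussian_errors n \<sigma> Q \<longrightarrow>
        minimax_risk \<Omega> \<nu> Q n (bounded_convex \<Omega> \<Gamma>) \<le>
          ennreal (C (vol \<Omega>) \<Gamma> \<sigma> (density_inf \<Omega> p) (density_sup \<Omega> p) *
            (real k / real n) powr (4 / (real DIM('a) + 4)))"
proof -
  obtain K :: real where K: "K > 0" and sp: "\<And>(\<Omega> :: 'a set) k \<nu> p \<Gamma> \<eta>. \<lbrakk>convex_body \<Omega>; \<Omega> \<in> simplicial_polytopes k;
    design_law \<Omega> \<nu> p; 0 < \<Gamma>; 0 < \<eta>\<rbrakk> \<Longrightarrow>
    splits (bounded_convex \<Omega> \<Gamma>) (K * real k / \<eta> ^ DIM('a))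
      (\<lambda>f g. sq_loss \<Omega> \<nu> f g \<le> ennreal (enn2real (density_sup \<Omega> p) * (K * \<Gamma>\<^sup>2 * \<eta> ^ 4 * vol \<Omega>)))"
    using splits_simplicial_polytope[where 'a='a] by blast
  define C where "C v \<Gamma> \<sigma> a b = 16 * \<Gamma>\<^sup>2 + (4 * (enn2real b * (K * \<Gamma>\<^sup>2 * v)) + 16 * (\<sigma>\<^sup>2 + \<Gamma>\<^sup>2) * K)"
    for v \<Gamma> \<sigma> :: real and a b :: ennreal
  show ?thesis
  proof (intro exI[of _ C] allI impI)
    fix \<Omega> :: "'a set" and \<nu> p and \<Gamma> \<sigma> :: real and k n :: nat and Q
    assume \<Omega>: "convex_body \<Omega>" "\<Omega> \<in> simplicial_polytopes k" and dl: "design_law \<Omega> \<nu> p" and \<Gamma>: "\<Gamma> > 0"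
      and n: "n \<ge> 1" and err: "subgaussian_errors n \<sigma> Q"
    note risk = minimax_risk_le_splits[OF \<Omega>(1) dl \<Gamma> n err]
    define x where "x = real k / real n"
    define X where "X = x powr (4 / (real DIM('a) + 4))"
    let ?C = "C (vol \<Omega>) \<Gamma> \<sigma> (density_inf \<Omega> p) (density_sup \<Omega> p)"
    have k: "k > 0" by (rule simplicial_polytopes_pos[OF \<Omega>])
    have x: "x > 0" using k n by (simp add: x_def)
    have parts: "0 \<le> 4 * (enn2real (density_sup \<Omega> p) * (K * \<Gamma>\<^sup>2 * vol \<Omega>)) + 16 * (\<sigma>\<^sup>2 + \<Gamma>\<^sup>2) * K"
      using K by (intro add_nonneg_nonneg mult_nonneg_nonneg) auto
    have "minimax_risk \<Omega> \<nu> Q n (bounded_convex \<Omega> \<Gamma>) \<le> ennreal (?C * X)"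
    proof (cases "k \<le> n")
      case True
      \<comment> \<open>This balances squared radius against entropy per observation: \<eta>^4 = (k
        / n) / \<eta>^d.\<close>
      define \<eta> where "\<eta> = x powr (1 / (real DIM('a) + 4))"
      have \<eta>: "\<eta> > 0" using x by (simp add: \<eta>_def)
      have \<eta>4: "\<eta> ^ 4 = X" using x by (simp add: \<eta>_def X_def powr_power)
      have "x / \<eta> ^ DIM('a) = x powr 1 / x powr (real DIM('a) / (real DIM('a) + 4))"
        using x by (simp add: \<eta>_def powr_power)
      also have "\<dots> = x powr (1 - real DIM('a) / (real DIM('a) + 4))" by (rule powr_diff[symmetric])
      also have "1 - real DIM('a) / (real DIM('a) + 4) = 4 / (real DIM('a) + 4)" by (simp add: field_simps)
      finally have \<eta>d: "x / \<eta> ^ DIM('a) = X" by (simp add: X_def)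
      have "K * real k / \<eta> ^ DIM('a) / real n = K * (x / \<eta> ^ DIM('a))" by (simp add: x_def)
      then have En: "K * real k / \<eta> ^ DIM('a) / real n = K * X" unfolding \<eta>d .
      let ?e = "enn2real (density_sup \<Omega> p) * (K * \<Gamma>\<^sup>2 * \<eta> ^ 4 * vol \<Omega>)"
      have "minimax_risk \<Omega> \<nu> Q n (bounded_convex \<Omega> \<Gamma>) \<le> ennreal (4 * ?e + 16 * (\<sigma>\<^sup>2 + \<Gamma>\<^sup>2) * (K * real k / \<eta> ^ DIM('a)) / real n)"
        by (rule risk[OF _ sp[OF \<Omega> dl \<Gamma> \<eta>]]) (use K in auto)
      also have "4 * ?e + 16 * (\<sigma>\<^sup>2 + \<Gamma>\<^sup>2) * (K * real k / \<eta> ^ DIM('a)) / real n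
         = (4 * (enn2real (density_sup \<Omega> p) * (K * \<Gamma>\<^sup>2 * vol \<Omega>)) + 16 * (\<sigma>\<^sup>2 + \<Gamma>\<^sup>2) * K) * X"
      proof -
        have "16 * (\<sigma>\<^sup>2 + \<Gamma>\<^sup>2) * (K * real k / \<eta> ^ DIM('a)) / real n = 16 * (\<sigma>\<^sup>2 + \<Gamma>\<^sup>2) * (K * X)"
          unfolding En[symmetric] by simp
        then show ?thesis unfolding \<eta>4 by (simp add: algebra_simps)
      qed
      also have "ennreal \<dots> \<le> ennreal (?C * X)"
        unfolding C_def X_def by (intro ennreal_leI mult_right_mono) auto
      finally show ?thesis .
    next
      case False
      \<comment> \<open>With more simplices than observations the rate is at least 1, and a single
        label achieves the trivial loss \<open>4 * \<Gamma>^2\<close>; this gives the term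
        \<open>16 * \<Gamma>^2\<close> of \<open>C\<close>.\<close>
      have "1 \<le> x" using False n by (simp add: x_def)
      then have X1: "1 \<le> X" unfolding X_def by (intro ge_one_powr_ge_zero) auto
      have "splits (bounded_convex \<Omega> \<Gamma>) 0 (\<lambda>f g. sq_loss \<Omega> \<nu> f g \<le> ennreal (4 * \<Gamma>\<^sup>2))"
        by (rule splits_trivial) (auto intro!: sq_loss_bounded[OF dl] simp: bounded_convex_def)
      then have "minimax_risk \<Omega> \<nu> Q n (bounded_convex \<Omega> \<Gamma>) \<le> ennreal (4 * (4 * \<Gamma>\<^sup>2) + 16 * (\<sigma>\<^sup>2 + \<Gamma>\<^sup>2) * 0 / real n)"
        by (intro risk) auto
      also have "\<dots> = ennreal (16 * \<Gamma>\<^sup>2 * 1)" by simp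
      also have "\<dots> \<le> ennreal (?C * X)"
        using X1 parts unfolding C_def by (intro ennreal_leI mult_mono) auto
      finally show ?thesis .
    qed
    then show "minimax_risk \<Omega> \<nu> Q n (bounded_convex \<Omega> \<Gamma>) \<le>
          ennreal (C (vol \<Omega>) \<Gamma> \<sigma> (density_inf \<Omega> p) (density_sup \<Omega> p) * (real k / real n) powr (4 / (real DIM('a) + 4)))"
      by (simp add: X_def x_def)
  qed
qed

section \<open>Steep slopes and general convex bodies\<close>

text \<open>
  Where the slope of \<open>\<phi>\<close> is steep and essentially along \<open>\<sigma> k\<close>, the graph of \<open>\<phi>\<close> is read
  as a graph over the remaining coordinates and the value of \<open>\<phi>\<close>, with \<open>- \<sigma> y\<^sub>k\<close> as the new
  convex function; its slope in the value direction is the reciprocal of the slope of \<open>\<phi>\<close>.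
\<close>

definition wall_pos :: "real \<Rightarrow> 'a::euclidean_space \<Rightarrow> 'a \<Rightarrow> real \<Rightarrow> 'a" where
  "wall_pos s k y t = (\<Sum>b\<in>Basis. (if b = k then t / s else y \<bullet> b) *\<^sub>R b)"

text \<open>Implicit differentiation of the graph solved for the coordinate \<open>k\<close>:
  dividing by the dominant slope \<open>\<sigma> * (p \<bullet> k)\<close> gives the gradient of
  \<open>- \<sigma> * (y \<bullet> k)\<close> in the new variables, with \<open>- s\<close>
  accounting for the rescaled value \<open>t / s\<close>.\<close>

definition wall_slope :: "real \<Rightarrow> real \<Rightarrow> 'a::euclidean_space \<Rightarrow> 'a \<Rightarrow> 'a" where
  "wall_slope s \<sigma> k p = (\<Sum>b\<in>Basis. (if b = k then - s else p \<bullet> b) *\<^sub>R b) /\<^sub>R (\<sigma> * (p \<bullet> k))"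

lemma wall_pos_inner: "b \<in> Basis \<Longrightarrow> wall_pos s k y t \<bullet> b = (if b = k then t / s else y \<bullet> b)"
  unfolding wall_pos_def by simp

lemma wall_slope_inner: "b \<in> Basis \<Longrightarrow> wall_slope s \<sigma> k p \<bullet> b = (if b = k then - s else p \<bullet> b) / (\<sigma> * (p \<bullet> k))"
  unfolding wall_slope_def by (simp add: divide_inverse mult.commute)

text \<open>The defect of the new minorant is the defect of the old subgradient inequality divided
  by the positive number \<open>\<sigma> * (p \<bullet> k)\<close>. So convexity passes to the new
  picture, and errors return multiplied by that slope.\<close>

lemma wall_dual:
  fixes y y' p :: "'a::euclidean_space"
  assumes k: "k \<in> Basis" and s: "s \<noteq> 0" and \<sigma>: "\<sigma> = 1 \<or> \<sigma> = -1" and A: "\<sigma> * (p \<bullet> k) > 0"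
  shows "wall_slope s \<sigma> k p \<bullet> (wall_pos s k y' t' - wall_pos s k y t)
     = (p \<bullet> (y' - y) - (t' - t)) / (\<sigma> * (p \<bullet> k)) - \<sigma> * ((y' - y) \<bullet> k)"
proof -
  define A where "A = \<sigma> * (p \<bullet> k)"
  have A0: "A > 0" using A by (simp add: A_def)
  have pk: "(p \<bullet> k) / A = \<sigma>" using \<sigma> A by (auto simp: A_def)
  have "wall_slope s \<sigma> k p \<bullet> (wall_pos s k y' t' - wall_pos s k y t)
    = (\<Sum>b\<in>Basis. ((if b = k then - s else p \<bullet> b) / A) * ((if b = k then t' / s else y' \<bullet> b) - (if b = k then t / s else y \<bullet> b)))"
    by (subst euclidean_inner) (auto intro!: sum.cong simp: wall_slope_inner wall_pos_inner inner_diff_left A_def)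
  also have "\<dots> = (- s / A) * (t' / s - t / s) + (\<Sum>b\<in>Basis - {k}. ((p \<bullet> b) / A) * (y' \<bullet> b - y \<bullet> b))"
    by (subst sum.remove[OF _ k]) auto
  also have "(- s / A) * (t' / s - t / s) = - (t' - t) / A"
  proof -
    have "(- s / A) * (t' / s - t / s) = - (s * ((t' - t) / s)) / A" by (simp add: diff_divide_distrib)
    then show ?thesis using s by simp
  qed
  also have "(\<Sum>b\<in>Basis - {k}. ((p \<bullet> b) / A) * (y' \<bullet> b - y \<bullet> b)) = (p \<bullet> (y' - y)) / A - ((p \<bullet> k) / A) * ((y' - y) \<bullet> k)"
  proof -
    have "(p \<bullet> (y' - y)) / A = (\<Sum>b\<in>Basis. ((p \<bullet> b) / A) * (y' \<bullet> b - y \<bullet> b))"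
      by (subst euclidean_inner) (simp add: sum_divide_distrib inner_diff_left)
    also have "\<dots> = ((p \<bullet> k) / A) * ((y' - y) \<bullet> k) + (\<Sum>b\<in>Basis - {k}. ((p \<bullet> b) / A) * (y' \<bullet> b - y \<bullet> b))"
      by (subst sum.remove[OF _ k]) (auto simp: inner_diff_left)
    finally show ?thesis by simp
  qed
  finally show ?thesis unfolding pk A_def[symmetric] by (simp add: diff_divide_distrib)
qed

text \<open>For slopes of size 2^i the inverse graph has slope of order 2^-i in the value direction.
  Since points and slopes share one width, the value is divided by \<open>sqrt 2 ^ i\<close>: both
  then have width of order \<open>1 / sqrt 2 ^ i\<close> in direction \<open>k\<close>, and the cell
  count gains this factor. An error of order \<open>r^2\<close> in the coordinate \<open>k\<close>
  means up to \<open>r^2 * 2 ^ i\<close> in value.\<close>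

lemma splits_wall_chart:
  assumes dim: "DIM('a::euclidean_space) \<ge> 2"
  shows "\<exists>K>0. \<forall>(F::'f set) (\<phi> :: 'f \<Rightarrow> 'a \<Rightarrow> real) T (i :: nat) r k \<sigma>.
     (\<forall>f\<in>F. \<forall>y\<in>T. \<bar>\<phi> f y\<bar> \<le> 1) \<longrightarrow> (\<forall>y\<in>T. \<forall>b\<in>Basis. \<bar>y \<bullet> b\<bar> \<le> 1) \<longrightarrow>
     0 < r \<longrightarrow> r \<le> 1 / sqrt 2 ^ i \<longrightarrow> k \<in> Basis \<longrightarrow> \<sigma> = 1 \<or> \<sigma> = -1 \<longrightarrow>
     splits F (K * (1 / sqrt 2 ^ i) / r ^ DIM('a)) (\<lambda>f g. \<forall>y\<in>T. \<forall>p. subgradient (\<phi> f) T y p \<longrightarrow>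
        (\<forall>b\<in>Basis. \<bar>p \<bullet> b\<bar> \<le> \<sigma> * (p \<bullet> k)) \<longrightarrow> 2 ^ i < 2 * (\<sigma> * (p \<bullet> k)) \<longrightarrow> \<sigma> * (p \<bullet> k) \<le> 2 ^ i \<longrightarrow>
        \<phi> f y - \<phi> g y \<le> K * r\<^sup>2 * 2 ^ i)"
proof -
  obtain K :: real where K: "K > 0" and
    jets: "\<And>(F::'f set) (J :: 'f \<Rightarrow> ('a \<times> 'a \<times> real) set) a r b0.
    \<lbrakk>\<forall>f\<in>F. convex_jets (J f);
    \<forall>f\<in>F. \<forall>(u, w, z)\<in>J f. \<bar>z\<bar> \<le> 2 \<and> (\<forall>b\<in>Basis. \<bar>u \<bullet> b\<bar> \<le> 2 * a b \<and> \<bar>w \<bullet> b\<bar> \<le> 2 * a b);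
    0 < r; \<forall>b\<in>Basis. r \<le> a b \<and> a b \<le> 1; b0 \<in> Basis; a b0 = 1\<rbrakk> \<Longrightarrow>
    splits F (K * (\<Prod>b\<in>Basis. a b / r))
      (\<lambda>f g. \<forall>(u, w, z)\<in>J f. \<exists>(u', w', z')\<in>J g. z - K * r\<^sup>2 \<le> z' + w' \<bullet> (u - u'))"
    using splits_convex_jets[where 'f='f and 'a='a] by blast
  show ?thesis
  proof (intro exI[of _ K] conjI allI impI K)
    fix F :: "'f set" and \<phi> :: "'f \<Rightarrow> 'a \<Rightarrow> real" and T :: "'a set" and i :: nat and r :: real and k :: 'a and \<sigma> :: real
    assume bd: "\<forall>f\<in>F. \<forall>y\<in>T. \<bar>\<phi> f y\<bar> \<le> 1" and T: "\<forall>y\<in>T. \<forall>b\<in>Basis. \<bar>y \<bullet> b\<bar> \<le> 1"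
      and r: "0 < r" "r \<le> 1 / sqrt 2 ^ i" and k: "k \<in> Basis" and \<sigma>: "\<sigma> = 1 \<or> \<sigma> = -1"
    define s where "s = sqrt 2 ^ i"
    have s1: "s \<ge> 1" unfolding s_def by (rule one_le_power) simp
    have ss: "s * s = 2 ^ i" unfolding s_def by (simp flip: power_mult_distrib)
    define a where "a b = (if b = k then 1 / s else 1)" for b :: 'a
    \<comment> \<open>In dimension at least 2 a direction other than \<open>k\<close> keeps full
      width 1, as the jet estimate requires.\<close>
    have "card (Basis - {k}) \<noteq> 0" using dim k by simp
    then obtain b0 where b0: "b0 \<in> Basis" "b0 \<noteq> k" by (metis Diff_iff card.empty ex_in_conv insertI1)
    define chart where "chart p \<longleftrightarrow> (\<forall>b\<in>Basis. \<bar>p \<bullet> b\<bar> \<le> \<sigma> * (p \<bullet> k)) \<and> 2 ^ i < 2 * (\<sigma> * (p \<bullet> k)) \<and> \<sigma> * (p \<bullet> k) \<le> 2 ^ i" for p :: 'a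
    have A: "\<sigma> * (p \<bullet> k) > 0" if "chart p" for p
    proof -
      have "(0::real) < 2 ^ i" by simp
      then show ?thesis using that unfolding chart_def by linarith
    qed
    define J where "J f = {(u, w, z). \<exists>y p. y \<in> T \<and> subgradient (\<phi> f) T y p \<and> chart p \<and>
       u = wall_pos s k y (\<phi> f y) \<and> w = wall_slope s \<sigma> k p \<and> z = - \<sigma> * (y \<bullet> k)}" for f
    have dual: "wall_slope s \<sigma> k p \<bullet> (wall_pos s k y' t' - wall_pos s k y t)
     = (p \<bullet> (y' - y) - (t' - t)) / (\<sigma> * (p \<bullet> k)) - \<sigma> * ((y' - y) \<bullet> k)" if "chart p" for p y y' :: 'a and t t'
      using wall_dual[OF k _ \<sigma> A[OF that]] s1 by simp
    have sp: "splits F (K * (\<Prod>b\<in>Basis. a b / r)) (\<lambda>f g. \<forall>(u, w, z)\<in>J f. \<exists>(u', w', z')\<in>J g. z - K * r\<^sup>2 \<le> z' + w' \<bullet> (u - u'))"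
    proof (rule jets[OF _ _ r(1) _ b0(1)])
      show "\<forall>f\<in>F. convex_jets (J f)"
      proof
        fix f assume "f \<in> F"
        have "- \<sigma> * (y \<bullet> k) + wall_slope s \<sigma> k p \<bullet> (wall_pos s k y' (\<phi> f y') - wall_pos s k y (\<phi> f y)) \<le> - \<sigma> * (y' \<bullet> k)"
          if "y \<in> T" "subgradient (\<phi> f) T y p" "chart p" "y' \<in> T" for y p y'
        proof -
          have "p \<bullet> (y' - y) - (\<phi> f y' - \<phi> f y) \<le> 0" using that unfolding subgradient_def by fastforce
          then have "(p \<bullet> (y' - y) - (\<phi> f y' - \<phi> f y)) / (\<sigma> * (p \<bullet> k)) \<le> 0"
            using A[OF that(3)] by (simp add: divide_nonpos_pos)
          then show ?thesis unfolding dual[OF that(3)] by (simp add: inner_diff_left algebra_simps)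
        qed
        then show "convex_jets (J f)" unfolding convex_jets_def J_def by auto
      qed
      show "\<forall>f\<in>F. \<forall>(u, w, z)\<in>J f. \<bar>z\<bar> \<le> 2 \<and> (\<forall>b\<in>Basis. \<bar>u \<bullet> b\<bar> \<le> 2 * a b \<and> \<bar>w \<bullet> b\<bar> \<le> 2 * a b)"
      proof (intro ballI, clarify)
        fix f u w z assume f: "f \<in> F" and "(u, w, z) \<in> J f"
        then obtain y p where y: "y \<in> T" "chart p"
          "u = wall_pos s k y (\<phi> f y)" "w = wall_slope s \<sigma> k p" "z = - \<sigma> * (y \<bullet> k)"
          unfolding J_def by auto
        have "\<bar>z\<bar> \<le> 2" using T y(1,5) k \<sigma> by fastforce
        moreover have "\<bar>u \<bullet> b\<bar> \<le> 2 * a b" if "b \<in> Basis" for b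
        proof (cases "b = k")
          case True
          have "\<bar>\<phi> f y\<bar> / s \<le> 2 / s" using bd f y(1) s1 by (intro divide_right_mono) force+
          then show ?thesis using True that s1 by (simp add: y(3) wall_pos_inner a_def)
        next
          case False
          then show ?thesis using T y(1) that by (fastforce simp: y(3) wall_pos_inner a_def)
        qed
        moreover have "\<bar>w \<bullet> b\<bar> \<le> 2 * a b" if "b \<in> Basis" for b
        proof (cases "b = k")
          case True
          have "s * s < 2 * (\<sigma> * (p \<bullet> k))" using y(2) unfolding ss chart_def by blast
          then have "s / (\<sigma> * (p \<bullet> k)) \<le> 2 / s" using A[OF y(2)] s1 by (simp add: field_simps)
          then show ?thesis using True that s1 A[OF y(2)] by (simp add: y(4) wall_slope_inner a_def)
        next
          case False
          have "\<bar>p \<bullet> b\<bar> / (\<sigma> * (p \<bullet> k)) \<le> 1" using y(2) that A[OF y(2)] unfolding chart_def by (simp add: divide_le_eq_1)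
          moreover have "\<bar>w \<bullet> b\<bar> = \<bar>p \<bullet> b\<bar> / (\<sigma> * (p \<bullet> k))"
            using False that A[OF y(2)] by (simp add: y(4) wall_slope_inner)
          ultimately show ?thesis using False by (simp add: a_def)
        qed
        ultimately show "\<bar>z\<bar> \<le> 2 \<and> (\<forall>b\<in>Basis. \<bar>u \<bullet> b\<bar> \<le> 2 * a b \<and> \<bar>w \<bullet> b\<bar> \<le> 2 * a b)" by blast
      qed
      show "\<forall>b\<in>Basis. r \<le> a b \<and> a b \<le> 1"
      proof -
        have "1 / s \<le> 1" using s1 by simp
        then show ?thesis using r(2) unfolding a_def s_def[symmetric] by auto
      qed
      show "a b0 = 1" using b0 by (simp add: a_def)
    qed
    show "splits F (K * (1 / sqrt 2 ^ i) / r ^ DIM('a)) (\<lambda>f g. \<forall>y\<in>T. \<forall>p. subgradient (\<phi> f) T y p \<longrightarrow>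
        (\<forall>b\<in>Basis. \<bar>p \<bullet> b\<bar> \<le> \<sigma> * (p \<bullet> k)) \<longrightarrow> 2 ^ i < 2 * (\<sigma> * (p \<bullet> k)) \<longrightarrow> \<sigma> * (p \<bullet> k) \<le> 2 ^ i \<longrightarrow>
        \<phi> f y - \<phi> g y \<le> K * r\<^sup>2 * 2 ^ i)"
    proof (rule splits_mono[OF sp])
      have "(\<Prod>b\<in>Basis. a b / r) = (\<Prod>b\<in>Basis. a b) / r ^ DIM('a)" by (simp add: prod_dividef)
      also have "(\<Prod>b\<in>Basis. a b) = 1 / s" unfolding a_def using k by (simp add: prod.delta)
      finally show "K * (\<Prod>b\<in>Basis. a b / r) \<le> K * (1 / sqrt 2 ^ i) / r ^ DIM('a)" by (simp add: s_def)
      fix f g assume close: "\<forall>(u, w, z)\<in>J f. \<exists>(u', w', z')\<in>J g. z - K * r\<^sup>2 \<le> z' + w' \<bullet> (u - u')"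
      have "\<phi> f y - \<phi> g y \<le> K * r\<^sup>2 * 2 ^ i" if y: "y \<in> T" "subgradient (\<phi> f) T y p" "chart p" for y p
      proof -
        have "(wall_pos s k y (\<phi> f y), wall_slope s \<sigma> k p, - \<sigma> * (y \<bullet> k)) \<in> J f" unfolding J_def using y by blast
        from bspec[OF close this] obtain u' w' z' where j: "(u', w', z') \<in> J g"
          "- \<sigma> * (y \<bullet> k) - K * r\<^sup>2 \<le> z' + w' \<bullet> (wall_pos s k y (\<phi> f y) - u')" by auto
        from j(1) obtain y' p' where y': "y' \<in> T" "subgradient (\<phi> g) T y' p'" "chart p'"
          "u' = wall_pos s k y' (\<phi> g y')" "w' = wall_slope s \<sigma> k p'" "z' = - \<sigma> * (y' \<bullet> k)"
          unfolding J_def by blast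
        let ?A = "\<sigma> * (p' \<bullet> k)"
        have A': "?A > 0" "?A \<le> 2 ^ i" using A[OF y'(3)] y'(3) by (auto simp: chart_def)
        \<comment> \<open>The identity for the pairing, applied at the jet of \<open>g\<close>,
          converts closeness in the coordinate \<open>k\<close> into closeness of values; the factor
          is the slope of \<open>g\<close>, not that of \<open>f\<close>.\<close>
        have "- K * r\<^sup>2 \<le> (p' \<bullet> (y - y') - (\<phi> f y - \<phi> g y')) / ?A"
          using j(2) unfolding y'(4-6) dual[OF y'(3)] by (simp add: inner_diff_left algebra_simps)
        also have "\<dots> \<le> (\<phi> g y - \<phi> f y) / ?A"
          using y'(2) y(1) A'(1) unfolding subgradient_def by (intro divide_right_mono) fastforce+
        finally have "\<phi> f y - \<phi> g y \<le> K * r\<^sup>2 * ?A" using A'(1) by (simp add: field_simps)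
        also have "\<dots> \<le> K * r\<^sup>2 * 2 ^ i" using K A'(2) by (intro mult_left_mono) auto
        finally show ?thesis .
      qed
      then show "\<forall>y\<in>T. \<forall>p. subgradient (\<phi> f) T y p \<longrightarrow>
        (\<forall>b\<in>Basis. \<bar>p \<bullet> b\<bar> \<le> \<sigma> * (p \<bullet> k)) \<longrightarrow> 2 ^ i < 2 * (\<sigma> * (p \<bullet> k)) \<longrightarrow> \<sigma> * (p \<bullet> k) \<le> 2 ^ i \<longrightarrow>
        \<phi> f y - \<phi> g y \<le> K * r\<^sup>2 * 2 ^ i" unfolding chart_def by blast
    qed
  qed
qed

section \<open>Boundary layers of a convex body\<close>

definition body_layer :: "'a::euclidean_space set \<Rightarrow> 'a \<Rightarrow> real \<Rightarrow> 'a set" where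
  "body_layer \<Omega> c \<tau> = (if \<tau> \<le> 1 then \<Omega> - (\<lambda>x. (1 - \<tau>) *\<^sub>R x + \<tau> *\<^sub>R c) ` \<Omega> else \<Omega>)"

text \<open>A homothetic copy is removed, rather than the points far from the boundary, because its
  volume is exactly \<open>(1 - \<tau>) ^ DIM('a)\<close> times that of the body; Bernoulli's
  inequality gives linear growth in \<open>\<tau>\<close>. For \<open>\<tau> > 1\<close> the layer
  is the whole body, so small exponents are covered by the same bound.\<close>

lemma body_layer_measure:
  fixes \<Omega> :: "'a::euclidean_space set"
  assumes \<Omega>: "compact \<Omega>" "convex \<Omega>" and c: "c \<in> \<Omega>" and \<tau>: "0 \<le> \<tau>"
  shows "body_layer \<Omega> c \<tau> \<in> sets borel"
    and "emeasure lborel (body_layer \<Omega> c \<tau>) \<le> ennreal (real DIM('a) * \<tau> * vol \<Omega>)"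
proof -
  let ?S = "(\<lambda>x. (1 - \<tau>) *\<^sub>R x + \<tau> *\<^sub>R c) ` \<Omega>"
  have \<Omega>b: "\<Omega> \<in> sets borel" using \<Omega> by (simp add: compact_imp_closed)
  have cS: "compact ?S" by (intro compact_continuous_image \<Omega> continuous_intros)
  then have Sb: "?S \<in> sets borel" by (simp add: compact_imp_closed)
  show m: "body_layer \<Omega> c \<tau> \<in> sets borel" unfolding body_layer_def using \<Omega>b Sb by auto
  have fin: "emeasure lborel (body_layer \<Omega> c \<tau>) = ennreal (vol (body_layer \<Omega> c \<tau>))"
  proof (rule emeasure_eq_ennreal_measure)
    have "emeasure lborel (body_layer \<Omega> c \<tau>) \<le> emeasure lborel \<Omega>"
      using \<Omega>b by (intro emeasure_mono) (auto simp: body_layer_def)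
    then show "emeasure lborel (body_layer \<Omega> c \<tau>) \<noteq> \<top>"
      using emeasure_compact_finite[OF \<Omega>(1)] by (auto simp: top_unique)
  qed
  have dim: "1 \<le> real DIM('a)" using DIM_positive[where 'a='a] by linarith
  have "vol (body_layer \<Omega> c \<tau>) \<le> real DIM('a) * \<tau> * vol \<Omega>"
  proof (cases "\<tau> \<le> 1")
    case True
    have sub: "?S \<subseteq> \<Omega>"
    proof
      fix x assume "x \<in> ?S"
      then obtain y where "y \<in> \<Omega>" "x = (1 - \<tau>) *\<^sub>R y + \<tau> *\<^sub>R c" by blast
      then show "x \<in> \<Omega>" using convexD[OF \<Omega>(2), of y c "1 - \<tau>" \<tau>] c \<tau> True by simp
    qed
    have "vol (body_layer \<Omega> c \<tau>) = vol \<Omega> - vol ?S"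
      unfolding body_layer_def using True sub \<Omega>b Sb emeasure_compact_finite[OF \<Omega>(1)]
      by (auto intro!: measure_Diff)
    also have "vol ?S = (1 - \<tau>) ^ DIM('a) * vol \<Omega>"
    proof -
      have "vol ?S = measure lebesgue ?S" using Sb by (simp add: measure_completion)
      also have "\<dots> = \<bar>1 - \<tau>\<bar> ^ DIM('a) * measure lebesgue \<Omega>" by (rule measure_lebesgue_affine)
      also have "measure lebesgue \<Omega> = vol \<Omega>" using \<Omega>b by (simp add: measure_completion)
      finally show ?thesis using True by simp
    qed
    also have "vol \<Omega> - (1 - \<tau>) ^ DIM('a) * vol \<Omega> = (1 - (1 - \<tau>) ^ DIM('a)) * vol \<Omega>" by (simp add: algebra_simps)
    also have "\<dots> \<le> (real DIM('a) * \<tau>) * vol \<Omega>"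
      using Bernoulli_inequality[of "- \<tau>" "DIM('a)"] True by (intro mult_right_mono) auto
    finally show ?thesis .
  next
    case False
    have "1 * 1 \<le> real DIM('a) * \<tau>" using False dim by (intro mult_mono) auto
    then have "1 * vol \<Omega> \<le> (real DIM('a) * \<tau>) * vol \<Omega>" by (intro mult_right_mono) auto
    then show ?thesis using False by (simp add: body_layer_def)
  qed
  then show "emeasure lborel (body_layer \<Omega> c \<tau>) \<le> ennreal (real DIM('a) * \<tau> * vol \<Omega>)"
    unfolding fin by (rule ennreal_leI)
qed

text \<open>A point outside the layer is a convex combination of some \<open>w\<close> in the body
  and \<open>c\<close> with weight \<open>\<tau>\<close> on \<open>c\<close>, so a ball of radius
  \<open>\<tau> * r0\<close> around it stays in the body. Steps of that length in both directions
  along \<open>b\<close> change \<open>\<phi>\<close> by at most 2.\<close>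

lemma slope_outside_layer:
  fixes \<Omega> :: "'a::euclidean_space set"
  assumes \<Omega>: "convex \<Omega>" "cball c r0 \<subseteq> \<Omega>" and r0: "0 < r0" and x: "x \<in> \<Omega>" "x \<notin> body_layer \<Omega> c \<tau>"
    and \<tau>: "0 < \<tau>" and b: "b \<in> Basis"
    and bd: "\<And>y. y \<in> \<Omega> \<Longrightarrow> \<bar>\<phi> y\<bar> \<le> 1" and p: "subgradient \<phi> \<Omega> x p"
  shows "\<bar>p \<bullet> b\<bar> * (\<tau> * r0) \<le> 2"
proof -
  have \<tau>1: "\<tau> \<le> 1" using x unfolding body_layer_def by (auto split: if_splits)
  then obtain w where w: "w \<in> \<Omega>" "x = (1 - \<tau>) *\<^sub>R w + \<tau> *\<^sub>R c" using x unfolding body_layer_def by auto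
  have mem: "x + (h * (\<tau> * r0)) *\<^sub>R b \<in> \<Omega>" if h: "\<bar>h\<bar> \<le> 1" for h
  proof -
    have "\<bar>h\<bar> * r0 \<le> 1 * r0" using h r0 by (intro mult_right_mono) auto
    then have "c + (h * r0) *\<^sub>R b \<in> cball c r0" using b r0 by (simp add: dist_norm abs_mult)
    then have "(1 - \<tau>) *\<^sub>R w + \<tau> *\<^sub>R (c + (h * r0) *\<^sub>R b) \<in> \<Omega>"
      using \<Omega> w \<tau> \<tau>1 by (intro convexD) auto
    moreover have "(1 - \<tau>) *\<^sub>R w + \<tau> *\<^sub>R (c + (h * r0) *\<^sub>R b) = x + (h * (\<tau> * r0)) *\<^sub>R b"
      unfolding w(2) by (simp add: scaleR_add_right mult_ac)
    ultimately show ?thesis by simp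
  qed
  have "(h * (\<tau> * r0)) * (p \<bullet> b) \<le> 2" if h: "\<bar>h\<bar> \<le> 1" for h
  proof -
    have "\<phi> x + p \<bullet> ((h * (\<tau> * r0)) *\<^sub>R b) \<le> \<phi> (x + (h * (\<tau> * r0)) *\<^sub>R b)"
      using p mem[OF h] unfolding subgradient_def by fastforce
    then show ?thesis using bd[OF x(1)] bd[OF mem[OF h]] unfolding inner_scaleR_right by linarith
  qed
  from this[of 1] this[of "-1"] have "\<bar>(\<tau> * r0) * (p \<bullet> b)\<bar> \<le> 2" by simp
  then show ?thesis using \<tau> r0 by (simp add: abs_mult mult.commute)
qed

text \<open>Slopes at most 1 go to one isotropic chart of mesh \<open>\<rho>\<close>; slopes of size
  2^i go to one of \<open>2 * DIM('a)\<close> wall charts, indexed by the dominant coordinate and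
  its sign; slopes beyond 2^J are bounded trivially on layer \<open>J\<close>. On layer
  \<open>i\<close> the squared error (r_i^2 2^i)^2 times the volume O(2^-i) is the term
  \<open>r i ^ 4 * 2 ^ i\<close>.\<close>

lemma splits_convex_body:
  fixes \<Omega> :: "'a::euclidean_space set"
  assumes \<Omega>: "convex_body \<Omega>" and dim: "DIM('a) \<ge> 2" and \<Gamma>: "0 < \<Gamma>"
  shows "\<exists>C>0. \<forall>J (\<rho>::real) (r :: nat \<Rightarrow> real). 0 < \<rho> \<longrightarrow> (\<forall>i\<in>{1..J}. 0 < r i \<and> r i \<le> 1 / sqrt 2 ^ i) \<longrightarrow>
    splits (bounded_convex \<Omega> \<Gamma>) (C * (1 / \<rho> ^ DIM('a) + (\<Sum>i\<in>{1..J}. 1 / sqrt 2 ^ i / r i ^ DIM('a))))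
      (dominated (interior \<Omega>) (C * (\<rho> ^ 4 + 1 / 2 ^ J + (\<Sum>i\<in>{1..J}. r i ^ 4 * 2 ^ i))))"
proof -
  have cO: "compact \<Omega>" "convex \<Omega>" "interior \<Omega> \<noteq> {}" using \<Omega> by (auto simp: convex_body_def)
  obtain c r0 where c: "0 < r0" "cball c r0 \<subseteq> \<Omega>" using cO(3) by (metis ex_in_conv mem_interior_cball)
  have c\<Omega>: "c \<in> \<Omega>" using c by auto
  obtain R where R: "0 < R" "\<And>x. x \<in> \<Omega> \<Longrightarrow> norm x \<le> R"
    using compact_imp_bounded[OF cO(1)] by (auto simp: bounded_pos)
  \<comment> \<open>Dividing by the radius \<open>R\<close> puts the body in the unit ball, so that
    coordinates are at most 1 as the wall charts require.\<close>
  define T where "T = {y. R *\<^sub>R y \<in> \<Omega>}"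
  have TO: "T = (\<lambda>x. (1 / R) *\<^sub>R x) ` \<Omega>"
  proof
    show "T \<subseteq> (\<lambda>x. (1 / R) *\<^sub>R x) ` \<Omega>"
      using R by (auto simp: T_def intro!: image_eqI[of _ _ "R *\<^sub>R y" for y])
    show "(\<lambda>x. (1 / R) *\<^sub>R x) ` \<Omega> \<subseteq> T" using R by (auto simp: T_def)
  qed
  have T1: "\<bar>y \<bullet> b\<bar> \<le> 1" if "y \<in> T" "b \<in> Basis" for y b
  proof -
    have "R * norm y \<le> R" using R(2)[of "R *\<^sub>R y"] R(1) that by (simp add: T_def)
    then have "norm y \<le> 1" using R(1) by simp
    then show ?thesis using Basis_le_norm[OF that(2), of y] by linarith
  qed
  define F where "F = bounded_convex \<Omega> \<Gamma>"
  define \<phi> where "\<phi> f y = f (R *\<^sub>R y) / \<Gamma>" for f :: "'a \<Rightarrow> real" and y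
  have bd: "\<bar>\<phi> f y\<bar> \<le> 1" if "f \<in> F" "y \<in> T" for f y
    using that \<Gamma> by (auto simp: \<phi>_def F_def bounded_convex_def T_def)
  obtain K1 :: real where K1: "K1 > 0" and low: "\<And>(F::('a \<Rightarrow> real) set) (\<phi> :: ('a \<Rightarrow> real) \<Rightarrow> 'a \<Rightarrow> real) T (i :: 'a \<Rightarrow> nat) r.
     (\<forall>f\<in>F. \<forall>y\<in>T. \<bar>\<phi> f y\<bar> \<le> 1) \<Longrightarrow> 0 < r \<Longrightarrow>
     splits F (K1 / r ^ DIM('a)) (\<lambda>f g. \<forall>y\<in>T. \<forall>p. subgradient (\<phi> f) T y p \<longrightarrow>
        (\<forall>b\<in>Basis. \<bar>y \<bullet> b\<bar> \<le> 4 / 2 ^ i b \<and> \<bar>p \<bullet> b\<bar> \<le> 2 ^ i b) \<longrightarrow> \<phi> f y - \<phi> g y \<le> K1 * r\<^sup>2)"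
    using splits_slope_chart[where 'f="'a \<Rightarrow> real" and 'a='a] by blast
  obtain K2 :: real where K2: "K2 > 0" and wall: "\<And>(F::('a \<Rightarrow> real) set) (\<phi> :: ('a \<Rightarrow> real) \<Rightarrow> 'a \<Rightarrow> real) T (i :: nat) r k \<sigma>.
     \<lbrakk>\<forall>f\<in>F. \<forall>y\<in>T. \<bar>\<phi> f y\<bar> \<le> 1; \<forall>y\<in>T. \<forall>b\<in>Basis. \<bar>y \<bullet> b\<bar> \<le> 1;
     0 < r; r \<le> 1 / sqrt 2 ^ i; k \<in> Basis; \<sigma> = 1 \<or> \<sigma> = -1\<rbrakk> \<Longrightarrow>
     splits F (K2 * (1 / sqrt 2 ^ i) / r ^ DIM('a)) (\<lambda>f g. \<forall>y\<in>T. \<forall>p. subgradient (\<phi> f) T y p \<longrightarrow>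
        (\<forall>b\<in>Basis. \<bar>p \<bullet> b\<bar> \<le> \<sigma> * (p \<bullet> k)) \<longrightarrow> 2 ^ i < 2 * (\<sigma> * (p \<bullet> k)) \<longrightarrow> \<sigma> * (p \<bullet> k) \<le> 2 ^ i \<longrightarrow>
        \<phi> f y - \<phi> g y \<le> K2 * r\<^sup>2 * 2 ^ i)"
    using splits_wall_chart[OF dim, where 'f="'a \<Rightarrow> real"] by blast
  \<comment> \<open>Off layer \<open>i\<close> the slopes in the coordinates of \<open>T\<close> are
    at most \<open>2 * R / (\<tau> i * r0)\<close>. With this \<open>c0\<close> that is 2^i / 2, so
    a steeper slope forces the point into the layer.\<close>
  define c0 where "c0 = 4 * (R / r0)"
  have c0: "c0 > 0" using R c by (simp add: c0_def)
  define \<tau> where "\<tau> i = c0 / 2 ^ i" for i :: nat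
  have \<tau>: "0 < \<tau> i" for i using c0 by (simp add: \<tau>_def)
  define V where "V = real DIM('a) * c0 * vol \<Omega>"
  have V: "V \<ge> 0" using c0 by (simp add: V_def)
  define C1 where "C1 = \<Gamma>\<^sup>2 * (K1\<^sup>2 * vol \<Omega> + K2\<^sup>2 * V + 4 * V)"
  define C where "C = K1 + 2 * real DIM('a) * K2 + C1"
  have C1: "0 \<le> C1" "\<Gamma>\<^sup>2 * K1\<^sup>2 * vol \<Omega> \<le> C1" "\<Gamma>\<^sup>2 * K2\<^sup>2 * V \<le> C1" "\<Gamma>\<^sup>2 * 4 * V \<le> C1"
    using V unfolding C1_def by (simp_all add: algebra_simps)
  have C: "0 < C" "K1 \<le> C" "2 * real DIM('a) * K2 \<le> C" "C1 \<le> C"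
    using C1(1) K1 K2 unfolding C_def by (simp_all add: add_pos_nonneg add_nonneg_nonneg)
  have layer_m: "body_layer \<Omega> c (\<tau> i) \<in> sets borel" for i
    by (rule body_layer_measure(1)[OF cO(1,2) c\<Omega>]) (use \<tau>[of i] in simp)
  have layer_e: "emeasure lborel (body_layer \<Omega> c (\<tau> i)) \<le> ennreal (V / 2 ^ i)" for i
  proof -
    have "emeasure lborel (body_layer \<Omega> c (\<tau> i)) \<le> ennreal (real DIM('a) * \<tau> i * vol \<Omega>)"
      by (rule body_layer_measure(2)[OF cO(1,2) c\<Omega>]) (use \<tau>[of i] in simp)
    also have "real DIM('a) * \<tau> i * vol \<Omega> = V / 2 ^ i" by (simp add: V_def \<tau>_def)
    finally show ?thesis .
  qed
  have in_layer: "x \<in> body_layer \<Omega> c (\<tau> i)"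
    if f: "f \<in> F" and x: "x \<in> \<Omega>" and p: "subgradient (\<phi> f) T ((1 / R) *\<^sub>R x) p" and b: "b \<in> Basis" "2 ^ i < 2 * \<bar>p \<bullet> b\<bar>" for f x p b i
  proof (rule ccontr)
    assume nl: "x \<notin> body_layer \<Omega> c (\<tau> i)"
    have "subgradient (\<lambda>x. f x / \<Gamma>) \<Omega> x ((1 / R) *\<^sub>R p)"
      unfolding subgradient_def
    proof
      fix y assume y: "y \<in> \<Omega>"
      then have "(1 / R) *\<^sub>R y \<in> T" unfolding TO by blast
      then have "\<phi> f ((1 / R) *\<^sub>R x) + p \<bullet> ((1 / R) *\<^sub>R y - (1 / R) *\<^sub>R x) \<le> \<phi> f ((1 / R) *\<^sub>R y)"
        using p unfolding subgradient_def by blast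
      moreover have "p \<bullet> ((1 / R) *\<^sub>R y - (1 / R) *\<^sub>R x) = ((1 / R) *\<^sub>R p) \<bullet> (y - x)"
        by (simp add: inner_diff_right right_diff_distrib)
      moreover have "\<phi> f ((1 / R) *\<^sub>R z) = f z / \<Gamma>" for z using R(1) by (simp add: \<phi>_def)
      ultimately show "f x / \<Gamma> + ((1 / R) *\<^sub>R p) \<bullet> (y - x) \<le> f y / \<Gamma>" by simp
    qed
    moreover have "\<bar>f y / \<Gamma>\<bar> \<le> 1" if "y \<in> \<Omega>" for y using f that \<Gamma> by (auto simp: F_def bounded_convex_def)
    ultimately have "\<bar>((1 / R) *\<^sub>R p) \<bullet> b\<bar> * (\<tau> i * r0) \<le> 2"
      using slope_outside_layer[OF cO(2) c(2,1) x nl \<tau> b(1), of "\<lambda>x. f x / \<Gamma>"] by blast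
    moreover have "\<bar>((1 / R) *\<^sub>R p) \<bullet> b\<bar> * (\<tau> i * r0) = 4 * \<bar>p \<bullet> b\<bar> / 2 ^ i"
      using R(1) c(1) by (simp add: \<tau>_def c0_def abs_mult)
    ultimately have "4 * \<bar>p \<bullet> b\<bar> \<le> 2 * 2 ^ i" by (simp add: pos_divide_le_eq)
    then show False using b(2) by simp
  qed
  show ?thesis
  proof (intro exI[of _ C] conjI allI impI C(1))
    fix J :: nat and \<rho> :: real and r :: "nat \<Rightarrow> real"
    assume \<rho>: "0 < \<rho>" and r: "\<forall>i\<in>{1..J}. 0 < r i \<and> r i \<le> 1 / sqrt 2 ^ i"
    define RL where "RL f g \<longleftrightarrow> (\<forall>y\<in>T. \<forall>p. subgradient (\<phi> f) T y p \<longrightarrow>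
        (\<forall>b\<in>Basis. \<bar>p \<bullet> b\<bar> \<le> 1) \<longrightarrow> \<phi> f y - \<phi> g y \<le> K1 * \<rho>\<^sup>2)" for f g
    define RW where "RW = (\<lambda>(i, k, \<sigma>) f g. \<forall>y\<in>T. \<forall>p. subgradient (\<phi> f) T y p \<longrightarrow>
        (\<forall>b\<in>Basis. \<bar>p \<bullet> b\<bar> \<le> \<sigma> * (p \<bullet> k)) \<longrightarrow> 2 ^ i < 2 * (\<sigma> * (p \<bullet> k)) \<longrightarrow> \<sigma> * (p \<bullet> k) \<le> 2 ^ i \<longrightarrow>
        \<phi> f y - \<phi> g y \<le> K2 * (r i)\<^sup>2 * 2 ^ i)"
    define Ch where "Ch = {1..J} \<times> (Basis :: 'a set) \<times> {1, -1 :: real}"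
    have finCh: "finite Ch" unfolding Ch_def by simp
    have spL: "splits F (K1 / \<rho> ^ DIM('a)) RL"
    proof (rule splits_mono[OF low[where T = T and i = "\<lambda>_. 0" and \<phi> = \<phi>, OF _ \<rho>]])
      fix f g assume "\<forall>y\<in>T. \<forall>p. subgradient (\<phi> f) T y p \<longrightarrow>
        (\<forall>b\<in>Basis. \<bar>y \<bullet> b\<bar> \<le> 4 / 2 ^ 0 \<and> \<bar>p \<bullet> b\<bar> \<le> 2 ^ 0) \<longrightarrow> \<phi> f y - \<phi> g y \<le> K1 * \<rho>\<^sup>2"
      moreover have "\<bar>y \<bullet> b\<bar> \<le> 4 / 2 ^ 0" if "y \<in> T" "b \<in> Basis" for y b using T1[OF that] by simp
      ultimately show "RL f g" unfolding RL_def by simp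
    qed (use bd in auto)
    have "splits F (K2 * (1 / sqrt 2 ^ fst j) / r (fst j) ^ DIM('a)) (RW j)" if j: "j \<in> Ch" for j
    proof -
      obtain i k \<sigma> where jj: "j = (i, k, \<sigma>)" by (metis prod.exhaust)
      have "i \<in> {1..J}" "k \<in> Basis" "\<sigma> = 1 \<or> \<sigma> = -1" using j unfolding Ch_def jj by auto
      then show ?thesis unfolding RW_def jj prod.case fst_conv
        by (intro wall) (use bd T1 r in auto)
    qed
    then have spW: "splits F (\<Sum>j\<in>Ch. K2 * (1 / sqrt 2 ^ fst j) / r (fst j) ^ DIM('a)) (\<lambda>f g. \<forall>j\<in>Ch. RW j f g)"
      by (intro splits_Ball finCh)
    have ent: "K1 / \<rho> ^ DIM('a) + (\<Sum>j\<in>Ch. K2 * (1 / sqrt 2 ^ fst j) / r (fst j) ^ DIM('a))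
       \<le> C * (1 / \<rho> ^ DIM('a) + (\<Sum>i\<in>{1..J}. 1 / sqrt 2 ^ i / r i ^ DIM('a)))"
    proof -
      have "(\<Sum>j\<in>Ch. K2 * (1 / sqrt 2 ^ fst j) / r (fst j) ^ DIM('a))
         = (\<Sum>i\<in>{1..J}. \<Sum>k\<in>(Basis :: 'a set) \<times> {1, -1 :: real}. K2 * (1 / sqrt 2 ^ i) / r i ^ DIM('a))"
        unfolding Ch_def by (simp add: sum.cartesian_product' case_prod_beta' sum.cartesian_product)
      also have "\<dots> = (\<Sum>i\<in>{1..J}. (2 * real DIM('a) * K2) * (1 / sqrt 2 ^ i / r i ^ DIM('a)))"
        by (intro sum.cong) (auto simp: card_cartesian_product)
      also have "\<dots> = (2 * real DIM('a) * K2) * (\<Sum>i\<in>{1..J}. 1 / sqrt 2 ^ i / r i ^ DIM('a))"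
        by (rule sum_distrib_left[symmetric])
      also have "\<dots> \<le> C * (\<Sum>i\<in>{1..J}. 1 / sqrt 2 ^ i / r i ^ DIM('a))"
        using r by (intro mult_right_mono C sum_nonneg) (auto simp: less_imp_le)
      finally have 1: "(\<Sum>j\<in>Ch. K2 * (1 / sqrt 2 ^ fst j) / r (fst j) ^ DIM('a)) \<le> C * (\<Sum>i\<in>{1..J}. 1 / sqrt 2 ^ i / r i ^ DIM('a))" .
      have "K1 * (1 / \<rho> ^ DIM('a)) \<le> C * (1 / \<rho> ^ DIM('a))" using \<rho> by (intro mult_right_mono C) auto
      then show ?thesis using 1 by (simp add: distrib_left)
    qed
    define Bd where "Bd = C * (\<rho> ^ 4 + 1 / 2 ^ J + (\<Sum>i\<in>{1..J}. r i ^ 4 * 2 ^ i))"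
    have dom: "dominated (interior \<Omega>) Bd f g"
      if fg: "f \<in> F" "g \<in> F" and L: "RL f g" "RL g f" and W: "\<forall>j\<in>Ch. RW j f g" "\<forall>j\<in>Ch. RW j g f" for f g
    proof -
      let ?lay = "\<lambda>i. body_layer \<Omega> c (\<tau> i)"
      define B where "B x = ennreal (\<Gamma>\<^sup>2 * (K1 * \<rho>\<^sup>2)\<^sup>2) * indicator \<Omega> x
        + (\<Sum>i\<in>{1..J}. ennreal (\<Gamma>\<^sup>2 * (K2 * (r i)\<^sup>2 * 2 ^ i)\<^sup>2) * indicator (?lay i) x)
        + ennreal (\<Gamma>\<^sup>2 * 4) * indicator (?lay J) x" for x
      have \<Omega>m [measurable]: "\<Omega> \<in> sets borel" using cO by (simp add: compact_imp_closed)
      note layer_m [measurable]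
      have Bm: "B \<in> borel_measurable borel" unfolding B_def[abs_def] by measurable
      have key: "\<phi> f y - \<phi> g y \<le> K1 * \<rho>\<^sup>2 \<or> (\<exists>i\<in>{1..J}. \<phi> f y - \<phi> g y \<le> K2 * (r i)\<^sup>2 * 2 ^ i \<and> x \<in> ?lay i) \<or> x \<in> ?lay J"
        if fg: "f \<in> F" "g \<in> F" "RL f g" "\<forall>j\<in>Ch. RW j f g" and x: "x \<in> interior \<Omega>" "y = (1 / R) *\<^sub>R x" for f g x y
      proof -
        have x\<Omega>: "x \<in> \<Omega>" using x interior_subset by blast
        have yT: "y \<in> T" unfolding TO x(2) using x\<Omega> by blast
        obtain q where q: "subgradient f \<Omega> x q"
          using subgradient_exists[of \<Omega> f x] fg(1) x(1) by (auto simp: F_def bounded_convex_def)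
        define p where "p = (R / \<Gamma>) *\<^sub>R q"
        have p: "subgradient (\<phi> f) T y p"
          unfolding subgradient_def
        proof
          fix y' assume "y' \<in> T"
          then have "f x + q \<bullet> (R *\<^sub>R y' - x) \<le> f (R *\<^sub>R y')" using q by (simp add: T_def subgradient_def)
          then have "(f x + q \<bullet> (R *\<^sub>R y' - x)) / \<Gamma> \<le> f (R *\<^sub>R y') / \<Gamma>" using \<Gamma> by (intro divide_right_mono) auto
          moreover have "p \<bullet> (y' - y) = (q \<bullet> (R *\<^sub>R y' - x)) / \<Gamma>"
            using R(1) by (simp add: p_def x(2) inner_diff_right right_diff_distrib diff_divide_distrib)
          moreover have "R *\<^sub>R y = x" using R(1) by (simp add: x(2))
          ultimately show "\<phi> f y + p \<bullet> (y' - y) \<le> \<phi> f y'" by (simp add: \<phi>_def add_divide_distrib)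
        qed
        show ?thesis
        proof (cases "\<forall>b\<in>Basis. \<bar>p \<bullet> b\<bar> \<le> 1")
          case True
          then show ?thesis using fg(3) yT p unfolding RL_def by blast
        next
          case False
          then obtain b1 where b1: "b1 \<in> Basis" "1 < \<bar>p \<bullet> b1\<bar>" by (auto simp: not_le)
          \<comment> \<open>The coordinate with the largest absolute slope is dominant: dividing by
            it keeps all other slopes of the wall chart at most 1.\<close>
          have "Max ((\<lambda>b. \<bar>p \<bullet> b\<bar>) ` (Basis :: 'a set)) \<in> (\<lambda>b. \<bar>p \<bullet> b\<bar>) ` Basis" by (intro Max_in) auto
          then obtain k where "Max ((\<lambda>b. \<bar>p \<bullet> b\<bar>) ` (Basis :: 'a set)) = \<bar>p \<bullet> k\<bar>" "k \<in> Basis" by (rule imageE)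
          then have k: "k \<in> Basis" "\<bar>p \<bullet> k\<bar> = Max ((\<lambda>b. \<bar>p \<bullet> b\<bar>) ` (Basis :: 'a set))" by simp_all
          have kmax: "\<bar>p \<bullet> b\<bar> \<le> \<bar>p \<bullet> k\<bar>" if "b \<in> Basis" for b unfolding k(2) using that by simp
          have A1: "1 < \<bar>p \<bullet> k\<bar>" using b1 kmax[OF b1(1)] by linarith
          define \<sigma> :: real where "\<sigma> = (if p \<bullet> k \<ge> 0 then 1 else -1)"
          have \<sigma>: "\<sigma> * (p \<bullet> k) = \<bar>p \<bullet> k\<bar>" "\<sigma> \<in> {1, -1}" by (auto simp: \<sigma>_def)
          show ?thesis
          proof (cases "\<bar>p \<bullet> k\<bar> \<le> 2 ^ J")
            case True
            define i where "i = (LEAST i. \<bar>p \<bullet> k\<bar> \<le> 2 ^ i)"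
            have i1: "\<bar>p \<bullet> k\<bar> \<le> 2 ^ i" unfolding i_def by (rule LeastI[of "\<lambda>i. \<bar>p \<bullet> k\<bar> \<le> 2 ^ i", OF True])
            have i2: "i \<le> J" unfolding i_def by (rule Least_le[of "\<lambda>i. \<bar>p \<bullet> k\<bar> \<le> 2 ^ i", OF True])
            have i3: "i \<noteq> 0"
            proof
              assume "i = 0" then show False using i1 A1 by simp
            qed
            then obtain i' where i': "i = Suc i'" by (metis not0_implies_Suc)
            have "\<not> \<bar>p \<bullet> k\<bar> \<le> 2 ^ i'" by (rule not_less_Least) (use i' i_def in simp)
            then have i4: "2 ^ i < 2 * \<bar>p \<bullet> k\<bar>" unfolding i' by simp
            have iJ: "i \<in> {1..J}" using i2 i3 by simp
            have "(i, k, \<sigma>) \<in> Ch" unfolding Ch_def using iJ k(1) \<sigma>(2) by blast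
            from bspec[OF fg(4) this] have "\<phi> f y - \<phi> g y \<le> K2 * (r i)\<^sup>2 * 2 ^ i"
              unfolding RW_def prod.case using yT p \<sigma>(1) kmax i1 i4 by simp
            moreover have "x \<in> ?lay i"
              using in_layer[OF fg(1) x\<Omega> _ k(1) i4] p unfolding x(2) by blast
            ultimately show ?thesis using iJ by blast
          next
            case False
            then have "2 ^ J < \<bar>p \<bullet> k\<bar>" by simp
            then have "2 ^ J < 2 * \<bar>p \<bullet> k\<bar>" by linarith
            then show ?thesis using in_layer[OF fg(1) x\<Omega> _ k(1)] p unfolding x(2) by blast
          qed
        qed
      qed
      have pt: "ennreal ((f x - g x)\<^sup>2) \<le> B x" if x: "x \<in> interior \<Omega>" for x
      proof -
        define y where "y = (1 / R) *\<^sub>R x"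
        have x\<Omega>: "x \<in> \<Omega>" using x interior_subset by blast
        have yT: "y \<in> T" unfolding TO y_def using x\<Omega> by blast
        define D where "D = \<bar>\<phi> f y - \<phi> g y\<bar>"
        have Ry: "R *\<^sub>R y = x" using R(1) by (simp add: y_def)
        have fx: "(f x - g x)\<^sup>2 = \<Gamma>\<^sup>2 * D\<^sup>2"
          unfolding D_def \<phi>_def Ry using \<Gamma> by (simp add: diff_divide_distrib[symmetric] power_divide)
        have D2: "D \<le> 2" "0 \<le> D" using bd[OF fg(1) yT] bd[OF fg(2) yT] unfolding D_def by linarith+
        have sq: "ennreal ((f x - g x)\<^sup>2) \<le> ennreal (\<Gamma>\<^sup>2 * d\<^sup>2)" if "D \<le> d" for d
          unfolding fx using that D2 by (intro ennreal_leI mult_left_mono power_mono) auto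
        have "D \<le> K1 * \<rho>\<^sup>2 \<or> (\<exists>i\<in>{1..J}. D \<le> K2 * (r i)\<^sup>2 * 2 ^ i \<and> x \<in> ?lay i) \<or> x \<in> ?lay J"
        proof (cases "\<phi> f y \<ge> \<phi> g y")
          case True
          then have "D = \<phi> f y - \<phi> g y" unfolding D_def by simp
          then show ?thesis using key[OF fg L(1) W(1) x y_def] by simp
        next
          case False
          then have "D = \<phi> g y - \<phi> f y" unfolding D_def by simp
          then show ?thesis using key[OF fg(2,1) L(2) W(2) x y_def] by simp
        qed
        then consider "D \<le> K1 * \<rho>\<^sup>2" | i where "i \<in> {1..J}" "D \<le> K2 * (r i)\<^sup>2 * 2 ^ i" "x \<in> ?lay i" | "x \<in> ?lay J"
          by blast
        then show ?thesis
        proof cases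
          case 1
          have "ennreal ((f x - g x)\<^sup>2) \<le> ennreal (\<Gamma>\<^sup>2 * (K1 * \<rho>\<^sup>2)\<^sup>2) * indicator \<Omega> x"
            using sq[OF 1] x\<Omega> by simp
          also have "\<dots> \<le> B x" unfolding B_def by (simp add: add.assoc)
          finally show ?thesis .
        next
          case (2 i)
          have "ennreal ((f x - g x)\<^sup>2) \<le> ennreal (\<Gamma>\<^sup>2 * (K2 * (r i)\<^sup>2 * 2 ^ i)\<^sup>2) * indicator (?lay i) x"
            using sq[OF 2(2)] 2(3) by simp
          also have "\<dots> \<le> (\<Sum>i\<in>{1..J}. ennreal (\<Gamma>\<^sup>2 * (K2 * (r i)\<^sup>2 * 2 ^ i)\<^sup>2) * indicator (?lay i) x)"
            by (rule member_le_sum[OF 2(1)]) auto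
          also have "\<dots> \<le> B x" unfolding B_def by (intro add_increasing2 add_increasing) auto
          finally show ?thesis .
        next
          case 3
          have "ennreal ((f x - g x)\<^sup>2) \<le> ennreal (\<Gamma>\<^sup>2 * 4) * indicator (?lay J) x"
            using sq[OF D2(1)] 3 by simp
          also have "\<dots> \<le> B x" unfolding B_def by simp
          finally show ?thesis .
        qed
      qed
      have e\<Omega>: "emeasure lborel \<Omega> = ennreal (vol \<Omega>)"
        using emeasure_compact_finite[OF cO(1)] by (simp add: emeasure_eq_ennreal_measure)
      have "(\<integral>\<^sup>+x. B x \<partial>lborel) = ennreal (\<Gamma>\<^sup>2 * (K1 * \<rho>\<^sup>2)\<^sup>2) * emeasure lborel \<Omega>
        + (\<Sum>i\<in>{1..J}. ennreal (\<Gamma>\<^sup>2 * (K2 * (r i)\<^sup>2 * 2 ^ i)\<^sup>2) * emeasure lborel (?lay i))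
        + ennreal (\<Gamma>\<^sup>2 * 4) * emeasure lborel (?lay J)"
      proof -
        have "(\<integral>\<^sup>+x. B x \<partial>lborel) = (\<integral>\<^sup>+x. ennreal (\<Gamma>\<^sup>2 * (K1 * \<rho>\<^sup>2)\<^sup>2) * indicator \<Omega> x
          + (\<Sum>i\<in>{1..J}. ennreal (\<Gamma>\<^sup>2 * (K2 * (r i)\<^sup>2 * 2 ^ i)\<^sup>2) * indicator (?lay i) x) \<partial>lborel)
          + (\<integral>\<^sup>+x. ennreal (\<Gamma>\<^sup>2 * 4) * indicator (?lay J) x \<partial>lborel)"
          unfolding B_def by (rule nn_integral_add) measurable
        also have "(\<integral>\<^sup>+x. ennreal (\<Gamma>\<^sup>2 * (K1 * \<rho>\<^sup>2)\<^sup>2) * indicator \<Omega> x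
          + (\<Sum>i\<in>{1..J}. ennreal (\<Gamma>\<^sup>2 * (K2 * (r i)\<^sup>2 * 2 ^ i)\<^sup>2) * indicator (?lay i) x) \<partial>lborel)
          = (\<integral>\<^sup>+x. ennreal (\<Gamma>\<^sup>2 * (K1 * \<rho>\<^sup>2)\<^sup>2) * indicator \<Omega> x \<partial>lborel)
          + (\<integral>\<^sup>+x. (\<Sum>i\<in>{1..J}. ennreal (\<Gamma>\<^sup>2 * (K2 * (r i)\<^sup>2 * 2 ^ i)\<^sup>2) * indicator (?lay i) x) \<partial>lborel)"
          by (rule nn_integral_add) measurable
        also have "(\<integral>\<^sup>+x. (\<Sum>i\<in>{1..J}. ennreal (\<Gamma>\<^sup>2 * (K2 * (r i)\<^sup>2 * 2 ^ i)\<^sup>2) * indicator (?lay i) x) \<partial>lborel)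
          = (\<Sum>i\<in>{1..J}. ennreal (\<Gamma>\<^sup>2 * (K2 * (r i)\<^sup>2 * 2 ^ i)\<^sup>2) * emeasure lborel (?lay i))"
          by (subst nn_integral_sum) (auto intro!: sum.cong nn_integral_cmult_indicator)
        also have "(\<integral>\<^sup>+x. ennreal (\<Gamma>\<^sup>2 * (K1 * \<rho>\<^sup>2)\<^sup>2) * indicator \<Omega> x \<partial>lborel) = ennreal (\<Gamma>\<^sup>2 * (K1 * \<rho>\<^sup>2)\<^sup>2) * emeasure lborel \<Omega>"
          by (rule nn_integral_cmult_indicator) simp
        also have "(\<integral>\<^sup>+x. ennreal (\<Gamma>\<^sup>2 * 4) * indicator (?lay J) x \<partial>lborel) = ennreal (\<Gamma>\<^sup>2 * 4) * emeasure lborel (?lay J)"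
          by (rule nn_integral_cmult_indicator) simp
        finally show ?thesis .
      qed
      also have "\<dots> \<le> ennreal (\<Gamma>\<^sup>2 * (K1 * \<rho>\<^sup>2)\<^sup>2) * ennreal (vol \<Omega>)
        + (\<Sum>i\<in>{1..J}. ennreal (\<Gamma>\<^sup>2 * (K2 * (r i)\<^sup>2 * 2 ^ i)\<^sup>2) * ennreal (V / 2 ^ i))
        + ennreal (\<Gamma>\<^sup>2 * 4) * ennreal (V / 2 ^ J)"
        unfolding e\<Omega> by (intro add_mono sum_mono mult_left_mono layer_e order_refl) auto
      also have "\<dots> = ennreal (\<Gamma>\<^sup>2 * (K1 * \<rho>\<^sup>2)\<^sup>2 * vol \<Omega>
        + (\<Sum>i\<in>{1..J}. \<Gamma>\<^sup>2 * (K2 * (r i)\<^sup>2 * 2 ^ i)\<^sup>2 * (V / 2 ^ i)) + \<Gamma>\<^sup>2 * 4 * (V / 2 ^ J))"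
      proof -
        have s: "(\<Sum>i\<in>{1..J}. ennreal (\<Gamma>\<^sup>2 * (K2 * (r i)\<^sup>2 * 2 ^ i)\<^sup>2) * ennreal (V / 2 ^ i))
          = ennreal (\<Sum>i\<in>{1..J}. \<Gamma>\<^sup>2 * (K2 * (r i)\<^sup>2 * 2 ^ i)\<^sup>2 * (V / 2 ^ i))"
          by (rule sum_ennreal_mult) (use V in auto)
        have nn: "0 \<le> (\<Sum>i\<in>{1..J}. \<Gamma>\<^sup>2 * (K2 * (r i)\<^sup>2 * 2 ^ i)\<^sup>2 * (V / 2 ^ i))" "0 \<le> \<Gamma>\<^sup>2 * (K1 * \<rho>\<^sup>2)\<^sup>2 * vol \<Omega>" "0 \<le> \<Gamma>\<^sup>2 * 4 * (V / 2 ^ J)"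
          using V by (auto intro!: sum_nonneg)
        have m: "ennreal a * ennreal b = ennreal (a * b)" if "0 \<le> a" "0 \<le> b" for a b
          using that by (simp add: ennreal_mult)
        show ?thesis unfolding s ennreal_plus[OF add_nonneg_nonneg[OF nn(2,1)] nn(3)] ennreal_plus[OF nn(2,1)]
          using V by (subst (1 2) m) auto
      qed
      also have "\<dots> \<le> ennreal Bd"
      proof (rule ennreal_leI)
        have a1: "\<Gamma>\<^sup>2 * (K1 * \<rho>\<^sup>2)\<^sup>2 * vol \<Omega> \<le> C * \<rho> ^ 4"
        proof -
          have "\<Gamma>\<^sup>2 * (K1 * \<rho>\<^sup>2)\<^sup>2 * vol \<Omega> = (\<Gamma>\<^sup>2 * K1\<^sup>2 * vol \<Omega>) * \<rho> ^ 4"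
            by (simp add: power_mult_distrib power_mult[symmetric])
          also have "\<dots> \<le> C * \<rho> ^ 4" using C1(2) C(4) by (intro mult_right_mono) auto
          finally show ?thesis .
        qed
        have a2: "\<Gamma>\<^sup>2 * 4 * (V / 2 ^ J) \<le> C * (1 / 2 ^ J)"
        proof -
          have "\<Gamma>\<^sup>2 * 4 * (V / 2 ^ J) = (\<Gamma>\<^sup>2 * 4 * V) * (1 / 2 ^ J)" by simp
          also have "\<dots> \<le> C * (1 / 2 ^ J)" using C1(4) C(4) by (intro mult_right_mono) auto
          finally show ?thesis .
        qed
        have a3: "(\<Sum>i\<in>{1..J}. \<Gamma>\<^sup>2 * (K2 * (r i)\<^sup>2 * 2 ^ i)\<^sup>2 * (V / 2 ^ i)) \<le> C * (\<Sum>i\<in>{1..J}. r i ^ 4 * 2 ^ i)"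
          unfolding sum_distrib_left
        proof (rule sum_mono)
          fix i
          have "\<Gamma>\<^sup>2 * (K2 * (r i)\<^sup>2 * 2 ^ i)\<^sup>2 * (V / 2 ^ i) = (\<Gamma>\<^sup>2 * K2\<^sup>2 * V) * (r i ^ 4 * 2 ^ i)"
          proof -
            have "(K2 * (r i)\<^sup>2 * 2 ^ i)\<^sup>2 = K2\<^sup>2 * r i ^ 4 * (2 ^ i * 2 ^ i)"
            proof -
              have "((r i)\<^sup>2)\<^sup>2 = r i ^ 4" "(2 ^ i)\<^sup>2 = (2::real) ^ i * 2 ^ i"
                by (simp flip: power_mult, rule power2_eq_square)
              then show ?thesis by (simp only: power_mult_distrib)
            qed
            then show ?thesis by simp
          qed
          also have "\<dots> \<le> C * (r i ^ 4 * 2 ^ i)" using C1(3) C(4) by (intro mult_right_mono) auto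
          finally show "\<Gamma>\<^sup>2 * (K2 * (r i)\<^sup>2 * 2 ^ i)\<^sup>2 * (V / 2 ^ i) \<le> C * (r i ^ 4 * 2 ^ i)" .
        qed
        show "\<Gamma>\<^sup>2 * (K1 * \<rho>\<^sup>2)\<^sup>2 * vol \<Omega>
        + (\<Sum>i\<in>{1..J}. \<Gamma>\<^sup>2 * (K2 * (r i)\<^sup>2 * 2 ^ i)\<^sup>2 * (V / 2 ^ i)) + \<Gamma>\<^sup>2 * 4 * (V / 2 ^ J) \<le> Bd"
          using a1 a2 a3 unfolding Bd_def distrib_left by linarith
      qed
      finally show ?thesis unfolding dominated_def using Bm pt by (intro bexI[of _ B]) auto
    qed
    have "splits F (C * (1 / \<rho> ^ DIM('a) + (\<Sum>i\<in>{1..J}. 1 / sqrt 2 ^ i / r i ^ DIM('a)))) (dominated (interior \<Omega>) Bd)"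
    proof (rule splits_mono[OF splits_sym[OF splits_conj[OF spL spW]] ent])
      fix f g assume "f \<in> F" "g \<in> F" "(RL f g \<and> (\<forall>j\<in>Ch. RW j f g)) \<and> (RL g f \<and> (\<forall>j\<in>Ch. RW j g f))"
      then show "dominated (interior \<Omega>) Bd f g" by (intro dom) auto
    qed
    then show "splits (bounded_convex \<Omega> \<Gamma>) (C * (1 / \<rho> ^ DIM('a) + (\<Sum>i\<in>{1..J}. 1 / sqrt 2 ^ i / r i ^ DIM('a))))
      (dominated (interior \<Omega>) (C * (\<rho> ^ 4 + 1 / 2 ^ J + (\<Sum>i\<in>{1..J}. r i ^ 4 * 2 ^ i))))"
      unfolding F_def Bd_def .
  qed
qed

section \<open>Rates of convergence\<close>

lemma design_law_support:
  fixes \<Omega> :: "'a::euclidean_space set"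
  assumes \<Omega>: "convex_body \<Omega>" and dl: "design_law \<Omega> \<nu> p"
  shows "x \<in> \<Omega> \<longleftrightarrow> (\<forall>U. open U \<longrightarrow> x \<in> U \<longrightarrow> emeasure \<nu> U \<noteq> 0)"
proof
  assume x: "x \<in> \<Omega>"
  have cO: "compact \<Omega>" "convex \<Omega>" "interior \<Omega> \<noteq> {}" using \<Omega> by (auto simp: convex_body_def)
  have [measurable]: "\<Omega> \<in> sets borel" "p \<in> borel_measurable borel" using cO dl by (auto simp: compact_imp_closed design_law_def)
  have nu: "\<nu> = density lborel (\<lambda>x. p x * indicator \<Omega> x)" and pos: "density_inf \<Omega> p > 0" using dl by (auto simp: design_law_def)
  show "\<forall>U. open U \<longrightarrow> x \<in> U \<longrightarrow> emeasure \<nu> U \<noteq> 0"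
  proof (intro allI impI notI)
    fix U assume U: "open U" "x \<in> U" and z: "emeasure \<nu> U = 0"
    have [measurable]: "U \<in> sets borel" using U by simp
    have "AE y in \<nu>. y \<notin> U" using z by (intro AE_not_in) (auto simp: nu null_sets_def)
    then have "AE y in lborel. 0 < p y * indicator \<Omega> y \<longrightarrow> y \<notin> U"
      unfolding nu by (subst (asm) AE_density) auto
    \<comment> \<open>Here the positive infimum of the density enters: a \<nu>-null open set cannot
      meet the interior, while a convex body lies in the closure of its interior.\<close>
    moreover have "0 < p y * indicator \<Omega> y" if "y \<in> interior \<Omega>" for y
    proof -
      have y: "y \<in> \<Omega>" using that interior_subset by blast
      then have "density_inf \<Omega> p \<le> p y" unfolding density_inf_def by (rule INF_lower)
      then show ?thesis using pos y by (simp add: less_le_trans)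
    qed
    ultimately have "AE y in lborel. y \<notin> U \<inter> interior \<Omega>" by (auto elim: eventually_mono)
    then have "U \<inter> interior \<Omega> \<in> null_sets lborel" by (subst AE_iff_null_sets) auto
    then have "negligible (U \<inter> interior \<Omega>)" by (simp add: negligible_iff_null_sets null_sets_completionI)
    moreover have "open (U \<inter> interior \<Omega>)" using U by auto
    moreover have "U \<inter> interior \<Omega> \<noteq> {}"
    proof -
      have "x \<in> closure (interior \<Omega>)" using x convex_closure_interior[OF cO(2,3)] closure_subset by blast
      then show ?thesis using open_Int_closure_eq_empty[OF U(1), of "interior \<Omega>"] U(2) by blast
    qed
    ultimately show False using open_not_negligible by blast
  qed
next
  assume h: "\<forall>U. open U \<longrightarrow> x \<in> U \<longrightarrow> emeasure \<nu> U \<noteq> 0"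
  have cl: "closed \<Omega>" using \<Omega> by (auto simp: convex_body_def compact_imp_closed)
  have "emeasure \<nu> (- \<Omega>) = 0"
  proof -
    have "AE y in \<nu>. y \<notin> - \<Omega>" using AE_in_design[OF \<Omega> dl] by simp
    moreover have "space \<nu> = UNIV" using sets_eq_imp_space_eq[OF sets_design[OF dl]] by simp
    moreover have "- \<Omega> \<in> sets \<nu>" using cl by (simp add: sets_design[OF dl])
    ultimately show ?thesis by (subst (asm) AE_iff_measurable[of "- \<Omega>"]) auto
  qed
  then show "x \<in> \<Omega>" using h cl by (metis ComplI open_Compl)
qed

text \<open>Both bodies are the topological support of \<open>\<nu>\<close>. Hence a constant built
  from the body, such as one involving its inner and outer radii, is a function of
  \<open>\<nu>\<close>.\<close>

lemma design_law_body_unique: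
  assumes "convex_body \<Omega>" "design_law \<Omega> \<nu> p" "convex_body \<Omega>'" "design_law \<Omega>' \<nu> p'"
  shows "\<Omega> = \<Omega>'"
  using design_law_support[OF assms(1,2)] design_law_support[OF assms(3,4)] by blast

section \<open>Choice of scales\<close>

lemma sum_powr_geometric_le:
  assumes "0 < \<alpha>0" "\<alpha>0 \<le> \<alpha>"
  shows "(\<Sum>i\<in>{1..J}. 2 powr (\<alpha> * real i)) \<le> 2 powr (\<alpha> * real J) / (1 - 2 powr (- \<alpha>0))"
proof -
  define s :: real where "s = 2 powr (- \<alpha>)"
  have s: "0 < s" "s < 1" using assms by (auto simp: s_def powr_less_one)
  have "(\<Sum>i\<in>{1..J}. 2 powr (\<alpha> * real i)) \<le> (\<Sum>i\<in>{0..J}. 2 powr (\<alpha> * real i))"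
    by (intro sum_mono2) auto
  also have "\<dots> = (\<Sum>i\<in>{0..J}. 2 powr (\<alpha> * real (J - i)))" by (subst sum.atLeastAtMost_rev) simp
  also have "\<dots> = (\<Sum>i\<le>J. 2 powr (\<alpha> * real J) * s ^ i)"
  proof (intro sum.cong)
    fix i assume "i \<in> {..J}"
    then have "\<alpha> * real (J - i) = \<alpha> * real J + (- \<alpha>) * real i" by (simp add: of_nat_diff algebra_simps)
    then show "2 powr (\<alpha> * real (J - i)) = 2 powr (\<alpha> * real J) * s ^ i"
      by (simp only: powr_add s_def powr_power) (simp add: mult.commute)
  qed auto
  also have "\<dots> = 2 powr (\<alpha> * real J) * (\<Sum>i\<le>J. s ^ i)" by (rule sum_distrib_left[symmetric])
  also have "\<dots> \<le> 2 powr (\<alpha> * real J) * (1 / (1 - s))" using s by (intro mult_left_mono sum_geometric_le) auto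
  also have "\<dots> \<le> 2 powr (\<alpha> * real J) * (1 / (1 - 2 powr (- \<alpha>0)))"
  proof (intro mult_left_mono divide_left_mono)
    have "2 powr (- \<alpha>0) < (1::real)" using assms by (simp add: powr_less_one)
    then show "0 < (1 - s) * (1 - 2 powr (- \<alpha>0))" using s by simp
    show "1 - 2 powr (- \<alpha>0) \<le> 1 - s" using assms by (simp add: s_def)
  qed auto
  finally show ?thesis by simp
qed

lemma dyadic_floor:
  fixes Y :: real
  assumes "1 \<le> Y"
  obtains J :: nat where "2 powr real J \<le> Y" "Y \<le> 2 * 2 powr real J"
proof -
  define J where "J = nat \<lfloor>log 2 Y\<rfloor>"
  have l: "0 \<le> log 2 Y" using assms by simp
  have J: "real J \<le> log 2 Y" "log 2 Y \<le> real J + 1" using l unfolding J_def by linarith+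
  have "2 powr real J \<le> 2 powr (log 2 Y)" using J(1) by (intro powr_mono) auto
  moreover have "2 powr (log 2 Y) \<le> 2 powr (real J + 1)" using J(2) by (intro powr_mono) auto
  ultimately show ?thesis using assms by (intro that[of J]) (auto simp: powr_add)
qed

lemma sqrt2_powr: "1 / sqrt 2 ^ i = 2 powr (- (real i / 2))"
  by (simp add: powr_half_sqrt[symmetric] powr_power powr_minus_divide)

text \<open>The constant is uniform in the scales, the sample size and the error law, so the scales
  may be tuned to \<open>n\<close> afterwards.\<close>

lemma minimax_risk_body_scales:
  fixes \<Omega> :: "'a::euclidean_space set"
  assumes \<Omega>: "convex_body \<Omega>" and dim: "DIM('a) \<ge> 2" and \<Gamma>: "0 < \<Gamma>" and dl: "design_law \<Omega> \<nu> p"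
  shows "\<exists>C>0. \<forall>J (\<rho> :: real) (r :: nat \<Rightarrow> real) n Q. 0 < \<rho> \<longrightarrow> (\<forall>i\<in>{1..J}. 0 < r i \<and> r i \<le> 1 / sqrt 2 ^ i) \<longrightarrow> n \<ge> 1 \<longrightarrow> subgaussian_errors n \<sigma> Q \<longrightarrow>
    minimax_risk \<Omega> \<nu> Q n (bounded_convex \<Omega> \<Gamma>) \<le>
      ennreal (C * ((\<rho> ^ 4 + 1 / 2 ^ J + (\<Sum>i\<in>{1..J}. r i ^ 4 * 2 ^ i))
        + (1 / \<rho> ^ DIM('a) + (\<Sum>i\<in>{1..J}. 1 / sqrt 2 ^ i / r i ^ DIM('a))) / real n))"
proof -
  obtain C where C: "0 < C" and sp: "\<And>J (\<rho> :: real) (r :: nat \<Rightarrow> real). 0 < \<rho> \<Longrightarrow> (\<forall>i\<in>{1..J}. 0 < r i \<and> r i \<le> 1 / sqrt 2 ^ i) \<Longrightarrow>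
    splits (bounded_convex \<Omega> \<Gamma>) (C * (1 / \<rho> ^ DIM('a) + (\<Sum>i\<in>{1..J}. 1 / sqrt 2 ^ i / r i ^ DIM('a))))
      (dominated (interior \<Omega>) (C * (\<rho> ^ 4 + 1 / 2 ^ J + (\<Sum>i\<in>{1..J}. r i ^ 4 * 2 ^ i))))"
    using splits_convex_body[OF \<Omega> dim \<Gamma>] by blast
  define b where "b = enn2real (density_sup \<Omega> p)"
  have b0: "b \<ge> 0" by (simp add: b_def)
  define K where "K = 1 + 4 * b * C + 16 * (\<sigma>\<^sup>2 + \<Gamma>\<^sup>2) * C"
  have K: "0 < K" "4 * b * C \<le> K" "16 * (\<sigma>\<^sup>2 + \<Gamma>\<^sup>2) * C \<le> K"
    unfolding K_def using b0 C by (auto intro!: add_pos_nonneg)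
  have neg: "negligible (\<Omega> - interior \<Omega>)"
    using \<Omega> by (intro negligible_subset[OF negligible_convex_frontier[of \<Omega>]])
      (auto simp: convex_body_def frontier_def closure_subset[THEN subsetD])
  show ?thesis
  proof (intro exI[of _ K] conjI allI impI K(1))
    fix J and \<rho> :: real and r :: "nat \<Rightarrow> real" and n Q
    assume \<rho>: "0 < \<rho>" and r: "\<forall>i\<in>{1..J}. 0 < r i \<and> r i \<le> 1 / sqrt 2 ^ i"
      and n: "n \<ge> 1" and err: "subgaussian_errors n \<sigma> Q"
    define e where "e = \<rho> ^ 4 + 1 / 2 ^ J + (\<Sum>i\<in>{1..J}. r i ^ 4 * 2 ^ i)"
    define E where "E = 1 / \<rho> ^ DIM('a) + (\<Sum>i\<in>{1..J}. 1 / sqrt 2 ^ i / r i ^ DIM('a))"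
    have e0: "0 \<le> e" "0 \<le> E" unfolding e_def E_def using \<rho> r
      by (auto intro!: add_nonneg_nonneg sum_nonneg divide_nonneg_nonneg simp: less_imp_le)
    then have Ce0: "0 \<le> C * e" using C by simp
    have "splits (bounded_convex \<Omega> \<Gamma>) (C * E) (\<lambda>f g. sq_loss \<Omega> \<nu> f g \<le> ennreal (b * (C * e)))"
      unfolding E_def
    proof (rule splits_mono[OF sp[OF \<rho> r] order_refl])
      fix f g assume "dominated (interior \<Omega>) (C * (\<rho> ^ 4 + 1 / 2 ^ J + (\<Sum>i\<in>{1..J}. r i ^ 4 * 2 ^ i))) f g"
      then have "dominated (interior \<Omega>) (C * e) f g" unfolding e_def .
      then show "sq_loss \<Omega> \<nu> f g \<le> ennreal (b * (C * e))"
        unfolding b_def by (rule sq_loss_le_dominated[OF \<Omega> dl neg _ Ce0])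
    qed
    then have "minimax_risk \<Omega> \<nu> Q n (bounded_convex \<Omega> \<Gamma>) \<le> ennreal (4 * (b * (C * e)) + 16 * (\<sigma>\<^sup>2 + \<Gamma>\<^sup>2) * (C * E) / real n)"
      by (rule minimax_risk_le_splits[OF \<Omega> dl \<Gamma> n err mult_nonneg_nonneg[OF b0 Ce0]])
    also have "4 * (b * (C * e)) + 16 * (\<sigma>\<^sup>2 + \<Gamma>\<^sup>2) * (C * E) / real n = (4 * b * C) * e + (16 * (\<sigma>\<^sup>2 + \<Gamma>\<^sup>2) * C) * (E / real n)"
      by simp
    also have "ennreal \<dots> \<le> ennreal (K * e + K * (E / real n))"
      using e0 by (intro ennreal_leI add_mono mult_right_mono K) auto
    finally show "minimax_risk \<Omega> \<nu> Q n (bounded_convex \<Omega> \<Gamma>) \<le>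
      ennreal (K * ((\<rho> ^ 4 + 1 / 2 ^ J + (\<Sum>i\<in>{1..J}. r i ^ 4 * 2 ^ i))
        + (1 / \<rho> ^ DIM('a) + (\<Sum>i\<in>{1..J}. 1 / sqrt 2 ^ i / r i ^ DIM('a))) / real n))"
      unfolding e_def E_def distrib_left[of K] .
  qed
qed

text \<open>With 2^J of order n^(2/(d+1)) the truncation error 2^-J and the entropy term
  2^(J(d-1)/2) / n have the same order. The meshes are tuned so that both sums over the layers are
  dominated by the last layer \<open>J\<close>.\<close>

lemma minimax_risk_body_high:
  fixes \<Omega> :: "'a::euclidean_space set"
  assumes \<Omega>: "convex_body \<Omega>" and dim: "DIM('a) \<ge> 3" and \<Gamma>: "0 < \<Gamma>" and dl: "design_law \<Omega> \<nu> p"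
  shows "\<exists>c\<ge>0. \<forall>n Q. n \<ge> 1 \<longrightarrow> subgaussian_errors n \<sigma> Q \<longrightarrow>
    minimax_risk \<Omega> \<nu> Q n (bounded_convex \<Omega> \<Gamma>) \<le> ennreal (c * real n powr (- 2 / (real DIM('a) + 1)))"
proof -
  define d where "d = real DIM('a)"
  have d: "d \<ge> 3" using dim by (simp add: d_def)
  have dim2: "DIM('a) \<ge> 2" using dim by simp
  obtain C where C: "0 < C" and risk: "\<And>J (\<rho> :: real) (r :: nat \<Rightarrow> real) n Q. \<lbrakk>0 < \<rho>; \<forall>i\<in>{1..J}. 0 < r i \<and> r i \<le> 1 / sqrt 2 ^ i; n \<ge> 1; subgaussian_errors n \<sigma> Q\<rbrakk> \<Longrightarrow>
    minimax_risk \<Omega> \<nu> Q n (bounded_convex \<Omega> \<Gamma>) \<le>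
      ennreal (C * ((\<rho> ^ 4 + 1 / 2 ^ J + (\<Sum>i\<in>{1..J}. r i ^ 4 * 2 ^ i))
        + (1 / \<rho> ^ DIM('a) + (\<Sum>i\<in>{1..J}. 1 / sqrt 2 ^ i / r i ^ DIM('a))) / real n))"
    using minimax_risk_body_scales[OF \<Omega> dim2 \<Gamma> dl] by blast
  define c1 where "c1 = 1 / (1 - 2 powr (- (1 / 4 :: real)))"
  \<comment> \<open>1/16 is the value of \<open>3 * d / 16 - 1 / 2\<close> at \<open>d = 3\<close>,
    the smallest growth exponent of the entropies in \<open>i\<close>.\<close>
  define c2 where "c2 = 1 / (1 - 2 powr (- (1 / 16 :: real)))"
  have c12: "c1 > 0" "c2 > 0" unfolding c1_def c2_def by (auto simp: powr_less_one)
  define c where "c = C * (2 * (2 + c1) + (1 + c2))"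
  show ?thesis
  proof (intro exI[of _ c] conjI allI impI)
    show "c \<ge> 0" unfolding c_def using C c12 by (auto intro!: add_nonneg_nonneg mult_nonneg_nonneg)
    fix n Q assume n: "n \<ge> 1" and err: "subgaussian_errors n \<sigma> Q"
    define Y where "Y = real n powr (2 / (d + 1))"
    have Y1: "1 \<le> Y" unfolding Y_def using n d by (intro ge_one_powr_ge_zero) auto
    obtain J :: nat where J: "2 powr real J \<le> Y" "Y \<le> 2 * 2 powr real J" using dyadic_floor[OF Y1] .
    define \<rho> :: real where "\<rho> = 2 powr (- (real J / 4))"
    \<comment> \<open>Equivalently r_i = 2^(-J/2 + a(J - i)) with a = 3/16. The squared errors grow
      with i if a < 1/4, the entropies if a > 1/(2d); 3/16 satisfies both for every d >= 3, and a <=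
      1/2 gives the required bound by \<open>1 / sqrt 2 ^ i\<close>.\<close>
    define r :: "nat \<Rightarrow> real" where "r i = 2 powr (- ((5 * real J + 3 * real i) / 16))" for i
    have \<rho>: "0 < \<rho>" by (simp add: \<rho>_def)
    have r: "\<forall>i\<in>{1..J}. 0 < r i \<and> r i \<le> 1 / sqrt 2 ^ i"
      unfolding sqrt2_powr r_def by (auto intro!: powr_mono)
    let ?e = "\<rho> ^ 4 + 1 / 2 ^ J + (\<Sum>i\<in>{1..J}. r i ^ 4 * 2 ^ i)"
    let ?E = "1 / \<rho> ^ DIM('a) + (\<Sum>i\<in>{1..J}. 1 / sqrt 2 ^ i / r i ^ DIM('a))"
    have e: "?e \<le> (2 + c1) * 2 powr (- real J)"
    proof -
      have "(\<Sum>i\<in>{1..J}. r i ^ 4 * 2 ^ i) = (\<Sum>i\<in>{1..J}. 2 powr (- (5 / 4 * real J)) * 2 powr ((1 / 4) * real i))"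
      proof (intro sum.cong refl)
        fix i
        have "r i ^ 4 * 2 ^ i = 2 powr (- ((5 * real J + 3 * real i) / 16) * 4) * 2 powr real i"
          by (simp add: r_def powr_power powr_realpow)
        also have "\<dots> = 2 powr (- ((5 * real J + 3 * real i) / 16) * 4 + real i)" by (rule powr_add[symmetric])
        also have "- ((5 * real J + 3 * real i) / 16) * 4 + real i = - (5 / 4 * real J) + (1 / 4) * real i" by (simp add: field_simps)
        finally show "r i ^ 4 * 2 ^ i = 2 powr (- (5 / 4 * real J)) * 2 powr ((1 / 4) * real i)" by (simp only: powr_add)
      qed
      also have "\<dots> = 2 powr (- (5 / 4 * real J)) * (\<Sum>i\<in>{1..J}. 2 powr ((1 / 4) * real i))" by (rule sum_distrib_left[symmetric])
      also have "\<dots> \<le> 2 powr (- (5 / 4 * real J)) * (2 powr ((1 / 4) * real J) / (1 - 2 powr (- (1 / 4 :: real))))"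
        by (intro mult_left_mono sum_powr_geometric_le) auto
      also have "\<dots> = (2 powr (- (5 / 4 * real J)) * 2 powr ((1 / 4) * real J)) * c1" by (simp add: c1_def)
      also have "2 powr (- (5 / 4 * real J)) * 2 powr ((1 / 4) * real J) = 2 powr (- real J)" by (simp flip: powr_add)
      finally have s: "(\<Sum>i\<in>{1..J}. r i ^ 4 * 2 ^ i) \<le> 2 powr (- real J) * c1" .
      have "\<rho> ^ 4 = 2 powr (- real J)" by (simp add: \<rho>_def powr_power)
      moreover have "1 / 2 ^ J = (2::real) powr (- real J)" by (simp add: powr_minus_divide powr_realpow)
      ultimately show ?thesis using s by (simp add: algebra_simps)
    qed
    have E: "?E \<le> (1 + c2) * 2 powr (real J * ((d - 1) / 2))"
    proof -
      have "(\<Sum>i\<in>{1..J}. 1 / sqrt 2 ^ i / r i ^ DIM('a)) = (\<Sum>i\<in>{1..J}. 2 powr (5 * d / 16 * real J) * 2 powr ((3 * d / 16 - 1 / 2) * real i))"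
      proof (intro sum.cong refl)
        fix i
        have "1 / sqrt 2 ^ i / r i ^ DIM('a) = 2 powr (- (real i / 2)) / 2 powr (- ((5 * real J + 3 * real i) / 16) * d)"
          unfolding sqrt2_powr by (simp add: r_def powr_power d_def mult.commute)
        also have "\<dots> = 2 powr (- (real i / 2) - (- ((5 * real J + 3 * real i) / 16) * d))" by (rule powr_diff[symmetric])
        also have "- (real i / 2) - (- ((5 * real J + 3 * real i) / 16) * d) = 5 * d / 16 * real J + (3 * d / 16 - 1 / 2) * real i"
          by (simp add: field_simps)
        finally show "1 / sqrt 2 ^ i / r i ^ DIM('a) = 2 powr (5 * d / 16 * real J) * 2 powr ((3 * d / 16 - 1 / 2) * real i)"
          by (simp only: powr_add)
      qed
      also have "\<dots> = 2 powr (5 * d / 16 * real J) * (\<Sum>i\<in>{1..J}. 2 powr ((3 * d / 16 - 1 / 2) * real i))" by (rule sum_distrib_left[symmetric])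
      also have "\<dots> \<le> 2 powr (5 * d / 16 * real J) * (2 powr ((3 * d / 16 - 1 / 2) * real J) / (1 - 2 powr (- (1 / 16 :: real))))"
        using d by (intro mult_left_mono sum_powr_geometric_le) auto
      also have "\<dots> = (2 powr (5 * d / 16 * real J) * 2 powr ((3 * d / 16 - 1 / 2) * real J)) * c2" by (simp add: c2_def)
      also have "2 powr (5 * d / 16 * real J) * 2 powr ((3 * d / 16 - 1 / 2) * real J) = 2 powr (5 * d / 16 * real J + (3 * d / 16 - 1 / 2) * real J)"
        by (rule powr_add[symmetric])
      also have "5 * d / 16 * real J + (3 * d / 16 - 1 / 2) * real J = real J * ((d - 1) / 2)" by (simp add: field_simps)
      finally have s: "(\<Sum>i\<in>{1..J}. 1 / sqrt 2 ^ i / r i ^ DIM('a)) \<le> 2 powr (real J * ((d - 1) / 2)) * c2" .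
      have "1 / \<rho> ^ DIM('a) = 1 / 2 powr (- (real J * (d / 4)))"
        by (simp add: \<rho>_def powr_power d_def mult.commute)
      also have "\<dots> = 2 powr (real J * (d / 4))" by (simp add: powr_minus_divide)
      also have "2 powr (real J * (d / 4)) \<le> 2 powr (real J * ((d - 1) / 2))" using d by (intro powr_mono mult_left_mono) auto
      finally show ?thesis using s by (simp add: algebra_simps)
    qed
    have Yinv: "1 / Y = real n powr (- 2 / (d + 1))" by (simp add: Y_def powr_minus_divide[symmetric])
    have J1: "2 powr (- real J) \<le> 2 * (1 / Y)"
      using J(2) Y1 by (simp add: powr_minus_divide field_simps)
    have J2: "2 powr (real J * ((d - 1) / 2)) / real n \<le> 1 / Y"
    proof -
      have "2 powr (real J * ((d - 1) / 2)) = (2 powr real J) powr ((d - 1) / 2)" by (simp add: powr_powr)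
      also have "\<dots> \<le> Y powr ((d - 1) / 2)" using J(1) d by (intro powr_mono2) auto
      also have "\<dots> = real n powr (2 / (d + 1) * ((d - 1) / 2))" by (simp add: Y_def powr_powr)
      finally have "2 powr (real J * ((d - 1) / 2)) / real n \<le> real n powr (2 / (d + 1) * ((d - 1) / 2)) / real n powr 1"
        using n by (simp add: divide_right_mono)
      also have "\<dots> = real n powr (2 / (d + 1) * ((d - 1) / 2) - 1)" by (rule powr_diff[symmetric])
      also have "2 / (d + 1) * ((d - 1) / 2) - 1 = - 2 / (d + 1)" using d by (simp add: field_simps)
      finally show ?thesis by (simp add: Yinv)
    qed
    have "minimax_risk \<Omega> \<nu> Q n (bounded_convex \<Omega> \<Gamma>) \<le> ennreal (C * (?e + ?E / real n))"
      by (rule risk[OF \<rho> r n err])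
    also have "\<dots> \<le> ennreal (c * (1 / Y))"
    proof (rule ennreal_leI)
      have "(2 + c1) * 2 powr (- real J) \<le> (2 + c1) * (2 * (1 / Y))" using J1 c12 by (intro mult_left_mono) auto
      then have 1: "?e \<le> (2 + c1) * (2 * (1 / Y))" using e by linarith
      have "?E / real n \<le> ((1 + c2) * 2 powr (real J * ((d - 1) / 2))) / real n" using E by (rule divide_right_mono) simp
      also have "\<dots> = (1 + c2) * (2 powr (real J * ((d - 1) / 2)) / real n)" by simp
      also have "\<dots> \<le> (1 + c2) * (1 / Y)" using J2 c12 by (intro mult_left_mono) auto
      finally have 2: "?E / real n \<le> (1 + c2) * (1 / Y)" .
      have "(2 * (2 + c1) + (1 + c2)) * (1 / Y) = (2 + c1) * (2 * (1 / Y)) + (1 + c2) * (1 / Y)" by (simp only: algebra_simps)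
      then have "?e + ?E / real n \<le> (2 * (2 + c1) + (1 + c2)) * (1 / Y)" using 1 2 by linarith
      then show "C * (?e + ?E / real n) \<le> c * (1 / Y)" unfolding c_def mult.assoc using C by (intro mult_left_mono) auto
    qed
    finally show "minimax_risk \<Omega> \<nu> Q n (bounded_convex \<Omega> \<Gamma>) \<le> ennreal (c * real n powr (- 2 / (real DIM('a) + 1)))"
      unfolding Yinv d_def .
  qed
qed

text \<open>In the plane no tilt of the meshes lets the last layer dominate both sums. Instead the
  squared error budget 2^-J is divided evenly among the \<open>J\<close> layers, which raises the
  entropy to order J^(3/2) 2^(J/2). Balancing against \<open>n\<close> gives 2^J of order n^(2/3) /
  log n.\<close>

lemma minimax_risk_body_plane:
  fixes \<Omega> :: "'a::euclidean_space set"
  assumes \<Omega>: "convex_body \<Omega>" and dim: "DIM('a) = 2" and \<Gamma>: "0 < \<Gamma>" and dl: "design_law \<Omega> \<nu> p"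
  shows "\<exists>c\<ge>0. \<forall>n Q. n \<ge> 216 \<longrightarrow> subgaussian_errors n \<sigma> Q \<longrightarrow>
    minimax_risk \<Omega> \<nu> Q n (bounded_convex \<Omega> \<Gamma>) \<le> ennreal (c * (real n powr (- 2 / 3) * ln (real n)))"
proof -
  have dim2: "DIM('a) \<ge> 2" using dim by simp
  obtain C where C: "0 < C" and risk: "\<And>J (\<rho> :: real) (r :: nat \<Rightarrow> real) n Q. \<lbrakk>0 < \<rho>; \<forall>i\<in>{1..J}. 0 < r i \<and> r i \<le> 1 / sqrt 2 ^ i; n \<ge> 1; subgaussian_errors n \<sigma> Q\<rbrakk> \<Longrightarrow>
    minimax_risk \<Omega> \<nu> Q n (bounded_convex \<Omega> \<Gamma>) \<le>
      ennreal (C * ((\<rho> ^ 4 + 1 / 2 ^ J + (\<Sum>i\<in>{1..J}. r i ^ 4 * 2 ^ i))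
        + (1 / \<rho> ^ DIM('a) + (\<Sum>i\<in>{1..J}. 1 / sqrt 2 ^ i / r i ^ DIM('a))) / real n))"
    using minimax_risk_body_scales[OF \<Omega> dim2 \<Gamma> dl] by blast
  show ?thesis
  proof (intro exI[of _ "C * 8"] conjI allI impI)
    show "C * 8 \<ge> 0" using C by simp
    fix n :: nat and Q assume n: "n \<ge> 216" and err: "subgaussian_errors n \<sigma> Q"
    define l where "l = ln (real n)"
    have n0: "real n \<ge> 216" using n by simp
    have l1: "1 \<le> l"
    proof -
      have "exp 1 \<le> real n" using exp_le n0 by linarith
      then show ?thesis unfolding l_def using n0 by (simp add: ln_ge_iff)
    qed
    define m where "m = real n powr (1 / 3)"
    \<comment> \<open>216 is the cube of 6: from \<open>m \<ge> 6\<close> follows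
      \<open>2 * l < m^2\<close>, hence \<open>Y > 2\<close> and at least one layer, so that
      dividing by \<open>J\<close> is meaningful.\<close>
    have m6: "6 \<le> m"
    proof -
      have "(6::real) = 216 powr (1 / 3)" using powr_powr[of 6 3 "1 / 3"] by simp
      also have "\<dots> \<le> m" unfolding m_def using n0 by (intro powr_mono2) auto
      finally show ?thesis .
    qed
    have nm: "real n = m ^ 3" unfolding m_def using n0 by (simp add: powr_power)
    have lm: "l < 3 * m"
    proof -
      have "l = 3 * ln m" unfolding l_def nm using m6 by (simp add: ln_realpow)
      also have "\<dots> \<le> 3 * (m - 1)" using m6 by (intro mult_left_mono ln_le_minus_one) auto
      finally show ?thesis by simp
    qed
    define Y where "Y = m\<^sup>2 / l"
    have Y2: "2 < Y"
    proof -
      have "2 * l < 6 * m" using lm by simp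
      also have "\<dots> \<le> m * m" using m6 by (intro mult_right_mono) auto
      finally show ?thesis unfolding Y_def using l1 by (simp add: pos_less_divide_eq power2_eq_square)
    qed
    obtain J :: nat where J: "2 powr real J \<le> Y" "Y \<le> 2 * 2 powr real J" using dyadic_floor[of Y] Y2 by auto
    have J1: "1 \<le> real J" using J(2) Y2 by (cases J) auto
    \<comment> \<open>From 2^J <= n^(2/3) and ln 2 >= 2/3; this replaces the number of layers by
      \<open>ln n\<close>.\<close>
    have Jl: "real J \<le> l"
    proof -
      have "Y \<le> m\<^sup>2 / 1" unfolding Y_def using l1 m6 by (intro divide_left_mono) auto
      then have "2 powr real J \<le> m\<^sup>2" using J(1) by simp
      then have "ln (2 powr real J) \<le> ln (m\<^sup>2)" using m6 by (subst ln_le_cancel_iff) auto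
      then have "real J * ln 2 \<le> 2 * ln m" using m6 by (simp add: ln_realpow ln_powr)
      moreover have "l = 3 * ln m" unfolding l_def nm using m6 by (simp add: ln_realpow)
      moreover have "real J * (2 / 3) \<le> real J * ln 2" using ln2_ge_two_thirds by (intro mult_left_mono) auto
      ultimately show ?thesis by linarith
    qed
    define \<rho> :: real where "\<rho> = 2 powr (- (real J / 4))"
    \<comment> \<open>The fourth powers of the meshes, chosen so that \<open>w i * 2 ^ i\<close> is
      2^-J / J for each layer.\<close>
    define w where "w i = 2 powr (- (real J + real i)) / real J" for i :: nat
    define r where "r i = w i powr (1 / 4)" for i
    have w0: "0 < w i" for i unfolding w_def using J1 by simp
    have \<rho>: "0 < \<rho>" by (simp add: \<rho>_def)
    have r4: "r i ^ 4 = w i" for i using w0[of i] by (simp add: r_def powr_power)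
    have r2: "(r i)\<^sup>2 = 2 powr (- ((real J + real i) / 2)) / sqrt (real J)" for i
    proof -
      have "(r i)\<^sup>2 = sqrt (w i)" using w0[of i] by (simp add: r_def powr_power powr_half_sqrt)
      also have "\<dots> = sqrt (2 powr (- (real J + real i))) / sqrt (real J)" unfolding w_def by (rule real_sqrt_divide)
      also have "sqrt (2 powr (- (real J + real i))) = (2 powr (- (real J + real i))) powr (1 / 2)" by (simp add: powr_half_sqrt)
      also have "\<dots> = 2 powr (- (real J + real i) * (1 / 2))" by (rule powr_powr)
      also have "- (real J + real i) * (1 / 2) = - ((real J + real i) / 2)" by (simp only: mult_minus_left times_divide_eq_right mult_1_right)
      finally show ?thesis .
    qed
    have r: "\<forall>i\<in>{1..J}. 0 < r i \<and> r i \<le> 1 / sqrt 2 ^ i"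
    proof
      fix i assume i: "i \<in> {1..J}"
      have "w i \<le> 2 powr (- (real J + real i)) / 1" unfolding w_def using J1 by (intro divide_left_mono) auto
      also have "\<dots> \<le> 2 powr (- 2 * real i)" using i by (simp add: powr_mono)
      finally have "w i powr (1 / 4) \<le> (2 powr (- 2 * real i)) powr (1 / 4)" using w0[of i] by (intro powr_mono2) auto
      also have "\<dots> = 1 / sqrt 2 ^ i" unfolding sqrt2_powr powr_powr by simp
      finally show "0 < r i \<and> r i \<le> 1 / sqrt 2 ^ i" using w0[of i] by (simp add: r_def)
    qed
    let ?e = "\<rho> ^ 4 + 1 / 2 ^ J + (\<Sum>i\<in>{1..J}. r i ^ 4 * 2 ^ i)"
    let ?E = "1 / \<rho> ^ DIM('a) + (\<Sum>i\<in>{1..J}. 1 / sqrt 2 ^ i / r i ^ DIM('a))"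
    have e: "?e = 3 * 2 powr (- real J)"
    proof -
      have "r i ^ 4 * 2 ^ i = 2 powr (- real J) / real J" for i
      proof -
        have "2 powr (- (real J + real i)) * 2 ^ i = 2 powr (- (real J + real i)) * 2 powr real i" by (simp add: powr_realpow)
        also have "\<dots> = 2 powr (- real J)" unfolding powr_add[symmetric] by simp
        finally show ?thesis unfolding r4 w_def by simp
      qed
      then have "(\<Sum>i\<in>{1..J}. r i ^ 4 * 2 ^ i) = 2 powr (- real J)" using J1 by simp
      moreover have "\<rho> ^ 4 = 2 powr (- real J)" by (simp add: \<rho>_def powr_power)
      moreover have "1 / 2 ^ J = (2::real) powr (- real J)" by (simp add: powr_minus_divide powr_realpow)
      ultimately show ?thesis by simp
    qed
    have E: "?E \<le> 2 * (l * sqrt l * 2 powr (real J / 2))"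
    proof -
      have "1 / sqrt 2 ^ i / r i ^ DIM('a) = sqrt (real J) * 2 powr (real J / 2)" for i
      proof -
        have "1 / sqrt 2 ^ i / r i ^ DIM('a) = sqrt (real J) * (2 powr (- (real i / 2)) / 2 powr (- ((real J + real i) / 2)))"
          unfolding dim r2 sqrt2_powr by simp
        also have "2 powr (- (real i / 2)) / 2 powr (- ((real J + real i) / 2)) = 2 powr (real J / 2)"
          unfolding powr_diff[symmetric] by (simp add: field_simps)
        finally show ?thesis .
      qed
      then have "(\<Sum>i\<in>{1..J}. 1 / sqrt 2 ^ i / r i ^ DIM('a)) = real J * sqrt (real J) * 2 powr (real J / 2)" by simp
      also have "\<dots> \<le> l * sqrt l * 2 powr (real J / 2)"
        using Jl l1 by (intro mult_right_mono mult_mono) auto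
      finally have 1: "(\<Sum>i\<in>{1..J}. 1 / sqrt 2 ^ i / r i ^ DIM('a)) \<le> l * sqrt l * 2 powr (real J / 2)" .
      have "1 / \<rho> ^ DIM('a) = 1 / 2 powr (- (real J / 2))" unfolding dim by (simp add: \<rho>_def powr_power)
      also have "\<dots> = 1 * 1 * 2 powr (real J / 2)" by (simp add: powr_minus_divide)
      also have "1 * 1 * 2 powr (real J / 2) \<le> l * sqrt l * 2 powr (real J / 2)" using l1 by (intro mult_right_mono mult_mono) auto
      finally show ?thesis using 1 by linarith
    qed
    have Yl: "1 / Y = real n powr (- 2 / 3) * ln (real n)"
    proof -
      have "m\<^sup>2 = real n powr (2 / 3)" using n0 by (simp add: m_def powr_power)
      then show ?thesis unfolding Y_def l_def by (simp add: powr_minus_divide)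
    qed
    have eY: "2 powr (- real J) \<le> 2 * (1 / Y)" using J(2) Y2 by (simp add: powr_minus_divide field_simps)
    have EY: "l * sqrt l * 2 powr (real J / 2) / real n \<le> 1 / Y"
    proof -
      have "2 powr (real J / 2) = sqrt (2 powr real J)" by (simp add: powr_half_sqrt[symmetric] powr_powr)
      also have "\<dots> \<le> sqrt Y" using J(1) by simp
      also have "\<dots> = m / sqrt l" unfolding Y_def using m6 by (simp add: real_sqrt_divide)
      finally have "l * sqrt l * 2 powr (real J / 2) \<le> l * sqrt l * (m / sqrt l)" using l1 by (intro mult_left_mono) auto
      also have "\<dots> = l * m" using l1 by simp
      finally have "l * sqrt l * 2 powr (real J / 2) / real n \<le> l * m / m ^ 3" unfolding nm using m6 by (intro divide_right_mono) auto
      also have "\<dots> = 1 / Y" unfolding Y_def using m6 by (simp add: power2_eq_square power3_eq_cube)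
      finally show ?thesis .
    qed
    have "minimax_risk \<Omega> \<nu> Q n (bounded_convex \<Omega> \<Gamma>) \<le> ennreal (C * (?e + ?E / real n))"
      by (rule risk[OF \<rho> r _ err]) (use n in simp)
    also have "\<dots> \<le> ennreal (C * (8 * (1 / Y)))"
    proof (intro ennreal_leI mult_left_mono)
      have "?E / real n \<le> 2 * (l * sqrt l * 2 powr (real J / 2)) / real n" using E by (rule divide_right_mono) simp
      also have "\<dots> = 2 * (l * sqrt l * 2 powr (real J / 2) / real n)" by simp
      also have "\<dots> \<le> 2 * (1 / Y)" using EY by (intro mult_left_mono) auto
      finally show "?e + ?E / real n \<le> 8 * (1 / Y)" using eY unfolding e by linarith
    qed (use C in simp)
    finally show "minimax_risk \<Omega> \<nu> Q n (bounded_convex \<Omega> \<Gamma>) \<le> ennreal (C * 8 * (real n powr (- 2 / 3) * ln (real n)))"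
      unfolding Yl by (simp only: mult.assoc)
  qed
qed

text \<open>For fixed \<open>\<Gamma>\<close>, \<open>\<sigma>\<close> and \<open>\<nu>\<close> at
  most one body qualifies, so the constant found for it can be chosen as a function of these
  parameters.\<close>

lemma minimax_risk_smooth:
  "\<exists>(C :: real \<Rightarrow> real \<Rightarrow> real \<Rightarrow> 'a measure \<Rightarrow> real)
       (N :: real \<Rightarrow> real \<Rightarrow> real \<Rightarrow> 'a measure \<Rightarrow> nat).
      \<forall>(\<Omega> :: 'a::euclidean_space set) \<nu> p (\<Gamma> :: real) (\<sigma> :: real) (n :: nat) Q.
        smooth_convex_body \<Omega> \<longrightarrow> design_law \<Omega> \<nu> p \<longrightarrow>
        \<Gamma> > 0 \<longrightarrow> n \<ge> 1 \<longrightarrow> subgaussian_errors n \<sigma> Q \<longrightarrow>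
        (DIM('a) = 2 \<longrightarrow> n \<ge> N (vol \<Omega>) \<Gamma> \<sigma> \<nu> \<longrightarrow>
          minimax_risk \<Omega> \<nu> Q n (bounded_convex \<Omega> \<Gamma>) \<le>
            ennreal (C (vol \<Omega>) \<Gamma> \<sigma> \<nu> * (real n powr (- 2 / 3) * ln (real n)))) \<and>
        (DIM('a) \<ge> 3 \<longrightarrow>
          minimax_risk \<Omega> \<nu> Q n (bounded_convex \<Omega> \<Gamma>) \<le>
            ennreal (C (vol \<Omega>) \<Gamma> \<sigma> \<nu> * real n powr (- 2 / (real DIM('a) + 1))))"
proof -
  \<comment> \<open>The body is quantified inside \<open>good\<close> and the constant outside; if
    no convex body has \<open>\<nu>\<close> as a design law, or \<open>\<Gamma>\<close> is not
    positive, the condition is vacuous.\<close>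
  define good where "good \<Gamma> \<sigma> \<nu> c \<longleftrightarrow> (\<forall>(\<Omega> :: 'a set) p n Q. convex_body \<Omega> \<longrightarrow> design_law \<Omega> \<nu> p \<longrightarrow>
     \<Gamma> > 0 \<longrightarrow> n \<ge> 1 \<longrightarrow> subgaussian_errors n \<sigma> Q \<longrightarrow>
        (DIM('a) = 2 \<longrightarrow> n \<ge> 216 \<longrightarrow>
          minimax_risk \<Omega> \<nu> Q n (bounded_convex \<Omega> \<Gamma>) \<le> ennreal (c * (real n powr (- 2 / 3) * ln (real n)))) \<and>
        (DIM('a) \<ge> 3 \<longrightarrow>
          minimax_risk \<Omega> \<nu> Q n (bounded_convex \<Omega> \<Gamma>) \<le> ennreal (c * real n powr (- 2 / (real DIM('a) + 1)))))"
    for \<Gamma> \<sigma> :: real and \<nu> :: "'a measure" and c :: real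
  have ex: "\<exists>c. good \<Gamma> \<sigma> \<nu> c" for \<Gamma> \<sigma> \<nu>
  proof (cases "\<Gamma> > 0 \<and> (\<exists>(\<Omega> :: 'a set) p. convex_body \<Omega> \<and> design_law \<Omega> \<nu> p)")
    case False
    then show ?thesis unfolding good_def by blast
  next
    case True
    then obtain \<Omega> :: "'a set" and p where \<Gamma>: "\<Gamma> > 0" and \<Omega>: "convex_body \<Omega>" "design_law \<Omega> \<nu> p" by blast
    have uniq: "\<Omega>' = \<Omega>" if "convex_body \<Omega>'" "design_law \<Omega>' \<nu> p'" for \<Omega>' p'
      by (rule design_law_body_unique[OF that \<Omega>])
    show ?thesis
    proof (cases "DIM('a) = 2")
      case True
      obtain c where c: "\<And>n Q. n \<ge> 216 \<Longrightarrow> subgaussian_errors n \<sigma> Q \<Longrightarrow>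
         minimax_risk \<Omega> \<nu> Q n (bounded_convex \<Omega> \<Gamma>) \<le> ennreal (c * (real n powr (- 2 / 3) * ln (real n)))"
        using minimax_risk_body_plane[OF \<Omega>(1) True \<Gamma> \<Omega>(2)] by blast
      have "good \<Gamma> \<sigma> \<nu> c" unfolding good_def using c True by (auto dest: uniq)
      then show ?thesis by blast
    next
      case no2: False
      show ?thesis
      proof (cases "DIM('a) \<ge> 3")
        case True
        obtain c where c: "\<And>n Q. n \<ge> 1 \<Longrightarrow> subgaussian_errors n \<sigma> Q \<Longrightarrow>
           minimax_risk \<Omega> \<nu> Q n (bounded_convex \<Omega> \<Gamma>) \<le> ennreal (c * real n powr (- 2 / (real DIM('a) + 1)))"
          using minimax_risk_body_high[OF \<Omega>(1) True \<Gamma> \<Omega>(2)] by blast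
        have "good \<Gamma> \<sigma> \<nu> c" unfolding good_def using c no2 by (auto dest: uniq)
        then show ?thesis by blast
      next
        case False
        then show ?thesis using no2 unfolding good_def by blast
      qed
    qed
  qed
  define C where "C v \<Gamma> \<sigma> \<nu> = (SOME c. good \<Gamma> \<sigma> \<nu> c)" for v \<Gamma> \<sigma> :: real and \<nu>
  have C: "good \<Gamma> \<sigma> \<nu> (C v \<Gamma> \<sigma> \<nu>)" for v \<Gamma> \<sigma> \<nu> unfolding C_def by (rule someI_ex[OF ex])
  show ?thesis
    by (rule exI[of _ C], rule exI[of _ "\<lambda>_ _ _ _. 216"])
      (use C in \<open>unfold good_def smooth_convex_body_def, blast\<close>)
qed

theorem theorem2p3:
  shows
   "(\<exists>C :: real \<Rightarrow> real \<Rightarrow> real \<Rightarrow> ennreal \<Rightarrow> ennreal \<Rightarrow> real.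
      \<forall>(\<Omega> :: 'a::euclidean_space set) \<nu> p (\<Gamma> :: real) (\<sigma> :: real) (k :: nat) (n :: nat) Q.
        convex_body \<Omega> \<longrightarrow> \<Omega> \<in> simplicial_polytopes k \<longrightarrow> design_law \<Omega> \<nu> p \<longrightarrow>
        \<Gamma> > 0 \<longrightarrow> n \<ge> 1 \<longrightarrow> subgaussian_errors n \<sigma> Q \<longrightarrow>
        minimax_risk \<Omega> \<nu> Q n (bounded_convex \<Omega> \<Gamma>) \<le>
          ennreal (C (vol \<Omega>) \<Gamma> \<sigma> (density_inf \<Omega> p) (density_sup \<Omega> p) *
            (real k / real n) powr (4 / (real DIM('a) + 4))))
    \<and>
    (\<exists>(C :: real \<Rightarrow> real \<Rightarrow> real \<Rightarrow> 'a measure \<Rightarrow> real)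
       (N :: real \<Rightarrow> real \<Rightarrow> real \<Rightarrow> 'a measure \<Rightarrow> nat).
      \<forall>(\<Omega> :: 'a set) \<nu> p (\<Gamma> :: real) (\<sigma> :: real) (n :: nat) Q.
        smooth_convex_body \<Omega> \<longrightarrow> design_law \<Omega> \<nu> p \<longrightarrow>
        \<Gamma> > 0 \<longrightarrow> n \<ge> 1 \<longrightarrow> subgaussian_errors n \<sigma> Q \<longrightarrow>
        (DIM('a) = 2 \<longrightarrow> n \<ge> N (vol \<Omega>) \<Gamma> \<sigma> \<nu> \<longrightarrow>
          minimax_risk \<Omega> \<nu> Q n (bounded_convex \<Omega> \<Gamma>) \<le>
            ennreal (C (vol \<Omega>) \<Gamma> \<sigma> \<nu> * (real n powr (- 2 / 3) * ln (real n)))) \<and>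
        (DIM('a) \<ge> 3 \<longrightarrow>
          minimax_risk \<Omega> \<nu> Q n (bounded_convex \<Omega> \<Gamma>) \<le>
            ennreal (C (vol \<Omega>) \<Gamma> \<sigma> \<nu> * real n powr (- 2 / (real DIM('a) + 1)))))"
  using minimax_risk_polytope minimax_risk_smooth by (rule conjI)

end
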